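(* Let $G=(V,E)$ be a graph with $n$ vertices and $m$ edges, and let $\mathcal{S}(G)$ be its set of minimal separators. In $O(n^5m)$ time one can construct a collection $(\mathcal{T}_S)_{S\in\mathcal{S}(G)}$ of families of trees such that for every well-structured $4$-Steiner root $T$ of $G$ and every $S\in\mathcal{S}(G)$, the subtree $T\langle S\rangle$ is Steiner-equivalent to some tree in $\mathcal{T}_S$.
   Context: A $4$-Steiner root of $G$ is a tree $T$ with $V\subseteq V(T)$ such that for distinct $u,v\in V$, $uv\in E$ iff $\mathrm{dist}_T(u,v)\le 4$; nodes in $V$ are real, others Steiner, and $\mathrm{Real}(T')=V(T')\cap V$. $T\langle X\rangle$ is the smallest subtree of $T$ containing $X$; $\mathcal{C}(T')$ is the center of a tree $T'$. A clique-intersection is a nonempty intersection of one or more maximal cliques of $G$. For a clique-intersection $X$, $v\in X$ is $X$-constrained if either there is a clique-intersection $X'\subsetneq X$ with $v\in X'$, $|X'|\ge2$, or there are clique-intersections $X_1,X_2$ with $X\subsetneq X_1$ and $X\cap X_2=\{v\}\subsetneq X_1\cap X_2$; otherwise $v$ is $X$-free. A $4$-Steiner root $T$ is well-structured if for every clique-intersection $X$: (1) every $X$-free vertex is a leaf of $T\langle X\rangle$ with eccentricity $\mathrm{diam}(T\langle X\rangle)$ in $T\langle X\rangle$; (2) some $c\in\mathcal{C}(T\langle X\rangle)$ satisfies $\mathrm{dist}_T(v,c)=\mathrm{dist}_T(v,\mathcal{C}(T\langle X\rangle))$ for all $X$-free $v$ except possibly one; (3) internal nodes of paths between $\mathcal{C}(T\langle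 X\rangle)$ and $X$-free vertices are Steiner nodes of degree two; (4) if $X$ is a maximal clique containing an $X$-free vertex then $\mathrm{diam}(T\langle X\rangle)=4$. Two trees $T_1,T_2$ are Steiner-equivalent if $\mathrm{Real}(T_1)=\mathrm{Real}(T_2)$ and there is an isomorphism $V(T_1)\to V(T_2)$ fixing every real node. *)

theory Defs
  imports Main
begin

section \<open>Finite simple graphs\<close>

type_synonym 'a graph = "'a set \<times> 'a set set"

abbreviation verts :: "'a graph \<Rightarrow> 'a set" where "verts \<equiv> fst"
abbreviation edges :: "'a graph \<Rightarrow> 'a set set" where "edges \<equiv> snd"

definition simple_graph :: "'a graph \<Rightarrow> bool" where
  "simple_graph G \<longleftrightarrow> finite (verts G) \<and> (\<forall>e\<in>edges G. e \<subseteq> verts G \<and> card e = 2)"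

definition induced :: "'a graph \<Rightarrow> 'a set \<Rightarrow> 'a graph" where
  "induced G U = (verts G \<inter> U, {e \<in> edges G. e \<subseteq> U})"

definition is_path :: "'a graph \<Rightarrow> 'a \<Rightarrow> 'a list \<Rightarrow> 'a \<Rightarrow> bool" where
  "is_path G u p v \<longleftrightarrow> p \<noteq> [] \<and> hd p = u \<and> last p = v \<and> distinct p \<and> set p \<subseteq> verts G \<and>
     successively (\<lambda>x y. {x, y} \<in> edges G) p"

definition connected_graph :: "'a graph \<Rightarrow> bool" where
  "connected_graph G \<longleftrightarrow> (\<forall>u\<in>verts G. \<forall>v\<in>verts G. \<exists>p. is_path G u p v)"

definition acyclic_graph :: "'a graph \<Rightarrow> bool" where
  "acyclic_graph G \<longleftrightarrow> \<not> (\<exists>u p v. is_path G u p v \<and> length p \<ge> 3 \<and> {v, u} \<in> edges G)"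

definition degree :: "'a graph \<Rightarrow> 'a \<Rightarrow> nat" where
  "degree G v = card {e \<in> edges G. v \<in> e}"

text \<open>Only meaningful if some path joins the two vertices; it is used for trees only.\<close>
definition dist :: "'a graph \<Rightarrow> 'a \<Rightarrow> 'a \<Rightarrow> nat" where
  "dist G u v = (LEAST k. \<exists>p. is_path G u p v \<and> length p = Suc k)"

definition ecc :: "'a graph \<Rightarrow> 'a \<Rightarrow> nat" where
  "ecc G v = Max (dist G v ` verts G)"

definition diam :: "'a graph \<Rightarrow> nat" where
  "diam G = Max (ecc G ` verts G)"

definition center :: "'a graph \<Rightarrow> 'a set" where
  "center G = {c \<in> verts G. \<forall>v\<in>verts G. ecc G c \<le> ecc G v}"

definition separates :: "'a graph \<Rightarrow> 'a set \<Rightarrow> 'a \<Rightarrow> 'a \<Rightarrow> bool" where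
  "separates G S a b \<longleftrightarrow> a \<in> verts G - S \<and> b \<in> verts G - S \<and>
     \<not> (\<exists>p. is_path (induced G (verts G - S)) a p b)"

definition minimal_separators :: "'a graph \<Rightarrow> 'a set set" where
  "minimal_separators G = {S. S \<subseteq> verts G \<and>
     (\<exists>a b. separates G S a b \<and> (\<forall>S'. S' \<subset> S \<longrightarrow> \<not> separates G S' a b))}"

definition clique :: "'a graph \<Rightarrow> 'a set \<Rightarrow> bool" where
  "clique G K \<longleftrightarrow> K \<subseteq> verts G \<and> (\<forall>u\<in>K. \<forall>v\<in>K. u \<noteq> v \<longrightarrow> {u, v} \<in> edges G)"

definition maximal_clique :: "'a graph \<Rightarrow> 'a set \<Rightarrow> bool" where
  "maximal_clique G K \<longleftrightarrow> clique G K \<and> (\<forall>K'. clique G K' \<and> K \<subseteq> K' \<longrightarrow> K' = K)"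

definition clique_intersection :: "'a graph \<Rightarrow> 'a set \<Rightarrow> bool" where
  "clique_intersection G X \<longleftrightarrow> X \<noteq> {} \<and>
     (\<exists>F. F \<noteq> {} \<and> (\<forall>K\<in>F. maximal_clique G K) \<and> X = \<Inter>F)"


section \<open>Trees and Steiner roots\<close>

text \<open>The graph without vertices counts as a (degenerate) tree. It arises only as the smallest
  subtree containing the empty set, which is a minimal separator of every disconnected graph.\<close>
definition tree :: "'a graph \<Rightarrow> bool" where
  "tree T \<longleftrightarrow> simple_graph T \<and> connected_graph T \<and> acyclic_graph T"

definition subtree :: "'a graph \<Rightarrow> 'a graph \<Rightarrow> bool" where
  "subtree T' T \<longleftrightarrow> tree T' \<and> verts T' \<subseteq> verts T \<and> edges T' \<subseteq> edges T"

definition span_tree :: "'a graph \<Rightarrow> 'a set \<Rightarrow> 'a graph" (\<open>_\<langle>_\<rangle>\<close> [1000, 0] 1000) where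
  "T\<langle>X\<rangle> = (THE T'. subtree T' T \<and> X \<subseteq> verts T' \<and>
     (\<forall>T''. subtree T'' T \<and> X \<subseteq> verts T'' \<longrightarrow> subtree T' T''))"

definition steiner_root :: "nat \<Rightarrow> 'a graph \<Rightarrow> 'a graph \<Rightarrow> bool" where
  "steiner_root k G T \<longleftrightarrow> tree T \<and> verts G \<subseteq> verts T \<and>
     (\<forall>u\<in>verts G. \<forall>v\<in>verts G. u \<noteq> v \<longrightarrow> ({u, v} \<in> edges G \<longleftrightarrow> dist T u v \<le> k))"

definition constrained :: "'a graph \<Rightarrow> 'a set \<Rightarrow> 'a \<Rightarrow> bool" where
  "constrained G X v \<longleftrightarrow>
     (\<exists>X'. clique_intersection G X' \<and> X' \<subset> X \<and> v \<in> X' \<and> card X' \<ge> 2) \<or>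
     (\<exists>X1 X2. clique_intersection G X1 \<and> clique_intersection G X2 \<and>
        X \<subset> X1 \<and> X \<inter> X2 = {v} \<and> {v} \<subset> X1 \<inter> X2)"

definition free_vertices :: "'a graph \<Rightarrow> 'a set \<Rightarrow> 'a set" where
  "free_vertices G X = {v \<in> X. \<not> constrained G X v}"

definition dist_set :: "'a graph \<Rightarrow> 'a \<Rightarrow> 'a set \<Rightarrow> nat" where
  "dist_set T v C = Min (dist T v ` C)"

text \<open>A leaf is a node of degree at most one, so that the node of a one-node tree is a leaf.
  In the third condition, a path between the center \<open>C\<close> and a vertex is a path that meets \<open>C\<close>
  in its first node only, as usual for paths between two vertex sets; the second node of a
  bicenter is therefore not an internal node of such a path. Degrees of Steiner nodes are
  taken in \<open>T\<close>.\<close>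
definition well_structured :: "'a graph \<Rightarrow> 'a graph \<Rightarrow> bool" where
  "well_structured G T \<longleftrightarrow> steiner_root 4 G T \<and>
     (\<forall>X. clique_intersection G X \<longrightarrow>
        (\<forall>v\<in>free_vertices G X. degree T\<langle>X\<rangle> v \<le> 1 \<and> ecc T\<langle>X\<rangle> v = diam T\<langle>X\<rangle>) \<and>
        (\<exists>c\<in>center T\<langle>X\<rangle>.
           card {v \<in> free_vertices G X. dist T v c \<noteq> dist_set T v (center T\<langle>X\<rangle>)} \<le> 1) \<and>
        (\<forall>v\<in>free_vertices G X. \<forall>c\<in>center T\<langle>X\<rangle>. \<forall>p.
           is_path T c p v \<and> set p \<inter> center T\<langle>X\<rangle> = {c} \<longrightarrow>
             (\<forall>x\<in>set p - {c, v}. x \<notin> verts G \<and> degree T x = 2)) \<and>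
        (maximal_clique G X \<and> free_vertices G X \<noteq> {} \<longrightarrow> diam T\<langle>X\<rangle> = 4))"

text \<open>\<open>V\<close> is the set of real vertices.\<close>
definition steiner_equivalent :: "'a set \<Rightarrow> 'a graph \<Rightarrow> 'a graph \<Rightarrow> bool" where
  "steiner_equivalent V T1 T2 \<longleftrightarrow> verts T1 \<inter> V = verts T2 \<inter> V \<and>
     (\<exists>f. bij_betw f (verts T1) (verts T2) \<and>
        (\<forall>u\<in>verts T1. \<forall>v\<in>verts T1. {u, v} \<in> edges T1 \<longleftrightarrow> {f u, f v} \<in> edges T2) \<and>
        (\<forall>v\<in>verts T1 \<inter> V. f v = v))"


section \<open>Word random access machines\<close>

text \<open>Programs of a unit-cost word RAM with indirect addressing and arithmetic on natural
  numbers, written with structured control flow instead of jumps. A memory maps addresses to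
  contents; \<open>Load a\<close> is the content of the cell whose address is the value of \<open>a\<close>,
  \<open>Store a e\<close> writes the value of \<open>e\<close> to the cell whose address is the value of \<open>a\<close>, and a
  condition holds iff its value is nonzero.\<close>

type_synonym mem = "nat \<Rightarrow> nat"

datatype exp = Const nat | Load exp | Add exp exp | Sub exp exp | Mul exp exp | Div exp exp

datatype com = Skip | Store exp exp | Seq com com | If exp com com | While exp com

fun val :: "exp \<Rightarrow> mem \<Rightarrow> nat" where
  "val (Const a) s = a"
| "val (Load e) s = s (val e s)"
| "val (Add e f) s = val e s + val f s"
| "val (Sub e f) s = val e s - val f s"
| "val (Mul e f) s = val e s * val f s"
| "val (Div e f) s = val e s div val f s"

text \<open>\<open>fits W e s\<close>: all values computed while evaluating \<open>e\<close> (addresses included) are less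
  than \<open>W\<close>, that is, they fit into a machine word.\<close>
fun fits :: "nat \<Rightarrow> exp \<Rightarrow> mem \<Rightarrow> bool" where
  "fits W (Const a) s \<longleftrightarrow> a < W"
| "fits W (Load e) s \<longleftrightarrow> fits W e s \<and> s (val e s) < W"
| "fits W (Add e f) s \<longleftrightarrow> fits W e s \<and> fits W f s \<and> val e s + val f s < W"
| "fits W (Sub e f) s \<longleftrightarrow> fits W e s \<and> fits W f s"
| "fits W (Mul e f) s \<longleftrightarrow> fits W e s \<and> fits W f s \<and> val e s * val f s < W"
| "fits W (Div e f) s \<longleftrightarrow> fits W e s \<and> fits W f s"

fun cost :: "exp \<Rightarrow> nat" where
  "cost (Const a) = 1"
| "cost (Load e) = 1 + cost e"
| "cost (Add e f) = 1 + cost e + cost f"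
| "cost (Sub e f) = 1 + cost e + cost f"
| "cost (Mul e f) = 1 + cost e + cost f"
| "cost (Div e f) = 1 + cost e + cost f"

text \<open>\<open>exec W c s t s'\<close>: started in memory \<open>s\<close>, program \<open>c\<close> halts in memory \<open>s'\<close> after \<open>t\<close>
  steps, and no value exceeds the word bound \<open>W\<close> on the way (a program that overflows is stuck).\<close>
inductive exec :: "nat \<Rightarrow> com \<Rightarrow> mem \<Rightarrow> nat \<Rightarrow> mem \<Rightarrow> bool" for W where
  "exec W Skip s 1 s"
| "fits W a s \<Longrightarrow> fits W e s \<Longrightarrow>
     exec W (Store a e) s (1 + cost a + cost e) (s(val a s := val e s))"
| "exec W c1 s t1 s1 \<Longrightarrow> exec W c2 s1 t2 s2 \<Longrightarrow> exec W (Seq c1 c2) s (t1 + t2) s2"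
| "fits W b s \<Longrightarrow> val b s \<noteq> 0 \<Longrightarrow> exec W c1 s t s1 \<Longrightarrow> exec W (If b c1 c2) s (1 + cost b + t) s1"
| "fits W b s \<Longrightarrow> val b s = 0 \<Longrightarrow> exec W c2 s t s1 \<Longrightarrow> exec W (If b c1 c2) s (1 + cost b + t) s1"
| "fits W b s \<Longrightarrow> val b s = 0 \<Longrightarrow> exec W (While b c) s (1 + cost b) s"
| "fits W b s \<Longrightarrow> val b s \<noteq> 0 \<Longrightarrow> exec W c s t1 s1 \<Longrightarrow> exec W (While b c) s1 t2 s2 \<Longrightarrow>
     exec W (While b c) s (1 + cost b + t1 + t2) s2"


section \<open>Input and output\<close>

text \<open>Lists are stored as their length followed by their elements, so that the encoding
  determines the list.\<close>
definition enc :: "('a \<Rightarrow> nat list) \<Rightarrow> 'a list \<Rightarrow> nat list" where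
  "enc f xs = length xs # concat (map f xs)"

type_synonym tree_code = "nat list \<times> (nat \<times> nat) list"

definition edge_sets :: "(nat \<times> nat) list \<Rightarrow> nat set set" where
  "edge_sets es = (\<lambda>(u, v). {u, v}) ` set es"

definition decode :: "tree_code \<Rightarrow> nat graph" where
  "decode \<tau> = (set (fst \<tau>), edge_sets (snd \<tau>))"

definition enc_vertices :: "nat list \<Rightarrow> nat list" where
  "enc_vertices = enc (\<lambda>v. [v])"

definition enc_edges :: "(nat \<times> nat) list \<Rightarrow> nat list" where
  "enc_edges = enc (\<lambda>(u, v). [u, v])"

definition enc_tree :: "tree_code \<Rightarrow> nat list" where
  "enc_tree \<tau> = enc_vertices (fst \<tau>) @ enc_edges (snd \<tau>)"

text \<open>A collection of families of trees is an association list from vertex sets to lists of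
  explicitly given trees. A set without entry has the empty family; an arbitrary graph may have
  exponentially many minimal separators, so that they cannot all be listed.\<close>
type_synonym collection = "(nat list \<times> tree_code list) list"

definition enc_collection :: "collection \<Rightarrow> nat list" where
  "enc_collection = enc (\<lambda>(ss, \<tau>s). enc_vertices ss @ enc enc_tree \<tau>s)"

definition family :: "collection \<Rightarrow> nat set \<Rightarrow> nat graph set" where
  "family coll S = {decode \<tau> | ss \<tau>s \<tau>. (ss, \<tau>s) \<in> set coll \<and> set ss = S \<and> \<tau> \<in> set \<tau>s}"

text \<open>Each edge of \<open>G\<close> is listed exactly once, in arbitrary order and orientation.\<close>
definition lists_edges :: "(nat \<times> nat) list \<Rightarrow> nat graph \<Rightarrow> bool" where
  "lists_edges es G \<longleftrightarrow> edge_sets es = edges G \<and> length es = card (edges G)"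

text \<open>The input occupies the first cells: the number of vertices, the number of edges, and the
  edges. All other cells are zero. The output starts at the address found in cell zero.\<close>
definition input_mem :: "nat \<Rightarrow> (nat \<times> nat) list \<Rightarrow> mem" where
  "input_mem n es = (\<lambda>i. let xs = n # enc_edges es in if i < length xs then xs ! i else 0)"

definition holds_output :: "mem \<Rightarrow> nat list \<Rightarrow> bool" where
  "holds_output s xs \<longleftrightarrow> map s [s 0 ..< s 0 + length xs] = xs"

end

theory Submission
  imports Defs "HOL-Library.Nat_Bijection"
begin

text \<open>Let \<open>T\<close> be a 4-Steiner root of \<open>G\<close>. Two vertices are adjacent iff the balls of radius 2 around
  them in \<open>T\<close> intersect. Hence a minimal separator \<open>S\<close> is the common neighbourhood of two
  vertices \<open>a\<close> and \<open>b\<close> that it separates, and there is an edge \<open>xy\<close> of \<open>T\<close> such that \<open>S\<close> consists of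
  vertices at distance at most 1 from \<open>x\<close> or \<open>y\<close>, while the components of \<open>a\<close> and \<open>b\<close> in \<open>G - S\<close> lie
  on the sides of \<open>x\<close> and \<open>y\<close>. So the span of \<open>S\<close> is empty, a star, or a bistar with centers \<open>x\<close> and
  \<open>y\<close>, and it remains to guess the side of each leaf. Either some neighbourhood in \<open>G\<close> cuts \<open>S\<close> along the
  two sides, or the side of a constrained leaf can be read off from \<open>G\<close> and the center of its side: it has a
  neighbour outside \<open>S\<close>, not adjacent to all of \<open>S\<close>, that lies in the component of \<open>a\<close> or \<open>b\<close> or is adjacent to the center.
  The remaining leaves are free, and in a well-structured root all of them but one are on the same
  side. This leaves polynomially many candidates, given by the two centers and either a
  neighbourhood or the exceptional free leaf.

  The program tries \<open>a\<close> among the endpoints of the \<open>m\<close> edges and \<open>b\<close> among the \<open>n\<close> vertices. This finds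
  every minimal separator if there is an edge at all, and each of the \<open>2mn\<close> pairs may take time \<open>n\<^sup>4\<close>.\<close>

section \<open>Paths and distances\<close>

text \<open>The radii behind the guess are as follows. A vertex that sees (is adjacent in G to) a
  leaf across the edge xy is within 2 of the center of its own side, and then it sees all of
  \<open>S\<close>. So a vertex outside \<open>S\<close> that misses part of \<open>S\<close> sees
  leaves of its own side only; if it is moreover within 3 of its center, it sees all of these, and
  its neighbourhood cuts \<open>S\<close>. When no neighbourhood does so, a leaf constrained by a
  smaller clique-intersection must share such a vertex with its real center, while a larger
  clique-intersection yields one in the component of \<open>a\<close> or \<open>b\<close>. Condition
  (2) of a well-structured root favours one center; the side to be guessed is the opposite one,
  because all of its free leaves are exceptions. The exponent 4 comes from a family of order
  \<open>n ^ 3\<close> trees of size n, and from comparing S with at most 2mn earlier pairs on n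
  bits, which is within \<open>n ^ 4\<close> since m is at most \<open>n ^ 2\<close>. Correctness is
  proved over arrays with a functional semantics; the word bound is recovered from the running time
  at the end.\<close>

lemma is_path_single: "u \<in> verts G \<Longrightarrow> is_path G u [u] u"
  by (simp add: is_path_def)

lemma is_path_Cons_Cons:
  "is_path G u (u' # w # p) v \<longleftrightarrow>
     u' = u \<and> u \<in> verts G \<and> {u, w} \<in> edges G \<and> u \<notin> set (w # p) \<and> is_path G w (w # p) v"
  by (auto simp: is_path_def)

lemma is_path_Cons:
  assumes "{u, w} \<in> edges G" "u \<in> verts G" "is_path G w p v" "u \<notin> set p"
  shows "is_path G u (u # p) v"
  using assms by (cases p) (auto simp: is_path_def)

lemma is_path_ends:
  assumes "is_path G u p v"
  shows "u \<in> set p" "v \<in> set p" "u \<in> verts G" "v \<in> verts G" "p \<noteq> []" "set p \<subseteq> verts G"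
  using assms unfolding is_path_def by (auto simp: subset_iff)

lemma is_path_split:
  assumes "is_path G u (p1 @ w # p2) v"
  shows "is_path G u (p1 @ [w]) w" "is_path G w (w # p2) v"
  using assms unfolding is_path_def
  by (auto simp: successively_append_iff hd_append split: if_splits)

lemma is_path_append:
  assumes "is_path G u p w" "is_path G w' q v" "{w, w'} \<in> edges G" "set p \<inter> set q = {}"
  shows "is_path G u (p @ q) v"
  using assms unfolding is_path_def by (auto simp: successively_append_iff)

lemma is_path_rev: "is_path G u p v \<Longrightarrow> is_path G v (rev p) u"
  unfolding is_path_def by (auto simp: hd_rev last_rev insert_commute)

text \<open>Paths have distinct vertices, so plain concatenation can fail. If the next vertex
  already lies on the joined path, that path is replaced by its suffix from there, which only
  shortens it. The length bound gives the triangle inequality.\<close>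

lemma is_path_join:
  assumes "is_path G u p w" "is_path G w q v"
  shows "\<exists>r. is_path G u r v \<and> set r \<subseteq> set p \<union> set q \<and> Suc (length r) \<le> length p + length q"
  using assms
proof (induction p arbitrary: u)
  case Nil
  then show ?case by (simp add: is_path_def)
next
  case (Cons z p)
  have z: "z = u" using Cons.prems(1) by (simp add: is_path_def)
  show ?case
  proof (cases p)
    case Nil
    then have "u = w" using Cons.prems(1) z by (simp add: is_path_def)
    then show ?thesis using Cons.prems(2) Nil by auto
  next
    case (Cons y p')
    have y: "is_path G y p w" "{u, y} \<in> edges G" "u \<in> verts G"
      using Cons.prems(1) z unfolding Cons is_path_Cons_Cons by auto
    obtain r where r: "is_path G y r v" "set r \<subseteq> set p \<union> set q" "Suc (length r) \<le> length p + length q"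
      using Cons.IH[OF y(1) Cons.prems(2)] by auto
    show ?thesis
    proof (cases "u \<in> set r")
      case True
      then obtain r1 r2 where "r = r1 @ u # r2" by (meson split_list)
      then show ?thesis using r is_path_split(2)[of G y r1 u r2 v]
        by (intro exI[of _ "u # r2"]) auto
    next
      case False
      then show ?thesis using r y z is_path_Cons[OF y(2,3) r(1)]
        by (intro exI[of _ "u # r"]) auto
    qed
  qed
qed

lemma is_path_mono:
  assumes "is_path H u p v" "verts H \<subseteq> verts G" "edges H \<subseteq> edges G"
  shows "is_path G u p v"
  using assms unfolding is_path_def by (auto intro: successively_mono)

lemma is_path_induced:
  "is_path (induced G U) u p v \<longleftrightarrow> is_path G u p v \<and> set p \<subseteq> U"
proof (induction p arbitrary: u)
  case Nil
  then show ?case by (simp add: is_path_def)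
next
  case (Cons z p)
  show ?case
  proof (cases p)
    case Nil
    then show ?thesis by (auto simp: is_path_def induced_def)
  next
    case (Cons y p')
    show ?thesis using Cons.IH[of y]
      unfolding Cons is_path_Cons_Cons by (auto simp: induced_def)
  qed
qed

lemma dist_le_path: "is_path G u p v \<Longrightarrow> Suc (dist G u v) \<le> length p"
proof -
  assume p: "is_path G u p v"
  then have "length p = Suc (length p - 1)" using is_path_ends(5)[OF p] by (cases p) auto
  then have "dist G u v \<le> length p - 1"
    unfolding dist_def using p by (intro Least_le) auto
  then show ?thesis using \<open>length p = Suc (length p - 1)\<close> by linarith
qed

lemma ex_geodesic:
  assumes "connected_graph G" "u \<in> verts G" "v \<in> verts G"
  shows "\<exists>p. is_path G u p v \<and> length p = Suc (dist G u v)"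
proof -
  obtain p where p: "is_path G u p v" using assms by (auto simp: connected_graph_def)
  then have "length p = Suc (length p - 1)" using is_path_ends(5)[OF p] by (cases p) auto
  then have "\<exists>k p. is_path G u p v \<and> length p = Suc k" using p by blast
  then show ?thesis unfolding dist_def by (rule LeastI_ex)
qed

lemma dist_self [simp]: "u \<in> verts G \<Longrightarrow> dist G u u = 0"
  using dist_le_path[OF is_path_single, of u G] by simp

lemma dist_eq_0_iff:
  assumes "connected_graph G" "u \<in> verts G" "v \<in> verts G"
  shows "dist G u v = 0 \<longleftrightarrow> u = v"
proof
  assume "dist G u v = 0"
  then obtain p where "is_path G u p v" "length p = Suc 0" using ex_geodesic[OF assms] by auto
  then show "u = v" by (cases p) (auto simp: is_path_def)
qed (use assms in simp)

lemma dist_triangle: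
  assumes "connected_graph G" "u \<in> verts G" "v \<in> verts G" "w \<in> verts G"
  shows "dist G u v \<le> dist G u w + dist G w v"
proof -
  obtain p q where "is_path G u p w" "length p = Suc (dist G u w)"
    "is_path G w q v" "length q = Suc (dist G w v)"
    using ex_geodesic assms by metis
  moreover from this obtain r where "is_path G u r v" "Suc (length r) \<le> length p + length q"
    using is_path_join[of G u p w q v] by auto
  ultimately show ?thesis using dist_le_path[of G u r v] by linarith
qed

lemma dist_commute:
  assumes "connected_graph G" "u \<in> verts G" "v \<in> verts G"
  shows "dist G u v = dist G v u"
proof -
  have "dist G u v \<le> dist G v u" if "u \<in> verts G" "v \<in> verts G" for u v
    using ex_geodesic[OF assms(1) that(2,1)] is_path_rev[of G v _ u] dist_le_path[of G u]
    by (metis length_rev Suc_le_mono)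
  then show ?thesis using assms by (simp add: le_antisym)
qed

lemma geodesic_between:
  assumes "connected_graph G" "is_path G u p v" "length p = Suc (dist G u v)" "z \<in> set p"
  shows "dist G u z + dist G z v = dist G u v"
proof -
  obtain p1 p2 where p: "p = p1 @ z # p2" using assms(4) by (meson split_list)
  have "Suc (dist G u z) \<le> length (p1 @ [z])" "Suc (dist G z v) \<le> length (z # p2)"
    using is_path_split[of G u p1 z p2 v] assms(2) dist_le_path[of G] unfolding p by blast+
  moreover have "dist G u v \<le> dist G u z + dist G z v"
    using assms is_path_ends[OF assms(2)] by (intro dist_triangle) auto
  ultimately show ?thesis using assms(3) p by simp
qed

section \<open>Trees as metric spaces\<close>

locale tree_graph =
  fixes T :: "'a graph"
  assumes tree: "tree T"
begin

abbreviation d where "d \<equiv> dist T"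

lemma conn: "connected_graph T" and acyc: "acyclic_graph T" and simple: "simple_graph T"
  using tree by (auto simp: tree_def)

lemma finite_verts: "finite (verts T)"
  using simple by (simp add: simple_graph_def)

lemma edgeD:
  assumes "{x, y} \<in> edges T"
  shows "x \<in> verts T" "y \<in> verts T" "x \<noteq> y"
  using assms simple by (force simp: simple_graph_def)+

lemma d_triangle: "u \<in> verts T \<Longrightarrow> v \<in> verts T \<Longrightarrow> w \<in> verts T \<Longrightarrow> d u v \<le> d u w + d w v"
  and d_commute: "u \<in> verts T \<Longrightarrow> v \<in> verts T \<Longrightarrow> d u v = d v u"
  and d_eq_0_iff: "u \<in> verts T \<Longrightarrow> v \<in> verts T \<Longrightarrow> d u v = 0 \<longleftrightarrow> u = v"
  using dist_triangle dist_commute dist_eq_0_iff conn by metis+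

lemma d_eq_1_iff:
  assumes "u \<in> verts T" "v \<in> verts T"
  shows "d u v = 1 \<longleftrightarrow> {u, v} \<in> edges T"
proof
  assume "d u v = 1"
  then obtain p where p: "is_path T u p v" "length p = Suc (Suc 0)"
    using ex_geodesic[OF conn assms] by auto
  then obtain w z where "p = [w, z]"
    by (cases p; cases "tl p") auto
  with p(1) show "{u, v} \<in> edges T" unfolding is_path_def by auto
next
  assume e: "{u, v} \<in> edges T"
  then have "is_path T u [u, v] v" using edgeD[OF e] by (simp add: is_path_def)
  then have "d u v \<le> 1" using dist_le_path by fastforce
  moreover have "d u v \<noteq> 0" using d_eq_0_iff edgeD[OF e] by blast
  ultimately show "d u v = 1" by simp
qed

lemma d_edge: "{u, v} \<in> edges T \<Longrightarrow> d u v = 1"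
  using d_eq_1_iff edgeD by blast

lemma step_towards:
  assumes "u \<in> verts T" "v \<in> verts T" "u \<noteq> v"
  obtains w where "{u, w} \<in> edges T" "d u v = Suc (d w v)"
proof -
  obtain p where p: "is_path T u p v" "length p = Suc (d u v)"
    using ex_geodesic[OF conn assms(1,2)] by auto
  then obtain w q where q: "p = u # w # q"
    using assms(3) unfolding is_path_def by (cases p; cases "tl p") auto
  have w: "{u, w} \<in> edges T" "is_path T w (w # q) v"
    using p(1) unfolding q is_path_Cons_Cons by auto
  have "Suc (d w v) \<le> d u v" using dist_le_path[OF w(2)] p(2) q by simp
  moreover have "d u v \<le> Suc (d w v)"
    using d_triangle[of u v w] d_edge[OF w(1)] edgeD[OF w(1)] assms by simp
  ultimately show ?thesis using that[OF w(1)] by simp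
qed

text \<open>A longer path would close a cycle with the edge. The metric lemmas below use acyclicity
  through this fact.\<close>

lemma edge_path_length:
  assumes "{x, y} \<in> edges T" "is_path T x p y"
  shows "length p = 2"
proof -
  have "\<not> length p \<ge> 3"
    using acyc assms unfolding acyclic_graph_def by (metis insert_commute)
  moreover have "length p \<noteq> 1" "length p \<noteq> 0"
    using assms(2) edgeD(3)[OF assms(1)] unfolding is_path_def
    by (auto simp: length_Suc_conv)
  ultimately show ?thesis by linarith
qed

text \<open>This is bipartiteness of T. If v were equally far from x and y, geodesics from v to both
  would either share a further vertex, which is a counterexample nearer to the edge, or form a cycle
  together with the edge.\<close>

lemma edge_unequal:
  assumes "{x, y} \<in> edges T" "v \<in> verts T"
  shows "d v x \<noteq> d v y"
  using assms(2)
proof (induction "d v x" arbitrary: v rule: less_induct)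
  case less
  have xy: "x \<in> verts T" "y \<in> verts T" "x \<noteq> y" using edgeD[OF assms(1)] by auto
  show ?case
  proof
    assume eq: "d v x = d v y"
    have nv: "v \<noteq> x" "v \<noteq> y" using eq xy d_eq_0_iff less.prems by fastforce+
    obtain p where p: "is_path T x p v" "length p = Suc (d x v)"
      using ex_geodesic[OF conn xy(1) less.prems] by auto
    obtain q where q: "is_path T v q y" "length q = Suc (d v y)"
      using ex_geodesic[OF conn less.prems xy(2)] by auto
    obtain w q' where q': "q = v # w # q'"
      using q(1) nv(2) unfolding is_path_def by (cases q; cases "tl q") auto
    have w: "{v, w} \<in> edges T" "is_path T w (w # q') y" "v \<notin> set (w # q')"
      using q(1) unfolding q' is_path_Cons_Cons by auto
    have "set p \<inter> set (w # q') = {}"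
    proof (rule ccontr)
      assume "set p \<inter> set (w # q') \<noteq> {}"
      then obtain u where u: "u \<in> set p" "u \<in> set q" "u \<noteq> v" using w(3) q' by auto
      have uv: "u \<in> verts T" using u(1) is_path_ends(6)[OF p(1)] by auto
      have "d x u + d u v = d x v" "d v u + d u y = d v y"
        using geodesic_between[OF conn p u(1)] geodesic_between[OF conn q u(2)] by auto
      moreover have "d u v \<noteq> 0" using d_eq_0_iff uv less.prems u(3) by blast
      moreover have "d x u = d u x" "d v u = d u v" "d x v = d v x"
        using d_commute uv xy less.prems by auto
      ultimately have "d u x = d u y" "d u x < d v x" using eq by linarith+
      then show False using less.hyps uv by blast
    qed
    then have path: "is_path T x (p @ w # q') y" using is_path_append p(1) w by metis
    have "length (p @ w # q') = 2" using edge_path_length[OF assms(1) path] .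
    then have "length p = 1" using is_path_ends(5)[OF p(1)] by (cases p) auto
    then show False using p(2) d_eq_0_iff nv less.prems xy by simp
  qed
qed

lemma edge_dist_cases:
  assumes "{x, y} \<in> edges T" "v \<in> verts T"
  shows "d v y = Suc (d v x) \<or> d v x = Suc (d v y)"
proof -
  have "d v y \<le> d v x + d x y" "d v x \<le> d v y + d y x"
    using d_triangle edgeD[OF assms(1)] assms(2) by auto
  moreover have "d x y = 1" "d y x = 1" using d_edge assms(1) by (auto simp: insert_commute)
  ultimately show ?thesis using edge_unequal[OF assms] by linarith
qed

text \<open>Deleting xy splits T into the vertices nearer to x and those nearer to y. The geodesics
  from x to v and from w to y stay on their sides, so they are disjoint; joined through vw they form
  a path from x to y, which can only be the edge itself.\<close>

lemma crossing_edge: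
  assumes xy: "{x, y} \<in> edges T" and vw: "{v, w} \<in> edges T"
    and v: "d v x < d v y" and w: "d w y < d w x"
  shows "v = x \<and> w = y"
proof -
  note V = edgeD[OF xy] edgeD[OF vw]
  obtain p where p: "is_path T x p v" "length p = Suc (d x v)"
    using ex_geodesic[OF conn] V by blast
  obtain q where q: "is_path T w q y" "length q = Suc (d w y)"
    using ex_geodesic[OF conn] V by blast
  have "set p \<inter> set q = {}"
  proof (rule ccontr)
    assume "set p \<inter> set q \<noteq> {}"
    then obtain u where u: "u \<in> set p" "u \<in> set q" by auto
    have uv: "u \<in> verts T" using u(1) is_path_ends(6)[OF p(1)] by auto
    have "d x u + d u v = d x v" "d w u + d u y = d w y"
      using geodesic_between[OF conn p u(1)] geodesic_between[OF conn q u(2)] by auto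
    moreover have "d v y \<le> d v u + d u y" "d w x \<le> d w u + d u x"
      using d_triangle V uv by auto
    moreover have "d x u = d u x" "d v u = d u v" "d x v = d v x" using d_commute V uv by auto
    ultimately show False using v w by linarith
  qed
  then have "length (p @ q) = 2"
    using edge_path_length[OF xy] is_path_append[OF p(1) q(1) vw] by blast
  then have "length p = 1" "length q = 1"
    using is_path_ends(5)[OF p(1)] is_path_ends(5)[OF q(1)] by (cases p; cases q; auto)+
  then show ?thesis using p(2) q(2) d_eq_0_iff V by auto
qed

text \<open>A geodesic changes sides only along xy, so it splits into a part up to x, this edge, and
  a part from y. The distance estimates across a separator rest on this formula.\<close>

lemma dist_across:
  assumes xy: "{x, y} \<in> edges T" and "v \<in> verts T" "w \<in> verts T"
    and "d v x < d v y" and w: "d w y < d w x"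
  shows "d v w = d v x + 1 + d y w"
  using assms(2,4)
proof (induction "d v w" arbitrary: v rule: less_induct)
  case less
  note V = edgeD[OF xy] less.prems assms(3)
  have "v \<noteq> w" using less.prems w by auto
  then obtain v1 where v1: "{v, v1} \<in> edges T" "d v w = Suc (d v1 w)"
    using step_towards V by metis
  have V1: "v1 \<in> verts T" using edgeD v1 by blast
  show ?case
  proof (cases "d v1 x < d v1 y")
    case True
    then have "d v1 w = d v1 x + 1 + d y w" using less.hyps[of v1] v1 V1 by simp
    moreover have "d v x \<le> d v v1 + d v1 x" using d_triangle V V1 by blast
    moreover have "d v v1 = 1" using d_edge[OF v1(1)] .
    moreover have "d v w \<le> d v x + d x w" "d x w \<le> d x y + d y w" using d_triangle V by blast+
    moreover have "d x y = 1" using d_edge[OF xy] .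
    ultimately show ?thesis using v1(2) by linarith
  next
    case False
    then have "d v1 y < d v1 x" using edge_unequal[OF xy V1] by linarith
    then have "v = x" "v1 = y" using crossing_edge[OF xy v1(1)] less.prems by auto
    then show ?thesis using v1(2) V by simp
  qed
qed

lemma path_crosses:
  assumes xy: "{x, y} \<in> edges T" and "is_path T v p w"
    and "d v x < d v y" and w: "d w y < d w x"
  shows "x \<in> set p"
  using assms(2,3)
proof (induction p arbitrary: v)
  case Nil
  then show ?case by (simp add: is_path_def)
next
  case (Cons z p)
  then have z: "z = v" by (simp add: is_path_def)
  show ?case
  proof (cases p)
    case Nil
    then have "v = w" using Cons.prems z by (simp add: is_path_def)
    then show ?thesis using Cons.prems w by simp
  next
    case (Cons u p')
    have u: "is_path T u p w" "{v, u} \<in> edges T"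
      using Cons.prems(1) z unfolding Cons is_path_Cons_Cons by auto
    show ?thesis
    proof (cases "d u x < d u y")
      case True
      then show ?thesis using Cons.IH u by simp
    next
      case False
      then have "d u y < d u x" using edge_unequal[OF xy] edgeD[OF u(2)] by (metis linorder_neqE_nat)
      then show ?thesis using crossing_edge[OF xy u(2) Cons.prems(2)] z by simp
    qed
  qed
qed

text \<open>In a tree this says that z lies on the path from s to t. Stated through distances, it
  turns convexity and hull arguments into arithmetic.\<close>

definition between :: "'a \<Rightarrow> 'a \<Rightarrow> 'a \<Rightarrow> bool" where
  "between s z t \<longleftrightarrow> d s z + d z t = d s t"

text \<open>The edge leaves z towards t and puts s and t on different sides, so that
  \<open>dist_across\<close> and \<open>path_crosses\<close> apply at z.\<close>

lemma between_edge:
  assumes "s \<in> verts T" "z \<in> verts T" "t \<in> verts T" "between s z t" "z \<noteq> t"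
  obtains z' where "{z, z'} \<in> edges T" "d s z < d s z'" "d t z' < d t z"
proof -
  obtain z' where z': "{z, z'} \<in> edges T" "d z t = Suc (d z' t)"
    using step_towards assms by metis
  have "z' \<in> verts T" using edgeD z' by blast
  then have "d s t \<le> d s z' + d z' t" "d t z' = d z' t" "d t z = d z t"
    using d_triangle d_commute assms by auto
  moreover have "d s z \<noteq> d s z'" using edge_unequal z' assms by blast
  ultimately show ?thesis using that[OF z'(1)] z'(2) assms(4) unfolding between_def by linarith
qed

lemma between_in_path:
  assumes "is_path T s p t" "z \<in> verts T" "between s z t"
  shows "z \<in> set p"
proof (cases "z = t")
  case False
  then obtain z' where "{z, z'} \<in> edges T" "d s z < d s z'" "d t z' < d t z"
    using between_edge assms is_path_ends[OF assms(1)] by metis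
  then show ?thesis using path_crosses assms(1) by metis
qed (use is_path_ends[OF assms(1)] in auto)

text \<open>Balls in a tree are convex. Relative to the edge leaving z towards t, the vertex a is
  either on the side of z, and then the way from a to t passes z, or beyond it, and then the way
  from s to a does.\<close>

lemma between_dist_le:
  assumes V: "s \<in> verts T" "z \<in> verts T" "t \<in> verts T" "a \<in> verts T" and "between s z t"
  shows "d a z \<le> max (d a s) (d a t)"
proof (cases "z = t")
  case False
  then obtain z' where z': "{z, z'} \<in> edges T" "d s z < d s z'" "d t z' < d t z"
    using between_edge assms by metis
  note Z = edgeD[OF z'(1)]
  show ?thesis
  proof (cases "d a z < d a z'")
    case True
    then show ?thesis using dist_across[OF z'(1) V(4) V(3) _ z'(3)] by simp
  next
    case False
    then have "d a z = Suc (d a z')" using edge_dist_cases[OF z'(1) V(4)] by linarith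
    moreover from this have "d s a = d s z + 1 + d z' a"
      using dist_across[OF z'(1) V(1) V(4) z'(2)] by simp
    ultimately show ?thesis using d_commute V Z by simp
  qed
qed simp

lemma subtree_path_in:
  assumes "subtree T' T" "s \<in> verts T'" "t \<in> verts T'"
  obtains p where "is_path T' s p t" "is_path T s p t"
  using assms is_path_mono unfolding subtree_def tree_def connected_graph_def by metis

lemma subtree_between:
  assumes "subtree T' T" "s \<in> verts T'" "t \<in> verts T'" "z \<in> verts T" "between s z t"
  shows "z \<in> verts T'"
proof -
  obtain p where p: "is_path T' s p t" "is_path T s p t" using subtree_path_in assms by metis
  then show ?thesis using between_in_path[OF p(2) assms(4,5)] is_path_ends(6)[OF p(1)] by auto
qed

text \<open>A subtree contains a path between the ends of every edge of T that it spans, and this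
  path can only be the edge. So a subtree is determined by its vertices.\<close>

lemma subtree_edges:
  assumes "subtree T' T"
  shows "edges T' = {e \<in> edges T. e \<subseteq> verts T'}"
proof
  show "edges T' \<subseteq> {e \<in> edges T. e \<subseteq> verts T'}"
    using assms by (auto simp: subtree_def tree_def simple_graph_def)
next
  show "{e \<in> edges T. e \<subseteq> verts T'} \<subseteq> edges T'"
  proof
    fix e assume e: "e \<in> {e \<in> edges T. e \<subseteq> verts T'}"
    then have "card e = 2" using simple by (simp add: simple_graph_def)
    then obtain u v where uv: "e = {u, v}" by (meson card_2_iff)
    then obtain p where p: "is_path T' u p v" "is_path T u p v"
      using subtree_path_in[OF assms] e by blast
    have "length p = 2" using edge_path_length p(2) e uv by blast
    then have "p = [u, v]" using p(1) by (cases p; cases "tl p") (auto simp: is_path_def)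
    then show "e \<in> edges T'" using p(1) uv by (simp add: is_path_def)
  qed
qed

lemma induced_subtree:
  assumes "connected_graph (induced T U)"
  shows "subtree (induced T U) T"
proof -
  have "acyclic_graph (induced T U)"
    using acyc unfolding acyclic_graph_def is_path_induced by (auto simp: induced_def)
  moreover have "simple_graph (induced T U)"
    using simple by (auto simp: simple_graph_def induced_def)
  ultimately show ?thesis using assms by (auto simp: subtree_def tree_def induced_def)
qed

text \<open>Each vertex of U is forced into every subtree containing X, so the tree induced by U is
  the least one, and mutual subtrees are equal. This evaluates the definite description in
  \<open>span_tree\<close> for a concrete U, without a general existence theorem.\<close>

lemma span_tree_eq_induced:
  assumes X: "X \<subseteq> U" "U \<subseteq> verts T" and con: "connected_graph (induced T U)"
    and hull: "\<And>z. z \<in> U \<Longrightarrow> z \<in> X \<or> (\<exists>s\<in>X. \<exists>t\<in>X. between s z t)"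
  shows "T\<langle>X\<rangle> = induced T U"
proof -
  have sub: "subtree (induced T U) T" using induced_subtree[OF con] .
  have [simp]: "verts (induced T U) = U" using X by (auto simp: induced_def)
  have least: "subtree (induced T U) T''" if T'': "subtree T'' T" "X \<subseteq> verts T''" for T''
  proof -
    have "U \<subseteq> verts T''"
    proof
      fix z assume z: "z \<in> U"
      then show "z \<in> verts T''" using hull[OF z] subtree_between[OF T''(1)] T''(2) X by blast
    qed
    then show ?thesis
      using sub subtree_edges[OF T''(1)] by (auto simp: subtree_def induced_def)
  qed
  show ?thesis unfolding span_tree_def
  proof (rule the_equality)
    fix T' assume T': "subtree T' T \<and> X \<subseteq> verts T' \<and>
        (\<forall>T''. subtree T'' T \<and> X \<subseteq> verts T'' \<longrightarrow> subtree T' T'')"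
    have "X \<subseteq> verts (induced T U)" using X by simp
    then have "subtree T' (induced T U)" using T' sub by blast
    moreover have "subtree (induced T U) T'" using T' least by blast
    ultimately show "T' = induced T U" by (auto simp: subtree_def prod_eq_iff)
  qed (use sub X least in auto)
qed

lemma dist_induced:
  assumes con: "connected_graph (induced T U)" and "u \<in> U" "v \<in> U" "U \<subseteq> verts T"
  shows "dist (induced T U) u v = d u v"
proof (rule antisym)
  have V: "verts (induced T U) = U" using assms by (auto simp: induced_def)
  have uv: "u \<in> verts T" "v \<in> verts T" using assms by auto
  obtain p where p: "is_path T u p v" "length p = Suc (d u v)" using ex_geodesic[OF conn uv] by auto
  have "set p \<subseteq> U"
    using subtree_between[OF induced_subtree[OF con], of u v] V assms(2,3)
      geodesic_between[OF conn p] is_path_ends(6)[OF p(1)] by (auto simp: between_def)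
  then show "dist (induced T U) u v \<le> d u v"
    using p dist_le_path[of "induced T U" u p v] by (simp add: is_path_induced)
  obtain q where "is_path (induced T U) u q v" "length q = Suc (dist (induced T U) u v)"
    using ex_geodesic[OF con] assms V by blast
  then show "d u v \<le> dist (induced T U) u v"
    using dist_le_path[of T u q v] by (simp add: is_path_induced)
qed

end

section \<open>Bistars\<close>

text \<open>With x = y this is a star, so one construction serves both shapes. D may be any set with
  the right trace on \<open>S - {x, y}\<close>, so a whole neighbourhood in G can serve as D. A
  center lies in S exactly when it is meant to be a real vertex.\<close>

definition bistar :: "'a set \<Rightarrow> 'a set \<Rightarrow> 'a \<Rightarrow> 'a \<Rightarrow> 'a graph" where
  "bistar S D x y = (insert x (insert y S),
     (if x = y then {} else {{x, y}}) \<union> (\<lambda>s. {s, if s \<in> D then x else y}) ` (S - {x, y}))"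

lemma bistar_cong:
  "(\<And>s. s \<in> S - {x, y} \<Longrightarrow> s \<in> D \<longleftrightarrow> s \<in> D') \<Longrightarrow> bistar S D x y = bistar S D' x y"
  unfolding bistar_def by (auto intro!: image_cong)

lemma bistar_leaf:
  assumes "{s, u} \<in> edges (bistar S D x y)" "s \<notin> {x, y}"
  shows "u = (if s \<in> D then x else y)"
  using assms by (auto simp: bistar_def doubleton_eq_iff split: if_splits)

text \<open>Every vertex of a cycle has two neighbours on it, whereas a leaf has only one neighbour
  at all. So three consecutive vertices of a cycle would have to be chosen among two
  centers.\<close>

lemma acyclic_bistar: "acyclic_graph (bistar S D x y)"
  unfolding acyclic_graph_def
proof safe
  fix u v p
  let ?B = "bistar S D x y"
  assume p: "is_path ?B u p v" "3 \<le> length p" and vu: "{v, u} \<in> edges ?B"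
  then obtain w z r where q: "p = u # w # z # r"
    by (metis (no_types, opaque_lifting) is_path_def Suc_le_length_iff list.sel(1) numeral_3_eq_3)
  have e: "{u, w} \<in> edges ?B" "{w, z} \<in> edges ?B"
    and dis: "u \<noteq> w" "u \<noteq> z" "w \<noteq> z" "u \<notin> set r" "w \<notin> set r"
    and v: "last (z # r) = v" and suc: "successively (\<lambda>x y. {x, y} \<in> edges ?B) (z # r)"
    using p(1) unfolding q is_path_def by auto
  have "v \<in> set (z # r)" using v last_in_set by blast
  then have "v \<noteq> w" using dis by auto
  have u: "u \<in> {x, y}"
  proof (rule ccontr)
    assume "u \<notin> {x, y}"
    then show False
      using bistar_leaf[OF e(1)] bistar_leaf[of u v S D x y] vu \<open>v \<noteq> w\<close>
      by (auto simp: insert_commute)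
  qed
  have w: "w \<in> {x, y}"
  proof (rule ccontr)
    assume "w \<notin> {x, y}"
    then show False using bistar_leaf[OF e(2)] bistar_leaf[of w u S D x y] e(1) dis
      by (auto simp: insert_commute)
  qed
  have z: "z \<notin> {x, y}" using u w dis by auto
  have "\<exists>z'. z' \<noteq> w \<and> {z, z'} \<in> edges ?B"
  proof (cases r)
    case Nil
    then show ?thesis using vu v dis by auto
  next
    case (Cons z' r')
    then show ?thesis using suc dis by auto
  qed
  then show False
    using bistar_leaf[of z w S D x y] bistar_leaf[of z _ S D x y] e(2) z by (auto simp: insert_commute)
qed

lemma simple_bistar: "finite S \<Longrightarrow> simple_graph (bistar S D x y)"
  unfolding simple_graph_def bistar_def by (auto simp: card_insert_if)

lemma connected_bistar: "connected_graph (bistar S D x y)"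
proof -
  let ?B = "bistar S D x y"
  have to_x: "\<exists>p. is_path ?B v p x" if "v \<in> verts ?B" for v
  proof -
    have "is_path ?B x [x] x" by (auto simp: is_path_def bistar_def)
    moreover have "is_path ?B y [y, x] x" if "x \<noteq> y"
      using that by (auto simp: is_path_def bistar_def insert_commute)
    moreover have "is_path ?B v [v, x] x" if "v \<in> S - {x, y}" "v \<in> D \<or> x = y"
      using that by (auto simp: is_path_def bistar_def)
    moreover have "is_path ?B v [v, y, x] x" if "v \<in> S - {x, y}" "v \<notin> D" "x \<noteq> y"
      using that by (auto simp: is_path_def bistar_def insert_commute)
    moreover have "v = x \<or> v = y \<or> v \<in> S - {x, y}" using that by (auto simp: bistar_def)
    ultimately show ?thesis by metis
  qed
  then show ?thesis
    unfolding connected_graph_def using is_path_rev[of ?B _ _ x] is_path_join[of ?B _ _ x] by metis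
qed

lemma tree_bistar: "finite S \<Longrightarrow> tree (bistar S D x y)"
  by (simp add: tree_def simple_bistar connected_bistar acyclic_bistar)

lemma inj_on_image_mem_iff_subset:
  assumes "inj_on f A" "X \<subseteq> A" "\<And>Y. Y \<in> E \<Longrightarrow> Y \<subseteq> A"
  shows "f ` X \<in> (`) f ` E \<longleftrightarrow> X \<in> E"
proof
  assume "f ` X \<in> (`) f ` E"
  then obtain Y where "Y \<in> E" "f ` X = f ` Y" by auto
  then show "X \<in> E" using inj_on_image_eq_iff[OF assms(1) assms(2) assms(3)] by metis
qed simp

text \<open>Only Steiner centers are renamed. A real center lies in S and keeps its name, so the
  renaming fixes all real vertices.\<close>

lemma steiner_equivalent_bistar:
  assumes "S \<subseteq> V" "x \<in> V \<Longrightarrow> x \<in> S \<and> x' = x" "y \<in> V \<Longrightarrow> y \<in> S \<and> y' = y"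
    and "x \<notin> V \<Longrightarrow> x' \<notin> V" "y \<notin> V \<Longrightarrow> y' \<notin> V" "x = y \<longleftrightarrow> x' = y'"
  shows "steiner_equivalent V (bistar S D x y) (bistar S D x' y')"
proof -
  let ?f = "\<lambda>z. if z = x then x' else if z = y then y' else z"
  let ?A = "insert x (insert y S)"
  have fS: "?f s = s" if "s \<in> S" for s using that assms by auto
  have inj: "inj_on ?f ?A"
    using assms by (auto simp: inj_on_def)
  have im: "?f ` ?A = insert x' (insert y' S)" using assms fS by (auto simp: image_iff)
  have rest: "S - {x', y'} = S - {x, y}" using assms by auto
  have im_edges: "(`) ?f ` edges (bistar S D x y) = edges (bistar S D x' y')"
  proof -
    have "(`) ?f ` (\<lambda>s. {s, if s \<in> D then x else y}) ` (S - {x, y})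
        = (\<lambda>s. {s, if s \<in> D then x' else y'}) ` (S - {x, y})"
      unfolding image_image using assms(6) by (intro image_cong) auto
    moreover have "(`) ?f ` (if x = y then {} else {{x, y}}) = (if x' = y' then {} else {{x', y'}})"
      using assms(6) by auto
    ultimately show ?thesis unfolding bistar_def snd_conv image_Un rest by presburger
  qed
  have sub: "Y \<subseteq> ?A" if "Y \<in> edges (bistar S D x y)" for Y
    using that by (auto simp: bistar_def split: if_splits)
  have edge: "{?f u, ?f v} \<in> edges (bistar S D x' y') \<longleftrightarrow> {u, v} \<in> edges (bistar S D x y)"
    if "u \<in> ?A" "v \<in> ?A" for u v
  proof -
    have "{u, v} \<subseteq> ?A" using that by blast
    from inj_on_image_mem_iff_subset[where E = "edges (bistar S D x y)", OF inj this sub]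
    have "?f ` {u, v} \<in> edges (bistar S D x' y') \<longleftrightarrow> {u, v} \<in> edges (bistar S D x y)"
      unfolding im_edges by blast
    then show ?thesis unfolding image_insert image_empty .
  qed
  show ?thesis unfolding steiner_equivalent_def
  proof (intro conjI exI[of _ ?f])
    show "bij_betw ?f (verts (bistar S D x y)) (verts (bistar S D x' y'))"
      using inj im by (simp add: bij_betw_def bistar_def)
    show "\<forall>u\<in>verts (bistar S D x y). \<forall>v\<in>verts (bistar S D x y).
      {u, v} \<in> edges (bistar S D x y) \<longleftrightarrow> {?f u, ?f v} \<in> edges (bistar S D x' y')"
      using edge by (simp add: bistar_def)
  qed (use assms in \<open>auto simp: bistar_def\<close>)
qed

context tree_graph
begin

lemma induced_eq_bistar:
  assumes "S \<subseteq> verts T" "x \<in> verts T" "y \<in> verts T" "x = y \<or> {x, y} \<in> edges T"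
    and "\<And>s. s \<in> S - {x, y} \<Longrightarrow> {s, if s \<in> D then x else y} \<in> edges T"
  shows "induced T (insert x (insert y S)) = bistar S D x y"
proof -
  have "finite S" using assms(1) finite_verts finite_subset by blast
  moreover have v: "verts (bistar S D x y) = insert x (insert y S)" by (simp add: bistar_def)
  moreover have "edges (bistar S D x y) \<subseteq> edges T"
    using assms(4,5) unfolding bistar_def by auto
  ultimately have "subtree (bistar S D x y) T"
    using assms(1-3) tree_bistar by (auto simp: subtree_def)
  then show ?thesis
    using subtree_edges v assms(1-3) by (auto simp: induced_def prod_eq_iff)
qed

lemma span_tree_eq_bistar:
  assumes "S \<subseteq> verts T" "x \<in> verts T" "y \<in> verts T" "x = y \<or> {x, y} \<in> edges T"
    and "\<And>s. s \<in> S - {x, y} \<Longrightarrow> {s, if s \<in> D then x else y} \<in> edges T"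
    and "\<And>z. z \<in> {x, y} \<Longrightarrow> z \<in> S \<or> (\<exists>s\<in>S. \<exists>t\<in>S. between s z t)"
  shows "T\<langle>S\<rangle> = bistar S D x y"
proof -
  have "induced T (insert x (insert y S)) = bistar S D x y"
    using induced_eq_bistar assms(1-5) by simp
  moreover have "T\<langle>S\<rangle> = induced T (insert x (insert y S))"
    by (rule span_tree_eq_induced) (use assms(1-3,6) connected_bistar calculation in auto)
  ultimately show ?thesis by simp
qed

lemma d_neighbours:
  assumes "{x, s} \<in> edges T" "{x, t} \<in> edges T" "s \<noteq> t"
  shows "d s t = 2"
proof -
  have "d t s = Suc (d t x) \<or> d t x = Suc (d t s)"
    using edge_dist_cases[OF assms(1), of t] edgeD[OF assms(2)] by blast
  moreover have "d t x = 1" using assms(2) d_edge by (simp add: insert_commute)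
  moreover have "d t s \<noteq> 0" using d_eq_0_iff edgeD assms by metis
  ultimately show ?thesis using d_commute edgeD assms by (metis Suc_1 One_nat_def nat.inject)
qed

text \<open>At most one of two neighbours of x lies towards p; the way from p to the other one
  passes through x.\<close>

lemma d_centre_le:
  assumes "{x, s} \<in> edges T" "{x, t} \<in> edges T" "s \<noteq> t" "p \<in> verts T" "d p s \<le> k" "d p t \<le> k"
  shows "Suc (d p x) \<le> k"
proof (cases "d p s = Suc (d p x)")
  case False
  then have p: "d p s < d p x" "d p x = Suc (d p s)" using edge_dist_cases[OF assms(1,4)] by auto
  have t: "d t x = 1" "d t s = 2"
    using d_edge[of t x] d_neighbours[OF assms(2,1)] assms by (auto simp: insert_commute)
  have "d p t = d p s + 1 + d x t"
    by (rule dist_across[of s x]) (use assms edgeD p t in \<open>auto simp: insert_commute\<close>)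
  moreover have "d x t = 1" using d_edge assms(2) .
  ultimately show ?thesis using p assms(6) by simp
qed (use assms in simp)

end

section \<open>Separators\<close>

definition nbrs :: "'a graph \<Rightarrow> 'a \<Rightarrow> 'a set" where
  "nbrs G u = {v. {u, v} \<in> edges G}"

definition component :: "'a graph \<Rightarrow> 'a set \<Rightarrow> 'a \<Rightarrow> 'a set" where
  "component G S a = {v. \<exists>p. is_path (induced G (verts G - S)) a p v}"

lemma separates_iff:
  "separates G S a b \<longleftrightarrow> a \<in> verts G - S \<and> b \<in> verts G - S \<and> b \<notin> component G S a"
  by (auto simp: separates_def component_def)

lemma component_subset: "component G S a \<subseteq> verts G - S"
  unfolding component_def using is_path_ends(4) by (fastforce simp: induced_def)

lemma component_memD: "v \<in> component G S a \<Longrightarrow> v \<in> verts G" "v \<in> component G S a \<Longrightarrow> v \<notin> S"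
  using subsetD[OF component_subset] by (metis DiffD1, metis DiffD2)

lemma component_self: "a \<in> verts G - S \<Longrightarrow> a \<in> component G S a"
  unfolding component_def mem_Collect_eq by (rule exI[of _ "[a]"]) (simp add: is_path_def induced_def)

lemma component_step:
  assumes "v \<in> component G S a" "{v, w} \<in> edges G" "w \<in> verts G - S" "v \<noteq> w"
  shows "w \<in> component G S a"
proof -
  let ?H = "induced G (verts G - S)"
  have "v \<in> verts G - S" using component_memD[OF assms(1)] by simp
  then have "is_path ?H v [v, w] w" using assms(2-4) by (auto simp: is_path_def induced_def)
  then show ?thesis using assms(1) is_path_join[of ?H a _ v] unfolding component_def by blast
qed

lemma path_invariant:
  assumes "is_path H u p v" "P u" "\<And>x y. P x \<Longrightarrow> {x, y} \<in> edges H \<Longrightarrow> P y"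
  shows "P v"
  using assms(1,2)
proof (induction p arbitrary: u)
  case Nil
  then show ?case by (simp add: is_path_def)
next
  case (Cons z p)
  show ?case
  proof (cases p)
    case Nil
    then show ?thesis using Cons.prems by (auto simp: is_path_def)
  next
    case (Cons w q)
    then show ?thesis using Cons.prems Cons.IH[of w] assms(3) by (auto simp: is_path_Cons_Cons)
  qed
qed

lemma component_induct [consumes 1, case_names base step]:
  assumes "v \<in> component G S a" "P a"
    and "\<And>x y. x \<in> component G S a \<Longrightarrow> y \<in> component G S a \<Longrightarrow> P x \<Longrightarrow> {x, y} \<in> edges G \<Longrightarrow> P y"
  shows "P v"
proof -
  let ?H = "induced G (verts G - S)"
  obtain p where p: "is_path ?H a p v" using assms(1) by (auto simp: component_def)
  have a: "a \<in> component G S a" using is_path_ends(3)[OF p] component_self[of a G S] by (simp add: induced_def)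
  have "v \<in> component G S a \<and> P v"
  proof (rule path_invariant[OF p])
    fix x y assume xy: "x \<in> component G S a \<and> P x" "{x, y} \<in> edges ?H"
    have "y \<in> component G S a"
      using xy component_step[of x G S a y] by (cases "x = y") (auto simp: induced_def)
    then show "y \<in> component G S a \<and> P y" using xy assms(3) by (auto simp: induced_def)
  qed (use a assms(2) in auto)
  then show ?thesis by simp
qed

lemma component_sym: "v \<in> component G S a \<Longrightarrow> a \<in> component G S v"
  unfolding component_def using is_path_rev by fast

lemma component_trans: "v \<in> component G S a \<Longrightarrow> w \<in> component G S v \<Longrightarrow> w \<in> component G S a"
  unfolding component_def using is_path_join by fast

lemma separates_sym: "separates G S a b \<longleftrightarrow> separates G S b a"
  unfolding separates_iff using component_sym by metis

lemma separates_comp: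
  assumes "separates G S a b" "v \<in> component G S a" "w \<in> component G S b"
  shows "separates G S v w"
  using assms component_memD component_sym component_trans unfolding separates_iff by (metis DiffI)

lemma separates_not_adjacent:
  assumes "separates G S a b"
  shows "a \<noteq> b" "{a, b} \<notin> edges G"
proof -
  have a: "a \<in> component G S a" using assms component_self[of a G S] by (simp add: separates_iff)
  then show "a \<noteq> b" using assms by (auto simp: separates_iff)
  then show "{a, b} \<notin> edges G" using assms component_step[OF a, of b] by (auto simp: separates_iff)
qed

text \<open>A common neighbour outside S would connect a to b. Applied to all sets that separate a
  and b, this yields minimality once S is the common neighbourhood itself.\<close>

lemma common_nbrs_subset:
  assumes "separates G S a b" "nbrs G a \<inter> nbrs G b \<subseteq> verts G"
  shows "nbrs G a \<inter> nbrs G b \<subseteq> S"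
proof
  fix v assume v: "v \<in> nbrs G a \<inter> nbrs G b"
  show "v \<in> S"
  proof (rule ccontr)
    assume "v \<notin> S"
    then have vS: "v \<in> verts G - S" using v assms(2) by auto
    show False
    proof (cases "v = a \<or> v = b")
      case True
      then show ?thesis using v separates_not_adjacent(2)[OF assms(1)] by (auto simp: nbrs_def insert_commute)
    next
      case False
      then have "v \<in> component G S a"
        using component_step[OF component_self, of a G S v] assms(1) v vS by (auto simp: separates_iff nbrs_def)
      then have "b \<in> component G S a"
        using component_step[of v G S a b] assms(1) v False by (auto simp: separates_iff nbrs_def insert_commute)
      then show ?thesis using assms(1) by (simp add: separates_iff)
    qed
  qed
qed

lemma common_nbrs_minimal_separator:
  assumes "simple_graph G" "S = nbrs G a \<inter> nbrs G b" "separates G S a b"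
  shows "S \<in> minimal_separators G"
proof -
  have V: "nbrs G a \<inter> nbrs G b \<subseteq> verts G" using assms(1) by (auto simp: nbrs_def simple_graph_def)
  then have "\<not> separates G S' a b" if "S' \<subset> S" for S'
    using common_nbrs_subset[of G S' a b] that assms(2) by auto
  then show ?thesis using assms V by (auto simp: minimal_separators_def)
qed

text \<open>Since \<open>S - {s}\<close> does not separate, some path from a to b meets S in s
  alone. The vertex before s on this path is still in the component of a.\<close>

lemma minimal_separator_neighbour:
  assumes "separates G S a b" "\<And>S'. S' \<subset> S \<Longrightarrow> \<not> separates G S' a b" "s \<in> S" "S \<subseteq> verts G"
  shows "\<exists>v\<in>component G S a. {s, v} \<in> edges G"
proof -
  let ?H = "induced G (verts G - (S - {s}))"
  have "S - {s} \<subset> S" using assms(3) by auto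
  then obtain p where p: "is_path ?H a p b"
    using assms(1,2) unfolding separates_def by blast
  then have pG: "is_path G a p b" "set p \<subseteq> verts G - (S - {s})" by (auto simp: is_path_induced)
  have "s \<in> set p"
  proof (rule ccontr)
    assume "s \<notin> set p"
    then have "is_path (induced G (verts G - S)) a p b" using pG by (auto simp: is_path_induced)
    then show False using assms(1) by (auto simp: separates_def)
  qed
  then obtain p1 p2 where p12: "p = p1 @ s # p2" by (meson split_list)
  moreover have "a \<noteq> s" using assms by (auto simp: separates_def)
  moreover have "hd p = a" using pG by (simp add: is_path_def)
  ultimately have "p1 \<noteq> []" by auto
  then obtain q v where "p1 = q @ [v]" by (meson rev_exhaust)
  then have qv: "p = q @ v # s # p2" using p12 by simp
  have "is_path G a (q @ [v]) v" "{v, s} \<in> edges G" "s \<notin> set (q @ [v])"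
    using is_path_split[of G a q v "s # p2" b] pG(1) unfolding qv is_path_Cons_Cons
    unfolding is_path_def by (simp_all, blast)
  then have "v \<in> component G S a"
    using pG(2) qv by (auto simp: component_def is_path_induced intro!: exI[of _ "q @ [v]"])
  then show ?thesis using \<open>{v, s} \<in> edges G\<close> by (auto simp: insert_commute)
qed

lemma ex_maximal_clique:
  assumes "finite (verts G)" "clique G K"
  shows "\<exists>K'. maximal_clique G K' \<and> K \<subseteq> K'"
proof -
  let ?M = "{K'. clique G K' \<and> K \<subseteq> K'}"
  have "finite ?M" using assms(1) by (auto simp: clique_def intro: finite_subset[of _ "Pow (verts G)"])
  moreover have "K \<in> ?M" using assms(2) by simp
  ultimately obtain M where M: "M \<in> ?M" "\<forall>K'\<in>?M. M \<subseteq> K' \<longrightarrow> M = K'"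
    using finite_has_maximal[of ?M] by blast
  then show ?thesis unfolding maximal_clique_def by (intro exI[of _ M]) auto
qed

text \<open>Otherwise K and S together would form a larger clique. Applied to a maximal clique that
  witnesses a constraint, this supplies the vertices called \<open>incomplete\<close> below.\<close>

lemma maximal_clique_not_superset:
  assumes "maximal_clique G K" "clique G S" "\<not> S \<subseteq> K"
  shows "\<exists>p\<in>K - S. \<not> S \<subseteq> nbrs G p"
proof (rule ccontr)
  assume "\<not> ?thesis"
  then have adj: "\<And>p s. p \<in> K - S \<Longrightarrow> s \<in> S \<Longrightarrow> {p, s} \<in> edges G" by (auto simp: nbrs_def)
  have "clique G (K \<union> S)"
    unfolding clique_def
  proof (intro conjI ballI impI)
    show "K \<union> S \<subseteq> verts G" using assms by (auto simp: maximal_clique_def clique_def)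
    fix u v assume uv: "u \<in> K \<union> S" "v \<in> K \<union> S" "u \<noteq> v"
    have "{u, v} \<in> edges G" if "u \<in> K - S" "v \<in> S" using that adj by auto
    moreover have "{u, v} \<in> edges G" if "v \<in> K - S" "u \<in> S" using that adj by (subst insert_commute) auto
    moreover have "{u, v} \<in> edges G" if "u \<in> K" "v \<in> K"
      using that uv(3) assms(1) by (auto simp: maximal_clique_def clique_def)
    moreover have "{u, v} \<in> edges G" if "u \<in> S" "v \<in> S"
      using that uv(3) assms(2) by (auto simp: clique_def)
    ultimately show "{u, v} \<in> edges G" using uv by blast
  qed
  then show False using assms(1,3) unfolding maximal_clique_def by blast
qed

section \<open>Minimal separators as common neighbourhoods in a 4-Steiner root\<close>

locale steiner_tree = tree_graph T for T :: "'a graph" +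
  fixes G :: "'a graph"
  assumes simple_G: "simple_graph G" and root: "steiner_root 4 G T"
begin

abbreviation "V \<equiv> verts G"

lemma V_subset: "V \<subseteq> verts T" using root by (simp add: steiner_root_def)

lemma finite_V: "finite V" using simple_G by (simp add: simple_graph_def)

lemma nbrs_iff:
  assumes "p \<in> V"
  shows "v \<in> nbrs G p \<longleftrightarrow> v \<in> V \<and> v \<noteq> p \<and> d p v \<le> 4"
proof -
  have "v \<in> V \<and> v \<noteq> p" if "{p, v} \<in> edges G"
    using that simple_G by (force simp: simple_graph_def)
  then show ?thesis using root assms unfolding nbrs_def steiner_root_def by auto
qed

lemma edge_G: "{p, v} \<in> edges G \<Longrightarrow> p \<in> V \<and> v \<in> V \<and> v \<noteq> p \<and> d p v \<le> 4"
  using nbrs_iff[of p v] simple_G by (auto simp: nbrs_def simple_graph_def)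

lemma component_in_T: "v \<in> component G S a \<Longrightarrow> v \<in> verts T"
  using component_memD(1) V_subset by (metis subsetD)

lemma separates_far:
  assumes "separates G S a b" "v \<in> component G S a" "w \<in> component G S b"
  shows "d v w > 4"
proof (rule ccontr)
  assume "\<not> d v w > 4"
  moreover have sep: "separates G S v w" using separates_comp assms by metis
  ultimately show False
    using separates_not_adjacent[OF sep] nbrs_iff[of v w] by (auto simp: separates_iff nbrs_def)
qed

text \<open>The two unions of balls of radius 2 around the vertices of the two components are disjoint.
  The edge is the first one of a shortest path between these unions.\<close>
lemma separating_edge:
  assumes sep: "separates G S a b"
    and nA: "\<And>s. s \<in> S \<Longrightarrow> \<exists>v\<in>component G S a. {s, v} \<in> edges G"
    and nB: "\<And>s. s \<in> S \<Longrightarrow> \<exists>v\<in>component G S b. {s, v} \<in> edges G"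
  obtains x y a' where "{x, y} \<in> edges T" "a' \<in> component G S a" "d a' x \<le> 2"
    "\<And>v. v \<in> component G S a \<Longrightarrow> d v x < d v y" "\<And>v. v \<in> component G S b \<Longrightarrow> d v y < d v x"
    "\<And>s. s \<in> S \<Longrightarrow> d s x \<le> 1 \<or> d s y \<le> 1"
proof -
  define TA where "TA = {z \<in> verts T. \<exists>v\<in>component G S a. d v z \<le> 2}"
  define TB where "TB = {z \<in> verts T. \<exists>v\<in>component G S b. d v z \<le> 2}"
  have ab: "a \<in> component G S a" "b \<in> component G S b" using sep component_self unfolding separates_iff by metis+
  have "a \<in> TA" "b \<in> TB" using ab component_in_T unfolding TA_def TB_def by force+
  then have "(\<lambda>(x, y). x \<in> TA \<and> y \<in> TB) (a, b)" by simp
  from ex_has_least_nat[where P = "\<lambda>(x, y). x \<in> TA \<and> y \<in> TB", OF this, of "\<lambda>(x, y). d x y"]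
  obtain x y0 where x: "x \<in> TA" "y0 \<in> TB" and least: "\<And>x' y'. x' \<in> TA \<Longrightarrow> y' \<in> TB \<Longrightarrow> d x y0 \<le> d x' y'"
    by auto
  have disj: False if z: "z \<in> TA" "z \<in> TB" for z
  proof -
    obtain v w where vw: "v \<in> component G S a" "d v z \<le> 2" "w \<in> component G S b" "d w z \<le> 2" "z \<in> verts T"
      using z unfolding TA_def TB_def by blast
    have "d v w \<le> d v z + d z w" "d z w = d w z"
      using d_triangle d_commute vw component_in_T by metis+
    then show False using separates_far[OF sep vw(1,3)] vw by simp
  qed
  have "x \<noteq> y0" using disj x by blast
  then obtain y where y: "{x, y} \<in> edges T" "d x y0 = Suc (d y y0)"
    using step_towards x unfolding TA_def TB_def by blast
  note xy = edgeD[OF y(1)]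
  \<comment> \<open>The vertex y is nearer to y0 than x is, so by minimality it lies outside the
    balls around the component of a. Likewise x lies outside those around the component of
    b.\<close>
  have "y \<notin> TA" using least[of y y0] x y by auto
  then have A3: "d v y \<ge> 3" if "v \<in> component G S a" for v using that xy by (force simp: TA_def)
  have "x \<notin> TB" using disj x by blast
  then have B3: "d v x \<ge> 3" if "v \<in> component G S b" for v using that xy by (force simp: TB_def)
  obtain a' where a': "a' \<in> component G S a" "d a' x \<le> 2" using x by (auto simp: TA_def)
  obtain b' where b': "b' \<in> component G S b" "d b' y0 \<le> 2" and y0: "y0 \<in> verts T" using x by (auto simp: TB_def)
  have side: "d v x < d v y \<or> d v y < d v x" if "v \<in> verts T" for v
    using edge_unequal[OF y(1) that] by auto
  have cross: "d v w = d v x + 1 + d w y" "d v y = Suc (d v x)" "d w x = Suc (d w y)"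
    if "v \<in> verts T" "w \<in> verts T" "d v x < d v y" "d w y < d w x" for v w
  proof -
    show "d v w = d v x + 1 + d w y" using dist_across[OF y(1) that] d_commute[OF xy(2) that(2)] by simp
    show "d v y = Suc (d v x)" "d w x = Suc (d w y)"
      using edge_dist_cases[OF y(1) that(1)] edge_dist_cases[OF y(1) that(2)] that(3,4) by linarith+
  qed
  have a'x: "d a' x < d a' y"
    using A3[OF a'(1)] a'(2) by linarith
  \<comment> \<open>Adjacent vertices are at distance at most 4. Both v and w have distance at least
    3 from y, so a step from v to w across xy would have length at least 2 + 1 + 3.\<close>
  have sideA: "d v x < d v y" if "v \<in> component G S a" for v
  proof -
    have "v \<in> component G S a'" using component_trans[OF component_sym[OF a'(1)] that] .
    then have "d v x < d v y \<and> v \<in> component G S a"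
    proof (induction rule: component_induct)
      case (step v w)
      have w: "w \<in> component G S a" using component_trans[OF a'(1) step(2)] .
      have "d w x < d w y"
      proof (rule ccontr)
        assume "\<not> ?thesis"
        then have "d w y < d w x" using side[OF component_in_T[OF w]] by blast
        then have "d v w = d v x + 1 + d w y" "d v y = Suc (d v x)"
          using cross(1,2)[OF component_in_T component_in_T[OF w]] step.IH by blast+
        moreover have "d v w \<le> 4" using step.hyps edge_G by blast
        ultimately show False using A3[of v] A3[of w] w step.IH by linarith
      qed
      then show ?case using w by simp
    qed (use a' a'x in auto)
    then show ?thesis by simp
  qed
  have b'y: "d b' y < d b' x"
  proof (rule ccontr)
    assume "\<not> ?thesis"
    then have "d b' x < d b' y" using side[OF component_in_T[OF b'(1)]] by blast
    moreover have "d y0 y < d y0 x" using y(2) d_commute xy y0 by simp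
    ultimately have "d b' y0 = d b' x + 1 + d y0 y" using cross(1)[OF component_in_T[OF b'(1)] y0] by blast
    then show False using B3[OF b'(1)] b'(2) by simp
  qed
  have sideB: "d v y < d v x" if "v \<in> component G S b" for v
  proof -
    have "v \<in> component G S b'" using component_trans[OF component_sym[OF b'(1)] that] .
    then have "d v y < d v x \<and> v \<in> component G S b"
    proof (induction rule: component_induct)
      case (step v w)
      have w: "w \<in> component G S b" using component_trans[OF b'(1) step(2)] .
      have "d w y < d w x"
      proof (rule ccontr)
        assume "\<not> ?thesis"
        then have "d w x < d w y" using side[OF component_in_T[OF w]] by blast
        then have "d w v = d w x + 1 + d v y" "d v x = Suc (d v y)"
          using cross(1,3)[OF component_in_T[OF w] component_in_T] step.IH by blast+
        moreover have "d w v \<le> 4" using step.hyps edge_G[of w v] by (simp add: insert_commute)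
        ultimately show False using B3[of v] B3[of w] w step.IH by linarith
      qed
      then show ?case using w by simp
    qed (use b' b'y in auto)
    then show ?thesis by simp
  qed
  \<comment> \<open>Neighbours of s in the two components have distance at least 2 from x and y,
    respectively. The one across the edge is within 4 of s; after 1 for the edge and 2 behind it, at
    most 1 remains for s.\<close>
  have "d s x \<le> 1 \<or> d s y \<le> 1" if s: "s \<in> S" for s
  proof -
    obtain v where v: "v \<in> component G S a" "{s, v} \<in> edges G" using nA s by blast
    obtain w where w: "w \<in> component G S b" "{s, w} \<in> edges G" using nB s by blast
    have sT: "s \<in> verts T" and le: "d s v \<le> 4" "d s w \<le> 4"
      using edge_G[OF v(2)] edge_G[OF w(2)] V_subset by auto
    note vT = component_in_T[OF v(1)] and wT = component_in_T[OF w(1)]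
    have v2: "d v x \<ge> 2" "d w y \<ge> 2"
      using cross(2,3)[OF vT wT sideA[OF v(1)] sideB[OF w(1)]] A3[OF v(1)] B3[OF w(1)] by linarith+
    show ?thesis
    proof (cases "d s x < d s y")
      case True
      then show ?thesis using cross(1)[OF sT wT True sideB[OF w(1)]] le v2 by linarith
    next
      case False
      then have "d s y < d s x" using side sT by blast
      then have "d v s = d v x + 1 + d s y" using cross(1)[OF vT sT sideA[OF v(1)]] by blast
      moreover have "d v s = d s v" using d_commute vT sT by simp
      ultimately show ?thesis using le v2 by linarith
    qed
  qed
  then show ?thesis using that[OF y(1) a'] sideA sideB by blast
qed

text \<open>The vertex a' supplied with the separating edge is within 2 of x, and each vertex of S
  is within 1 of x or y. This adds up to at most 2 + 1 + 1 = 4.\<close>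

lemma minimal_separator_common_neighbour:
  assumes sep: "separates G S a b" and min: "\<And>S'. S' \<subset> S \<Longrightarrow> \<not> separates G S' a b" and S: "S \<subseteq> V"
  shows "\<exists>a'\<in>component G S a. S \<subseteq> nbrs G a'"
proof -
  have sep': "separates G S b a" and min': "\<And>S'. S' \<subset> S \<Longrightarrow> \<not> separates G S' b a"
    using sep min separates_sym by metis+
  have nA: "\<exists>v\<in>component G S a. {s, v} \<in> edges G" if "s \<in> S" for s
    using minimal_separator_neighbour[of G S a b s] sep min that S by blast
  have nB: "\<exists>v\<in>component G S b. {s, v} \<in> edges G" if "s \<in> S" for s
    using minimal_separator_neighbour[of G S b a s] sep' min' that S by blast
  obtain x y a' where xy: "{x, y} \<in> edges T" and a': "a' \<in> component G S a" "d a' x \<le> 2"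
    and near: "\<And>s. s \<in> S \<Longrightarrow> d s x \<le> 1 \<or> d s y \<le> 1"
    using separating_edge[OF sep nA nB] by metis
  have "S \<subseteq> nbrs G a'"
  proof
    fix s assume s: "s \<in> S"
    note V = V_subset component_in_T[OF a'(1)] edgeD[OF xy] S
    have aV: "a' \<in> V" "a' \<noteq> s" using component_memD[OF a'(1)] s by auto
    have sT: "s \<in> verts T" using s S V_subset by blast
    have "d a' s \<le> d a' x + d x s" "d s x \<le> d s y + d y x" "d x s = d s x"
      using d_triangle d_commute V sT by blast+
    moreover have "d y x = 1" using xy d_edge[of y x] by (simp add: insert_commute)
    ultimately have "d a' s \<le> 4" using near[OF s] a' by linarith
    then show "s \<in> nbrs G a'" using nbrs_iff[OF aV(1)] aV s S by auto
  qed
  then show ?thesis using a' by blast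
qed

text \<open>A common neighbour of all of S is chosen in each of the two components. S separates
  these two vertices as well, so \<open>common_nbrs_subset\<close> gives the converse inclusion.
  Thus a search over pairs of vertices finds every minimal separator.\<close>

lemma minimal_separator_is_common_nbrs:
  assumes "S \<in> minimal_separators G"
  obtains a b where "separates G S a b" "S = nbrs G a \<inter> nbrs G b"
proof -
  obtain a b where ab: "separates G S a b" "\<And>S'. S' \<subset> S \<Longrightarrow> \<not> separates G S' a b" "S \<subseteq> V"
    using assms by (auto simp: minimal_separators_def)
  obtain a' where a': "a' \<in> component G S a" "S \<subseteq> nbrs G a'"
    using minimal_separator_common_neighbour[OF ab] by blast
  have "separates G S b a" "\<And>S'. S' \<subset> S \<Longrightarrow> \<not> separates G S' b a"
    using ab separates_sym by metis+
  then obtain b' where b': "b' \<in> component G S b" "S \<subseteq> nbrs G b'"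
    using minimal_separator_common_neighbour[of S b a] ab(3) by blast
  have sep: "separates G S a' b'" using separates_comp ab a' b' by metis
  have "nbrs G a' \<inter> nbrs G b' \<subseteq> V" using nbrs_iff[OF component_memD(1)[OF a'(1)]] by blast
  from common_nbrs_subset[OF sep this] have "S = nbrs G a' \<inter> nbrs G b'" using a'(2) b'(2) by auto
  with sep show ?thesis by (rule that)
qed

end

section \<open>Spans of separators in well-structured roots\<close>

text \<open>\<open>marked\<close> and \<open>linked\<close> detect the leaves that belong to the side of \<open>a\<close> or of the center \<open>c\<close>;
  \<open>f\<close> is the exceptional free leaf of that side (or no vertex at all).\<close>

definition incomplete :: "'a graph \<Rightarrow> 'a set \<Rightarrow> 'a \<Rightarrow> bool" where
  "incomplete G S p \<longleftrightarrow> p \<in> verts G - S \<and> \<not> S \<subseteq> nbrs G p"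

definition marked :: "'a graph \<Rightarrow> 'a set \<Rightarrow> 'a \<Rightarrow> 'a \<Rightarrow> bool" where
  "marked G S a v \<longleftrightarrow> (\<exists>p. incomplete G S p \<and> p \<in> component G S a \<and> v \<in> nbrs G p)"

definition linked :: "'a graph \<Rightarrow> 'a set \<Rightarrow> 'a \<Rightarrow> 'a \<Rightarrow> bool" where
  "linked G S v c \<longleftrightarrow> (\<exists>p. incomplete G S p \<and> v \<in> nbrs G p \<and> c \<in> nbrs G p)"

definition side_set :: "'a graph \<Rightarrow> 'a set \<Rightarrow> 'a \<Rightarrow> 'a \<Rightarrow> 'a \<Rightarrow> 'a set" where
  "side_set G S a f c = {v. marked G S a v \<or> linked G S v c \<or> v = f}"

context tree_graph
begin

definition side :: "'a set \<Rightarrow> 'a \<Rightarrow> 'a \<Rightarrow> 'a set" where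
  "side S x y = {s \<in> S. s \<noteq> x \<and> d s x < d s y}"

end

section \<open>The common neighbourhood of two separated vertices\<close>

locale common_neighbourhood = steiner_tree T G for T G :: "'a graph" +
  fixes S :: "'a set" and a b :: 'a
  assumes S_eq: "S = nbrs G a \<inter> nbrs G b" and sep: "separates G S a b"
begin

lemma ab: "a \<in> component G S a" "b \<in> component G S b"
  using sep component_self[of a G S] component_self[of b G S] by (auto simp: separates_iff)

lemma abV: "a \<in> V - S" "b \<in> V - S"
  using sep by (auto simp: separates_iff)

lemma S_V: "S \<subseteq> V"
  using abV nbrs_iff[of a] unfolding S_eq by auto

lemma VT: "v \<in> V \<Longrightarrow> v \<in> verts T" and ST: "v \<in> S \<Longrightarrow> v \<in> verts T"
  using S_V V_subset by auto

text \<open>S consists of the real vertices in the balls of radius 4 around a and b, which are more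
  than 4 apart, and balls are convex. It follows later that a real center of the span belongs to
  S.\<close>

lemma between_in_S:
  assumes "s \<in> S" "t \<in> S" "z \<in> V" "between s z t"
  shows "z \<in> S"
proof -
  have ab4: "d a z \<le> 4" "d b z \<le> 4"
  proof -
    have "d c z \<le> 4" if "c \<in> {a, b}" for c
    proof -
      have c: "c \<in> V" "s \<in> nbrs G c" "t \<in> nbrs G c" using that assms(1,2) abV S_eq by auto
      have "d c z \<le> max (d c s) (d c t)"
        by (rule between_dist_le) (use assms c ST VT in auto)
      then show ?thesis using nbrs_iff[OF c(1)] c by (auto simp: max_def split: if_splits)
    qed
    then show "d a z \<le> 4" "d b z \<le> 4" by auto
  qed
  have "z \<noteq> a" "z \<noteq> b"
    using ab4 separates_far[OF sep ab] d_commute[of b a] VT abV by auto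
  then show ?thesis using ab4 nbrs_iff[of a z] nbrs_iff[of b z] abV assms(3) S_eq by auto
qed

end

section \<open>Separators whose span is a bistar with leaves on both sides\<close>

locale bistar_separator = common_neighbourhood T G S a b
  for T G :: "'a graph" and S :: "'a set" and a b :: 'a +
  fixes x y :: 'a
  assumes edge: "{x, y} \<in> edges T"
    and a_side: "v \<in> component G S a \<Longrightarrow> d v x < d v y"
    and b_side: "v \<in> component G S b \<Longrightarrow> d v y < d v x"
    and near: "s \<in> S \<Longrightarrow> d s x \<le> 1 \<or> d s y \<le> 1"
    and A_ne: "side S x y \<noteq> {}" and B_ne: "side S y x \<noteq> {}"
begin

text \<open>All assumptions are symmetric under exchanging a with b and x with y. Facts are proved
  for one side and imported for the other through the interpretation \<open>F\<close>.\<close>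

lemma flip: "bistar_separator T G S b a y x"
  by unfold_locales
    (use S_eq sep separates_sym[of G S a b] edge a_side b_side near A_ne B_ne in
      \<open>auto simp: insert_commute\<close>)

lemma xyT: "x \<in> verts T" "y \<in> verts T" "x \<noteq> y"
  using edgeD[OF edge] by auto

lemma edge_T: "d x y = 1" "d y x = 1"
  using edge d_edge[of x y] d_edge[of y x] by (auto simp: insert_commute)

lemma side_or: "v \<in> verts T \<Longrightarrow> d v x < d v y \<or> d v y < d v x"
  using edge_unequal[OF edge] by fastforce

lemma side_dist:
  assumes "v \<in> verts T" "d v x < d v y"
  shows "d v y = Suc (d v x)"
  using edge_dist_cases[OF edge assms(1)] assms(2) by linarith

lemma sideD:
  assumes "s \<in> side S x y"
  shows "s \<in> S" "s \<noteq> x" "s \<noteq> y" "d s x = 1" "d s y = 2" "{x, s} \<in> edges T" "s \<in> verts T"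
proof -
  show s: "s \<in> S" "s \<noteq> x" "s \<in> verts T" using assms ST by (auto simp: side_def)
  show "s \<noteq> y" using assms xyT by (auto simp: side_def)
  have "d s y = Suc (d s x)" "d s x \<noteq> 0"
    using side_dist[of s] assms s d_eq_0_iff xyT by (auto simp: side_def)
  then show "d s x = 1" "d s y = 2" using near[OF s(1)] by linarith+
  then show "{x, s} \<in> edges T" using d_eq_1_iff[of s x] s xyT by (simp add: insert_commute)
qed

lemma S_cases:
  assumes "s \<in> S"
  obtains "s = x" | "s = y" | "s \<in> side S x y" | "s \<in> side S y x"
  using assms side_or[of s] ST[of s] by (auto simp: side_def)

lemma nbrs_eq_side:
  assumes "side S x y \<subseteq> P" "P \<inter> side S y x = {}"
  shows "P \<inter> S - {x, y} = side S x y"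
proof
  show "P \<inter> S - {x, y} \<subseteq> side S x y" using assms(2) S_cases by blast
  show "side S x y \<subseteq> P \<inter> S - {x, y}" using assms(1) sideD(1-3) by blast
qed

lemma side_disjoint: "s \<in> side S x y \<Longrightarrow> s \<notin> side S y x"
  by (auto simp: side_def)

text \<open>The way passes both centers. Since the distance is the same for all leaves across, p
  sees either all of them or none.\<close>

lemma across:
  assumes "p \<in> verts T" "d p x < d p y" "s \<in> side S y x"
  shows "d p s = d p x + 2"
proof -
  interpret F: bistar_separator T G S b a y x by (rule flip)
  note s = F.sideD[OF assms(3)]
  have "d p s = d p x + 1 + d y s" using dist_across[OF edge assms(1) s(7) assms(2)] s(4,5) by simp
  moreover have "d y s = 1" using d_edge[OF s(6)] .
  ultimately show ?thesis by simp
qed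

lemma near_dist:
  assumes "p \<in> verts T" "s \<in> side S x y"
  shows "d p s \<le> Suc (d p x)"
proof -
  have "d p s \<le> d p x + d x s" using d_triangle sideD(7)[OF assms(2)] assms(1) xyT by blast
  then show ?thesis using d_edge[OF sideD(6)[OF assms(2)]] by simp
qed

text \<open>Leaves of the own side are within 2 + 1 of p, those across within 2 + 2.\<close>

lemma dist_le_imp_complete:
  assumes p: "p \<in> V - S" and "d p x < d p y" "d p x \<le> 2"
  shows "S \<subseteq> nbrs G p"
proof
  fix s assume s: "s \<in> S"
  note pT = VT[of p] and py = side_dist[of p]
  have "d p s \<le> 4"
    using s
  proof (cases rule: S_cases)
    case 3
    then show ?thesis using near_dist[of p s] pT assms by simp
  next
    case 4
    then show ?thesis using across[of p s] pT assms by simp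
  qed (use assms pT py in auto)
  then show "s \<in> nbrs G p" using p s S_V nbrs_iff[of p s] by auto
qed

text \<open>A neighbour across uses up 2 of the distance 4, which leaves at most 2 for the way from
  p to x.\<close>

lemma across_nbr_complete:
  assumes "p \<in> V - S" "d p x < d p y" "s \<in> side S y x" "s \<in> nbrs G p"
  shows "S \<subseteq> nbrs G p"
  using dist_le_imp_complete[OF assms(1,2)] across[of p s] nbrs_iff[of p s] assms VT[of p] by auto

lemma S_clique: "clique G S"
  unfolding clique_def
proof (intro conjI ballI impI S_V)
  fix s t assume st: "s \<in> S" "t \<in> S" "s \<noteq> t"
  have T: "s \<in> verts T" "t \<in> verts T" using ST st by auto
  have "d s t \<le> d s x + d x t" "d s t \<le> d s y + d y t" "d x t \<le> d x y + d y t" "d y t \<le> d y x + d x t"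
    using d_triangle T xyT by blast+
  moreover have "d x t = d t x" "d y t = d t y" using d_commute T xyT by blast+
  ultimately have "d s t \<le> 4" using near[OF st(1)] near[OF st(2)] edge_T by linarith
  then show "{s, t} \<in> edges G" using nbrs_iff[of s t] st S_V by (auto simp: nbrs_def)
qed

lemma between_centres:
  assumes "s \<in> side S x y" "t \<in> side S y x"
  shows "between s x t" "between s y t"
proof -
  interpret F: bistar_separator T G S b a y x by (rule flip)
  note s = sideD[OF assms(1)] and t = F.sideD[OF assms(2)]
  have "d s t = 3" using across[OF s(7) _ assms(2)] s by simp
  moreover have "d x t = 2" "d y t = 1" using d_commute t xyT by metis+
  ultimately show "between s x t" "between s y t" using s by (simp_all add: between_def)
qed

lemma centres_in_S: "x \<in> V \<Longrightarrow> x \<in> S" "y \<in> V \<Longrightarrow> y \<in> S"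
  using A_ne B_ne between_centres between_in_S sideD(1) bistar_separator.sideD(1)[OF flip]
  by (metis ex_in_conv)+

lemma leaf_edge:
  assumes "s \<in> S - {x, y}"
  shows "{s, if s \<in> side S x y then x else y} \<in> edges T"
proof -
  interpret F: bistar_separator T G S b a y x by (rule flip)
  have "s \<in> S" using assms by simp
  then show ?thesis
  proof (cases rule: S_cases)
    case 3
    then show ?thesis using sideD(6) by (simp add: insert_commute)
  next
    case 4
    then show ?thesis using F.sideD(6) F.side_disjoint by (auto simp: insert_commute)
  qed (use assms in auto)
qed

lemma span: "T\<langle>S\<rangle> = bistar S (side S x y) x y"
proof -
  interpret F: bistar_separator T G S b a y x by (rule flip)
  show ?thesis
  proof (rule span_tree_eq_bistar)
    show "z \<in> S \<or> (\<exists>s\<in>S. \<exists>t\<in>S. between s z t)" if "z \<in> {x, y}" for z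
      using that A_ne B_ne between_centres sideD(1) F.sideD(1) by blast
  qed (use ST xyT edge leaf_edge in auto)
qed

lemma span_induced: "T\<langle>S\<rangle> = induced T (insert x (insert y S))"
  unfolding span by (rule induced_eq_bistar[symmetric]) (use ST xyT edge leaf_edge in auto)

lemma equivalent:
  assumes D: "\<And>s. s \<in> S - {x, y} \<Longrightarrow> s \<in> D \<longleftrightarrow> s \<in> side S x y"
    and "n1 \<notin> V" "n2 \<notin> V" "n1 \<noteq> n2"
  shows "steiner_equivalent V T\<langle>S\<rangle>
    (bistar S D (if x \<in> V then x else n1) (if y \<in> V then y else n2))"
proof -
  have "T\<langle>S\<rangle> = bistar S D x y" unfolding span using D by (intro bistar_cong) auto
  moreover have "steiner_equivalent V (bistar S D x y)
    (bistar S D (if x \<in> V then x else n1) (if y \<in> V then y else n2))"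
    by (rule steiner_equivalent_bistar) (use S_V centres_in_S assms xyT in auto)
  ultimately show ?thesis by simp
qed

lemma eq_side_iff:
  assumes "P \<inter> S - {x, y} = side S x y" "s \<in> S - {x, y}"
  shows "s \<in> P \<longleftrightarrow> s \<in> side S x y"
  using assms by blast

text \<open>Extend S with a and S with b to maximal cliques. As a and b are neither equal nor
  adjacent, a vertex in both cliques is a common neighbour of a and b, hence in S. So the conditions
  on a well-structured root can be applied to S.\<close>

lemma S_clique_intersection: "clique_intersection G S"
proof -
  interpret F: bistar_separator T G S b a y x by (rule flip)
  have cl: "clique G (insert c S)" if "c \<in> {a, b}" for c
    unfolding clique_def
  proof (intro conjI ballI impI)
    have cS: "{c, v} \<in> edges G" "{v, c} \<in> edges G" if "v \<in> S" for v
      using that S_eq \<open>c \<in> {a, b}\<close> by (auto simp: nbrs_def insert_commute[of v])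
    show "insert c S \<subseteq> V" using that abV S_V by auto
    show "{u, v} \<in> edges G" if "u \<in> insert c S" "v \<in> insert c S" "u \<noteq> v" for u v
      using that cS S_clique by (auto simp: clique_def)
  qed
  obtain K1 K2 where K: "maximal_clique G K1" "insert a S \<subseteq> K1" "maximal_clique G K2" "insert b S \<subseteq> K2"
    using ex_maximal_clique[OF finite_V cl] by (metis insertI1 insertI2)
  have "K1 \<inter> K2 \<subseteq> S"
  proof
    fix v assume v: "v \<in> K1 \<inter> K2"
    have "{a, v} \<in> edges G \<or> v = a" "{b, v} \<in> edges G \<or> v = b"
      using v K by (auto simp: maximal_clique_def clique_def)
    then show "v \<in> S"
      using separates_not_adjacent[OF sep] by (auto simp: S_eq nbrs_def insert_commute)
  qed
  then have "S = \<Inter>{K1, K2}" using K by auto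
  moreover have "S \<noteq> {}" using A_ne sideD(1) by blast
  ultimately show ?thesis using K unfolding clique_intersection_def by (intro conjI exI[of _ "{K1, K2}"]) auto
qed

text \<open>If some neighbourhood has one of the two sides as its trace, it can serve as D directly.
  Otherwise a vertex that sees all leaves of one side and none of the other is a contradiction, and
  this makes \<open>linked\<close> reliable.\<close>

definition uncut :: bool where
  "uncut \<longleftrightarrow> (\<forall>p\<in>V. nbrs G p \<inter> S - {x, y} \<noteq> side S x y \<and> nbrs G p \<inter> S - {x, y} \<noteq> side S y x)"

lemma uncut_flip: "bistar_separator.uncut T G S y x \<longleftrightarrow> uncut"
  unfolding uncut_def bistar_separator.uncut_def[OF flip] by (auto simp: insert_commute)

lemma incomplete_side:
  assumes "incomplete G S p" "v \<in> side S x y" "v \<in> nbrs G p"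
  shows "d p x < d p y"
proof (rule ccontr)
  interpret F: bistar_separator T G S b a y x by (rule flip)
  assume "\<not> ?thesis"
  then have "d p y < d p x" using side_or[of p] VT[of p] assms(1) by (auto simp: incomplete_def)
  then show False using F.across_nbr_complete[of p v] assms by (auto simp: incomplete_def)
qed

text \<open>A witness p seeing a leaf at y lies on the side of y. As it also sees x, it is within 3
  of y, so it sees all leaves at y, and none at x because it is incomplete. Its neighbourhood would
  cut S.\<close>

lemma linked_side:
  assumes "uncut" "x \<in> S" "linked G S v x" "v \<in> S"
  shows "v \<notin> side S y x"
proof
  interpret F: bistar_separator T G S b a y x by (rule flip)
  assume v: "v \<in> side S y x"
  obtain p where p: "incomplete G S p" "v \<in> nbrs G p" "x \<in> nbrs G p"
    using assms(3) by (auto simp: linked_def)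
  have side: "d p y < d p x" using F.incomplete_side p v by blast
  have pV: "p \<in> V - S" "p \<in> V" using p by (auto simp: incomplete_def)
  have pT: "p \<in> verts T" using VT pV by simp
  have "d p y \<le> 3" using F.side_dist[OF pT side] p(3) nbrs_iff[OF pV(2)] by simp
  then have "side S y x \<subseteq> nbrs G p"
    using F.near_dist[OF pT] nbrs_iff[OF pV(2)] pV S_V F.sideD(1) by fastforce
  moreover have "nbrs G p \<inter> side S x y = {}"
    using incomplete_side[OF p(1)] side by fastforce
  ultimately have "nbrs G p \<inter> S - {y, x} = side S y x"
    by (rule F.nbrs_eq_side)
  then show False using assms(1) pV by (auto simp: uncut_def insert_commute)
qed

text \<open>The component of a lies on the side of x, and an incomplete vertex there sees no leaf
  across.\<close>

lemma marked_side:
  assumes "marked G S a v"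
  shows "v \<notin> side S y x"
proof
  assume v: "v \<in> side S y x"
  obtain p where p: "incomplete G S p" "p \<in> component G S a" "v \<in> nbrs G p"
    using assms by (auto simp: marked_def)
  then show False using across_nbr_complete[of p v] a_side[of p] v by (auto simp: incomplete_def)
qed

text \<open>Some maximal clique containing X omits part of S, so it has an incomplete vertex p,
  which sees v and a second vertex z of X. If z is the center x, then v is linked to it. Otherwise
  the neighbourhood of p turns out to cut S.\<close>

lemma constrained_by_smaller:
  assumes "uncut" and v: "v \<in> side S x y" and X: "clique_intersection G X" "X \<subset> S" "v \<in> X" "card X \<ge> 2"
  shows "x \<in> S \<and> linked G S v x"
proof -
  obtain F where F: "\<And>K. K \<in> F \<Longrightarrow> maximal_clique G K" "X = \<Inter>F"
    using X(1) by (auto simp: clique_intersection_def)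
  then obtain K where K: "K \<in> F" "\<not> S \<subseteq> K" using X(2) by blast
  obtain p where p: "p \<in> K - S" "\<not> S \<subseteq> nbrs G p"
    using maximal_clique_not_superset F(1) K S_clique by metis
  have Kc: "clique G K" using F(1)[OF K(1)] by (simp add: maximal_clique_def)
  have pV: "p \<in> V" using p Kc by (auto simp: clique_def)
  have inc: "incomplete G S p" using p pV by (simp add: incomplete_def)
  have Xp: "X \<subseteq> nbrs G p" 
  proof
    fix z assume "z \<in> X"
    then have "z \<in> K" "p \<in> K" "p \<noteq> z" using p F(2) K(1) X(2) by auto
    then show "z \<in> nbrs G p" using Kc by (simp add: clique_def nbrs_def)
  qed
  have "X \<noteq> {v}" using X(4) by auto
  then obtain z where z: "z \<in> X" "z \<noteq> v" using X(3) by blast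
  have vp: "v \<in> nbrs G p" and zp: "z \<in> nbrs G p" and zS: "z \<in> S" using Xp X z by auto
  have side: "d p x < d p y" using incomplete_side inc v vp by blast
  have pT: "p \<in> verts T" using VT pV by simp
  show ?thesis
  proof (cases "z = x")
    case True
    then show ?thesis using inc vp zp zS by (auto simp: linked_def)
  next
    case False
    have "{x, z} \<in> edges T"
      using zS
    proof (cases rule: S_cases)
      case 4
      then show ?thesis using across_nbr_complete[of p z] side zp inc by (auto simp: incomplete_def)
    qed (use False edge sideD(6) in auto)
    \<comment> \<open>Now v and z are two neighbours of x in T that are within 4 of p. So p is
      within 3 of x and sees every leaf at x.\<close>
    then have "Suc (d p x) \<le> 4"
      using d_centre_le[OF sideD(6)[OF v]] z pT vp zp nbrs_iff[OF pV] by metis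
    then have "side S x y \<subseteq> nbrs G p"
      using near_dist[OF pT] nbrs_iff[OF pV] p S_V sideD(1) by fastforce
    moreover have "nbrs G p \<inter> side S y x = {}"
      using across_nbr_complete[of p] side inc by (auto simp: incomplete_def)
    ultimately have "nbrs G p \<inter> S - {x, y} = side S x y"
      by (rule nbrs_eq_side)
    then show ?thesis using assms(1) pV by (auto simp: uncut_def)
  qed
qed

text \<open>A further vertex u of X1 and X2 sees all of S, and a maximal clique around X2 has an
  incomplete vertex p that sees both u and v. To connect p with a outside S, u is shown to be on the
  side of x. Seeing leaves across, u and a are both within 2 of x, hence adjacent or equal.\<close>

lemma constrained_by_larger:
  assumes v: "v \<in> side S x y"
    and X: "clique_intersection G X1" "clique_intersection G X2" "S \<subset> X1" "S \<inter> X2 = {v}" "{v} \<subset> X1 \<inter> X2"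
  shows "marked G S a v"
proof -
  interpret F: bistar_separator T G S b a y x by (rule flip)
  obtain u where u: "u \<in> X1" "u \<in> X2" "u \<noteq> v" using X(5) by blast
  have uS: "u \<notin> S" using u X(4) by blast
  obtain F where F: "\<And>K. K \<in> F \<Longrightarrow> maximal_clique G K" "X2 = \<Inter>F"
    using X(2) by (auto simp: clique_intersection_def)
  have "\<not> S \<subseteq> X2"
  proof
    assume "S \<subseteq> X2"
    then have "S = {v}" using X(4) by auto
    then show False using B_ne F.sideD(1) side_disjoint[OF v] by (metis ex_in_conv singletonD)
  qed
  then obtain K where K: "K \<in> F" "\<not> S \<subseteq> K" using F(2) by blast
  have Kc: "clique G K" using F(1)[OF K(1)] by (simp add: maximal_clique_def)
  have X2K: "u \<in> K" "v \<in> K" using F(2) K(1) u X(4) by auto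
  obtain p where p: "p \<in> K - S" "\<not> S \<subseteq> nbrs G p"
    using maximal_clique_not_superset F(1) K S_clique by metis
  have pV: "p \<in> V" using p Kc by (auto simp: clique_def)
  have pT: "p \<in> verts T" using VT pV by simp
  have inc: "incomplete G S p" using p pV by (simp add: incomplete_def)
  have vp: "v \<in> nbrs G p" using Kc p X2K sideD(1)[OF v] by (auto simp: clique_def nbrs_def)
  have side: "d p x < d p y" using incomplete_side inc v vp by blast
  obtain K1 where "maximal_clique G K1" "X1 \<subseteq> K1" using X(1) by (auto simp: clique_intersection_def)
  then have K1: "clique G K1" "X1 \<subseteq> K1" by (auto simp: maximal_clique_def)
  have uV: "u \<in> V" and uT: "u \<in> verts T" using K1 u VT by (auto simp: clique_def)
  have Su: "S \<subseteq> nbrs G u" 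
  proof
    fix s assume "s \<in> S"
    then have "s \<in> K1" "u \<in> K1" "u \<noteq> s" using K1(2) u X(3) uS by auto
    then show "s \<in> nbrs G u" using K1(1) by (simp add: clique_def nbrs_def)
  qed
  have "u \<noteq> p" using Su p by blast
  then have pu: "{p, u} \<in> edges G" using Kc p X2K by (auto simp: clique_def)
  have p3: "d p x \<ge> 3" using dist_le_imp_complete[of p] p pV side by fastforce
  \<comment> \<open>As p is incomplete, it has distance at least 3 from x. Within 4 of p the only
    vertex across the edge is then y itself, but a real y belongs to S.\<close>
  have u_side: "d u x < d u y"
  proof (rule ccontr)
    assume "\<not> ?thesis"
    then have yu: "d u y < d u x" using side_or[OF uT] by blast
    have "d p u = d p x + 1 + d y u" using dist_across[OF edge pT uT side yu] .
    then have "d y u = 0" using p3 edge_G[OF pu] by simp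
    then have "u = y" using d_eq_0_iff uT xyT by simp
    then show False using centres_in_S uV uS by blast
  qed
  obtain t where t: "t \<in> side S y x" using B_ne by blast
  have tS: "t \<in> nbrs G u" "t \<in> nbrs G a" using t F.sideD(1) Su S_eq by auto
  have aT: "a \<in> verts T" and aV: "a \<in> V" using abV VT by auto
  have "d u t = d u x + 2" "d a t = d a x + 2"
    using across t uT u_side aT a_side[OF ab(1)] by blast+
  then have "d u x \<le> 2" "d a x \<le> 2" using tS nbrs_iff[OF uV] nbrs_iff[OF aV] by auto
  moreover have "d a u \<le> d a x + d x u" "d x u = d u x" using d_triangle d_commute uT aT xyT by blast+
  ultimately have "u \<in> nbrs G a \<or> u = a" using nbrs_iff[OF aV, of u] uV by auto
  then have "u \<in> component G S a"
    using component_step[OF ab(1), of u] ab(1) uV uS by (auto simp: nbrs_def)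
  then have "p \<in> component G S a"
    using component_step[of u G S a p] pu p pV \<open>u \<noteq> p\<close> by (simp add: insert_commute)
  then show ?thesis using inc vp by (auto simp: marked_def)
qed

lemma constrained_side:
  assumes "uncut" "v \<in> side S x y" "constrained G S v"
  shows "marked G S a v \<or> x \<in> S \<and> linked G S v x"
  using assms constrained_by_smaller constrained_by_larger unfolding constrained_def by meson

lemma ecc_span_le_iff:
  assumes "u \<in> insert x (insert y S)"
  shows "ecc T\<langle>S\<rangle> u \<le> k \<longleftrightarrow> (\<forall>v\<in>insert x (insert y S). d u v \<le> k)"
proof -
  let ?U = "insert x (insert y S)"
  have con: "connected_graph (induced T ?U)" using span span_induced connected_bistar by metis
  have UT: "?U \<subseteq> verts T" using ST xyT by auto
  then have verts: "verts (induced T ?U) = ?U" by (auto simp: induced_def)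
  have fin: "finite ?U" using finite_subset[OF UT finite_verts] .
  show ?thesis
    unfolding span_induced ecc_def verts using assms fin dist_induced[OF con assms _ UT]
    by (subst Max_le_iff) auto
qed

lemma ecc_centre: "ecc T\<langle>S\<rangle> x = 2"
proof -
  interpret F: bistar_separator T G S b a y x by (rule flip)
  have "d x v \<le> 2" if "v \<in> insert x (insert y S)" for v
  proof -
    have "v \<in> S \<or> v = x \<or> v = y" using that by blast
    then have "v = x \<or> v = y \<or> v \<in> side S x y \<or> v \<in> side S y x" by (auto elim: S_cases)
    moreover have "d x v = d v x" using d_commute that xyT ST by blast
    ultimately show ?thesis using edge_T xyT sideD(4) F.sideD(5) by fastforce
  qed
  then have "ecc T\<langle>S\<rangle> x \<le> 2" using ecc_span_le_iff by blast
  moreover obtain t where t: "t \<in> side S y x" using B_ne by blast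
  moreover have "d x t = 2" using F.sideD[OF t] d_commute xyT by metis
  ultimately show ?thesis
    using ecc_span_le_iff[of x 1] F.sideD(1)[OF t] by force
qed

lemma ecc_leaf: "s \<in> side S x y \<Longrightarrow> ecc T\<langle>S\<rangle> s > 2"
proof (rule ccontr)
  interpret F: bistar_separator T G S b a y x by (rule flip)
  assume s: "s \<in> side S x y" and "\<not> ecc T\<langle>S\<rangle> s > 2"
  then have le: "\<forall>v\<in>insert x (insert y S). d s v \<le> 2" 
    using ecc_span_le_iff[of s 2] sideD(1)[OF s] by simp
  obtain t where t: "t \<in> side S y x" using B_ne by blast
  then have "d s t = 3" using across[OF sideD(7)[OF s] _ t] sideD[OF s] by simp
  moreover have "d s t \<le> 2" using le F.sideD(1)[OF t] by blast
  ultimately show False by simp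
qed

text \<open>Both x and y have eccentricity 2, while each leaf has a leaf at distance 3 on the other
  side. So the center named in condition (2) of a well-structured root is x or y.\<close>

lemma centre: "center T\<langle>S\<rangle> = {x, y}"
proof -
  interpret F: bistar_separator T G S b a y x by (rule flip)
  have verts: "verts T\<langle>S\<rangle> = insert x (insert y S)" by (simp add: span bistar_def)
  have "ecc T\<langle>S\<rangle> v > 2" if "v \<in> S - {x, y}" for v
    using that ecc_leaf F.ecc_leaf S_cases[of v] by blast
  then show ?thesis using ecc_centre F.ecc_centre unfolding center_def verts by fastforce
qed

text \<open>If x is the favoured center, each free leaf at y is an exception, being nearer to y. So
  there is at most one; it is taken as f, and \<open>none\<close> if it does not exist. The other
  leaves at y are constrained and thus detected. \<open>none\<close> also names a Steiner center: it
  has no neighbours in G, so nothing is linked to it.\<close>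

lemma side_set_far_side:
  assumes "uncut" "none \<notin> V"
    and card: "card {v \<in> free_vertices G S. d v x \<noteq> dist_set T v {x, y}} \<le> 1"
  obtains f where "f \<in> insert none V"
    "\<And>s. s \<in> S - {x, y} \<Longrightarrow>
       s \<in> side_set G S b f (if y \<in> V then y else none) \<longleftrightarrow> s \<in> side S y x"
proof -
  interpret F: bistar_separator T G S b a y x by (rule flip)
  let ?Z = "{v \<in> free_vertices G S. d v x \<noteq> dist_set T v {x, y}}"
  let ?B = "{v \<in> side S y x. \<not> constrained G S v}"
  have "?B \<subseteq> ?Z"
    using F.sideD by (auto simp: free_vertices_def dist_set_def)
  moreover have "finite ?Z"
    using finite_subset[OF S_V finite_V] by (auto simp: free_vertices_def)
  ultimately have fin: "finite ?B" "card ?B \<le> 1"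
    using card finite_subset card_mono by (blast, metis (no_types, lifting) order_trans)
  obtain f where f: "?B = {} \<and> f = none \<or> ?B = {f}"
  proof (cases "?B = {}")
    case False
    then have "card ?B = 1" using fin card_0_eq by (metis One_nat_def le_SucE le_zero_eq)
    then show ?thesis using that card_1_singletonE by metis
  qed (use that in blast)
  have nbrs_V: "none \<notin> nbrs G p" for p
    using assms(2) edge_G[of p none] by (auto simp: nbrs_def)
  have "s \<in> side_set G S b f (if y \<in> V then y else none) \<longleftrightarrow> s \<in> side S y x"
    if s: "s \<in> S - {x, y}" for s
  proof
    assume L: "s \<in> side_set G S b f (if y \<in> V then y else none)"
    have "s \<notin> side S x y" if "marked G S b s" using F.marked_side that by blast
    moreover have "s \<notin> side S x y" if "linked G S s (if y \<in> V then y else none)"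
      using that nbrs_V F.linked_side[of s] uncut_flip assms(1) centres_in_S(2) s
      by (auto simp: linked_def split: if_splits)
    moreover have "s \<notin> side S x y" if "s = f"
      using f that s assms(2) S_V F.side_disjoint by auto
    ultimately have "s \<notin> side S x y" using L by (auto simp: side_set_def)
    then show "s \<in> side S y x" using s S_cases[of s] by blast
  next
    assume R: "s \<in> side S y x"
    show "s \<in> side_set G S b f (if y \<in> V then y else none)"
    proof (cases "constrained G S s")
      case True
      then show ?thesis
        using F.constrained_side[OF _ R] uncut_flip assms(1) S_V by (auto simp: side_set_def)
    next
      case False
      then show ?thesis using f R by (auto simp: side_set_def)
    qed
  qed
  moreover have "f \<in> insert none V" using f F.sideD(1) S_V by blast
  ultimately show ?thesis using that by blast
qed

text \<open>The center of the guessed side is d1, and d2 is the opposite one. n1 and n2 are names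
  for Steiner centers; n1 is also the value of f when there is no exceptional leaf.\<close>

definition candidate :: "'a \<Rightarrow> 'a \<Rightarrow> 'a \<Rightarrow> 'a \<Rightarrow> 'a set \<Rightarrow> bool" where
  "candidate n1 n2 d1 d2 D \<longleftrightarrow> d1 \<in> insert n1 V \<and> d2 \<in> insert n2 V \<and>
     (D \<in> nbrs G ` V \<or> (\<exists>e\<in>{a, b}. \<exists>f\<in>insert n1 V. D = side_set G S e f d1)) \<and>
     steiner_equivalent V T\<langle>S\<rangle> (bistar S D d1 d2)"

lemma candidate_flip: "bistar_separator.candidate T G S b a n1 n2 d1 d2 D \<longleftrightarrow> candidate n1 n2 d1 d2 D"
  unfolding candidate_def bistar_separator.candidate_def[OF flip] by (auto simp: insert_commute)

text \<open>The hypothesis favours x, so the side to be guessed is that of y, and y comes first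
  among the centers.\<close>

lemma candidate_centre:
  assumes "uncut" and n: "n1 \<notin> V" "n2 \<notin> V" "n1 \<noteq> n2"
    and card: "card {v \<in> free_vertices G S. d v x \<noteq> dist_set T v {x, y}} \<le> 1"
  shows "\<exists>d1 d2 D. candidate n1 n2 d1 d2 D"
proof -
  interpret F: bistar_separator T G S b a y x by (rule flip)
  let ?d1 = "if y \<in> V then y else n1" and ?d2 = "if x \<in> V then x else n2"
  obtain f where f: "f \<in> insert n1 V"
    "\<And>s. s \<in> S - {x, y} \<Longrightarrow> s \<in> side_set G S b f ?d1 \<longleftrightarrow> s \<in> side S y x"
    using side_set_far_side[OF assms(1) n(1) card] by metis
  have "steiner_equivalent V T\<langle>S\<rangle> (bistar S (side_set G S b f ?d1) ?d1 ?d2)"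
    by (rule F.equivalent) (use f n in auto)
  then have "candidate n1 n2 ?d1 ?d2 (side_set G S b f ?d1)"
    using f(1) unfolding candidate_def by (simp, blast)
  then show ?thesis by blast
qed

lemma candidate_cut:
  assumes n: "n1 \<notin> V" "n2 \<notin> V" "n1 \<noteq> n2" and p: "p \<in> V" "nbrs G p \<inter> S - {x, y} = side S x y"
  shows "\<exists>d1 d2 D. candidate n1 n2 d1 d2 D"
proof -
  let ?d1 = "if x \<in> V then x else n1" and ?d2 = "if y \<in> V then y else n2"
  have "steiner_equivalent V T\<langle>S\<rangle> (bistar S (nbrs G p) ?d1 ?d2)"
    by (rule equivalent) (use eq_side_iff[OF p(2)] n in auto)
  then have "candidate n1 n2 ?d1 ?d2 (nbrs G p)"
    using p(1) unfolding candidate_def by auto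
  then show ?thesis by blast
qed

lemma ex_candidate:
  assumes ws: "well_structured G T" and n: "n1 \<notin> V" "n2 \<notin> V" "n1 \<noteq> n2"
  shows "\<exists>d1 d2 D. candidate n1 n2 d1 d2 D"
proof (cases uncut)
  interpret F: bistar_separator T G S b a y x by (rule flip)
  case True
  obtain c where c: "c \<in> {x, y}" "card {v \<in> free_vertices G S. d v c \<noteq> dist_set T v {x, y}} \<le> 1"
    using ws S_clique_intersection unfolding well_structured_def centre[symmetric] by blast
  show ?thesis
  proof (cases "c = x")
    case True
    then show ?thesis using candidate_centre \<open>uncut\<close> n c by simp
  next
    case False
    then have "c = y" using c by simp
    then show ?thesis
      using F.candidate_centre[unfolded candidate_flip] \<open>uncut\<close> uncut_flip n c by (simp add: insert_commute)
  qed
next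
  interpret F: bistar_separator T G S b a y x by (rule flip)
  case False
  then obtain p where p: "p \<in> V"
    "nbrs G p \<inter> S - {x, y} = side S x y \<or> nbrs G p \<inter> S - {y, x} = side S y x"
    unfolding uncut_def by (metis insert_commute)
  then show ?thesis
    using candidate_cut[OF n p(1)] F.candidate_cut[OF n p(1)] unfolding candidate_flip by argo
qed

end

section \<open>Star-shaped and empty separators, and the complete list of candidates\<close>

context common_neighbourhood
begin

lemma star_equivalent:
  assumes c: "c \<in> verts T" "\<And>s. s \<in> S \<Longrightarrow> s = c \<or> {c, s} \<in> edges T" and "S \<noteq> {}" "n1 \<notin> V"
  shows "\<exists>d1\<in>insert n1 V. steiner_equivalent V T\<langle>S\<rangle> (bistar S D d1 d1)"
proof (cases "\<exists>u. S = {u}")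
  case True
  \<comment> \<open>A single vertex spans only itself, even if the given center c is a different
    vertex.\<close>
  then obtain u where u: "S = {u}" by blast
  have "T\<langle>S\<rangle> = bistar S D u u"
    by (rule span_tree_eq_bistar) (use u ST in auto)
  then show ?thesis
    using steiner_equivalent_bistar[of S V u u u u D] u S_V by auto
next
  case False
  then obtain s t where st: "s \<in> S" "t \<in> S" "s \<noteq> t" using assms(3) by blast
  have between: "between s c t" if "c \<notin> S"
  proof -
    have e: "{c, s} \<in> edges T" "{c, t} \<in> edges T" using c(2) st that by auto
    then have "d s c = 1" "d c t = 1" "d s t = 2"
      using d_edge[of s c] d_edge[of c t] d_neighbours[OF e st(3)] by (auto simp: insert_commute)
    then show ?thesis by (simp add: between_def)
  qed
  have "T\<langle>S\<rangle> = bistar S D c c"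
  proof (rule span_tree_eq_bistar)
    show "{s, if s \<in> D then c else c} \<in> edges T" if "s \<in> S - {c, c}" for s
      using that c(2)[of s] by (auto simp: insert_commute)
    show "z \<in> S \<or> (\<exists>s\<in>S. \<exists>t\<in>S. between s z t)" if "z \<in> {c, c}" for z
      using that st between by blast
  qed (use c ST in auto)
  moreover have "c \<in> V \<Longrightarrow> c \<in> S" using between between_in_S st by blast
  ultimately show ?thesis
    using steiner_equivalent_bistar[of S V c "if c \<in> V then c else n1" c "if c \<in> V then c else n1" D]
      S_V assms(4) by (auto split: if_splits)
qed

lemma span_empty: "T\<langle>{}\<rangle> = ({}, {})"
proof -
  have "induced T {} = ({}, {})" using simple by (auto simp: induced_def simple_graph_def)
  then show ?thesis
    using span_tree_eq_induced[of "{}" "{}"] by (auto simp: connected_graph_def)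
qed

theorem span_candidates:
  assumes ws: "well_structured G T" and n: "n1 \<notin> V" "n2 \<notin> V" "n1 \<noteq> n2"
  shows "steiner_equivalent V T\<langle>S\<rangle> ({}, {}) \<or>
    (\<exists>d1\<in>insert n1 V. \<exists>d2\<in>insert n1 (insert n2 V). \<exists>D.
       (D \<in> nbrs G ` V \<or> (\<exists>e\<in>{a, b}. \<exists>f\<in>insert n1 V. D = side_set G S e f d1)) \<and>
       steiner_equivalent V T\<langle>S\<rangle> (bistar S D d1 d2))"
proof (cases "S = {}")
  case True
  then have "steiner_equivalent V T\<langle>S\<rangle> ({}, {})"
    using span_empty by (simp add: steiner_equivalent_def bij_betw_def)
  then show ?thesis ..
next
  case False
  have adj: "{s, a} \<in> edges G" "{s, b} \<in> edges G" if "s \<in> S" for s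
    using that S_eq by (auto simp: nbrs_def insert_commute)
  obtain x y a' where xy: "{x, y} \<in> edges T"
    and sides: "\<And>v. v \<in> component G S a \<Longrightarrow> d v x < d v y" "\<And>v. v \<in> component G S b \<Longrightarrow> d v y < d v x"
    and near: "\<And>s. s \<in> S \<Longrightarrow> d s x \<le> 1 \<or> d s y \<le> 1"
    using separating_edge[OF sep] adj ab by metis
  note xyT = edgeD[OF xy]
  show ?thesis
  proof (cases "side S x y = {} \<or> side S y x = {}")
    case True
    \<comment> \<open>If no leaf hangs at u, every vertex of S other than u is nearer to v and thus
      within 1 of it, and u itself is adjacent to v.\<close>
    have star: "s = v \<or> {v, s} \<in> edges T"
      if uv: "{u, v} = {x, y}" "side S u v = {}" and s: "s \<in> S" for u v s
    proof -
      have e: "{u, v} \<in> edges T" using uv xy by simp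
      note euv = edgeD[OF e]
      have sT: "s \<in> verts T" using ST s .
      have "d s u \<le> 1 \<or> d s v \<le> 1" using near[OF s] uv(1) by (auto simp: doubleton_eq_iff)
      moreover have "s = u \<or> d s v < d s u"
        using uv(2) s edge_unequal[OF e sT] by (force simp: side_def)
      ultimately have "s = u \<or> d s v \<le> 1" by linarith
      then have "s = u \<or> d s v = 0 \<or> d s v = 1" by linarith
      then show ?thesis
        using d_eq_0_iff[OF sT euv(2)] d_eq_1_iff[OF sT euv(2)] e by (auto simp: insert_commute)
    qed
    have aV: "a \<in> V" using abV by simp
    obtain c where "c \<in> verts T" "\<And>s. s \<in> S \<Longrightarrow> s = c \<or> {c, s} \<in> edges T"
      using True star[of x y] star[of y x] xyT by (metis insert_commute)
    \<comment> \<open>For equal centers every D yields the same star; the neighbourhood of a is a D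
      that the list contains.\<close>
    from star_equivalent[OF this False n(1)]
    obtain d1 where "d1 \<in> insert n1 V" "steiner_equivalent V T\<langle>S\<rangle> (bistar S (nbrs G a) d1 d1)"
      by blast
    then show ?thesis using aV by blast
  next
    case False
    interpret bistar_separator T G S a b x y
      by unfold_locales (use xy sides near False in auto)
    show ?thesis using ex_candidate[OF ws n] unfolding candidate_def by blast
  qed
qed

end

section \<open>Word bounds\<close>

lemma fits_mono: "fits W e s \<Longrightarrow> W \<le> W' \<Longrightarrow> fits W' e s"
  by (induction e) auto

lemma exec_mono: "exec W c s t s' \<Longrightarrow> W \<le> W' \<Longrightarrow> exec W' c s t s'"
  by (induction rule: exec.induct) (blast intro: exec.intros fits_mono)+

text \<open>The exponent in \<open>val e s + 2 \<le> (V + 2) ^ exp_weight e\<close> for cells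
  bounded by V. With the offset 2, products of bounds dominate sums as well as products of values. A
  constant a gets a + 1 because of \<open>a + 2 \<le> 2 ^ (a + 1)\<close>.\<close>

fun exp_weight :: "exp \<Rightarrow> nat" where
  "exp_weight (Const a) = a + 1"
| "exp_weight (Load e) = 1 + exp_weight e"
| "exp_weight (Add e f) = exp_weight e + exp_weight f"
| "exp_weight (Sub e f) = exp_weight e + exp_weight f"
| "exp_weight (Mul e f) = exp_weight e + exp_weight f"
| "exp_weight (Div e f) = exp_weight e + exp_weight f"

fun weight :: "com \<Rightarrow> nat" where
  "weight Skip = 0"
| "weight (Store a e) = exp_weight a + exp_weight e"
| "weight (Seq c d) = weight c + weight d"
| "weight (If b c d) = exp_weight b + weight c + weight d"
| "weight (While b c) = exp_weight b + weight c"

lemma power_weight_mono: "a \<le> b \<Longrightarrow> ((V::nat) + 2) ^ a \<le> (V + 2) ^ b"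
  by (rule power_increasing) auto

lemma val_bound:
  assumes "\<And>i. s i \<le> V"
  shows "val e s + 2 \<le> (V + 2) ^ exp_weight e"
proof (induction e)
  case (Const a)
  have "a + 2 \<le> 2 ^ (a + 1)" by (induction a) auto
  also have "\<dots> \<le> (V + 2) ^ (a + 1)" by (rule power_mono) auto
  finally show ?case by simp
next
  case (Load e)
  have "s (val e s) + 2 \<le> (V + 2) ^ 1" using assms by simp
  also have "\<dots> \<le> (V + 2) ^ (1 + exp_weight e)" by (rule power_weight_mono) simp
  finally show ?case by simp
next
  case (Add e f)
  have "val (Add e f) s + 2 \<le> (val e s + 2) * (val f s + 2)" by (simp add: algebra_simps)
  also have "\<dots> \<le> (V + 2) ^ exp_weight e * (V + 2) ^ exp_weight f" using Add by (intro mult_mono) auto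
  finally show ?case by (simp add: power_add)
next
  case (Sub e f)
  have "val (Sub e f) s + 2 \<le> (val e s + 2) * (val f s + 2)" by (simp add: algebra_simps)
  also have "\<dots> \<le> (V + 2) ^ exp_weight e * (V + 2) ^ exp_weight f" using Sub by (intro mult_mono) auto
  finally show ?case by (simp add: power_add)
next
  case (Mul e f)
  have "val (Mul e f) s + 2 \<le> (val e s + 2) * (val f s + 2)" by (simp add: algebra_simps)
  also have "\<dots> \<le> (V + 2) ^ exp_weight e * (V + 2) ^ exp_weight f" using Mul by (intro mult_mono) auto
  finally show ?case by (simp add: power_add)
next
  case (Div e f)
  have "val (Div e f) s \<le> val e s" by simp
  moreover have "val e s + 2 \<le> (val e s + 2) * (val f s + 2)" by (simp add: algebra_simps)
  ultimately have "val (Div e f) s + 2 \<le> (val e s + 2) * (val f s + 2)" by linarith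
  also have "\<dots> \<le> (V + 2) ^ exp_weight e * (V + 2) ^ exp_weight f" using Div by (intro mult_mono) auto
  finally show ?case by (simp add: power_add)
qed

lemma fits_if_bound:
  assumes "\<And>i. s i \<le> V"
  shows "(V + 2) ^ exp_weight e \<le> W \<Longrightarrow> fits W e s"
proof (induction e)
  case (Const a)
  then show ?case using val_bound[of s V "Const a", OF assms] by simp
next
  case (Load e)
  have "fits W e s"
    using Load power_weight_mono[of "exp_weight e" "exp_weight (Load e)" V] by (simp add: order_trans)
  moreover have "val (Load e) s < W"
    using val_bound[of s V "Load e", OF assms] Load(2) by linarith
  ultimately show ?case by simp
next
  case (Add e f)
  have "fits W e s" "fits W f s"
    using Add power_weight_mono[of _ "exp_weight (Add e f)" V]
    by (metis exp_weight.simps(3) le_add1 order_trans, metis exp_weight.simps(3) le_add2 order_trans)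
  moreover have "val (Add e f) s < W"
    using val_bound[of s V "Add e f", OF assms] Add(3) by linarith
  ultimately show ?case by simp
next
  case (Sub e f)
  then show ?case
    using power_weight_mono[of _ "exp_weight (Sub e f)" V]
    by (metis exp_weight.simps(4) fits.simps(4) le_add1 le_add2 order_trans)
next
  case (Mul e f)
  have "fits W e s" "fits W f s"
    using Mul power_weight_mono[of _ "exp_weight (Mul e f)" V]
    by (metis exp_weight.simps(5) le_add1 order_trans, metis exp_weight.simps(5) le_add2 order_trans)
  moreover have "val (Mul e f) s < W"
    using val_bound[of s V "Mul e f", OF assms] Mul(3) by linarith
  ultimately show ?case by simp
next
  case (Div e f)
  then show ?case
    using power_weight_mono[of _ "exp_weight (Div e f)" V]
    by (metis exp_weight.simps(6) fits.simps(6) le_add1 le_add2 order_trans)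
qed

lemma power_weight_le:
  assumes "((U::nat) + 2) ^ w \<le> W" "V \<le> U" "a \<le> w"
  shows "(V + 2) ^ a \<le> W"
proof -
  have "(V + 2) ^ a \<le> (U + 2) ^ a" using assms(2) by (intro power_mono) auto
  also have "\<dots> \<le> (U + 2) ^ w" using assms(3) by (rule power_weight_mono)
  finally show ?thesis using assms(1) by simp
qed

lemma fits_if_power_le:
  assumes "((U::nat) + 2) ^ w \<le> W" "V \<le> U" "exp_weight e \<le> w" "\<And>i. s i \<le> V"
  shows "fits W e s"
  using fits_if_bound[OF assms(4)] power_weight_le[OF assms(1-3)] .

text \<open>If every stored value exceeds the largest cell by at most one, then the cells, and hence the
  values of all expressions, are bounded in terms of the running time. Word bounds need not be
  tracked during the execution.\<close>

fun small_step_exp :: "exp \<Rightarrow> bool" where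
  "small_step_exp (Const a) \<longleftrightarrow> a \<le> 1"
| "small_step_exp (Load e) \<longleftrightarrow> True"
| "small_step_exp (Add (Load e) (Const a)) \<longleftrightarrow> a = 1"
| "small_step_exp _ \<longleftrightarrow> False"

fun small_steps :: "com \<Rightarrow> bool" where
  "small_steps Skip \<longleftrightarrow> True"
| "small_steps (Store a e) \<longleftrightarrow> small_step_exp e"
| "small_steps (Seq c d) \<longleftrightarrow> small_steps c \<and> small_steps d"
| "small_steps (If b c d) \<longleftrightarrow> small_steps c \<and> small_steps d"
| "small_steps (While b c) \<longleftrightarrow> small_steps c"

lemma small_step_exp_val:
  assumes "small_step_exp e" "\<And>i. s i \<le> V"
  shows "val e s \<le> V + 1"
  using assms by (induction e rule: small_step_exp.induct) (auto simp: le_SucI)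

text \<open>A command takes at least one step and raises the maximum of the cells by at most 1. So
  the word bound can be chosen after the execution is known, from its duration t.\<close>

lemma exec_small_steps:
  assumes "exec W c s t s'" "small_steps c" "\<And>i. s i \<le> V"
  shows "(\<forall>i. s' i \<le> V + t) \<and> (\<forall>W'. (V + t + 2) ^ weight c \<le> W' \<longrightarrow> exec W' c s t s')"
  using assms
proof (induction arbitrary: V rule: exec.induct)
  case (1 s)
  have "exec W' Skip s 1 s" for W' by (rule exec.intros)
  then show ?case using 1 by (simp add: le_SucI)
next
  case (2 a s e)
  have "val e s \<le> V + 1" using 2 small_step_exp_val by simp
  moreover have "exec W' (Store a e) s (1 + cost a + cost e) (s(val a s := val e s))"
    if W': "(V + (1 + cost a + cost e) + 2) ^ weight (Store a e) \<le> W'" for W'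
    by (rule exec.intros) (rule fits_if_power_le[OF W' _ _ 2(4)]; simp)+
  moreover have "s i \<le> V + (1 + cost a + cost e)" for i using 2(4)[of i] by linarith
  ultimately show ?case by (simp add: fun_upd_def)
next
  case (3 c1 s t1 s1 c2 t2 s2)
  have 1: "(\<forall>i. s1 i \<le> V + t1) \<and> (\<forall>W'. (V + t1 + 2) ^ weight c1 \<le> W' \<longrightarrow> exec W' c1 s t1 s1)"
    using 3(3)[of V] 3(5,6) by simp
  then have 2: "(\<forall>i. s2 i \<le> V + t1 + t2) \<and> (\<forall>W'. (V + t1 + t2 + 2) ^ weight c2 \<le> W' \<longrightarrow> exec W' c2 s1 t2 s2)"
    using 3(4)[of "V + t1"] 3(5) by simp
  have "exec W' (Seq c1 c2) s (t1 + t2) s2"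
    if W': "(V + (t1 + t2) + 2) ^ weight (Seq c1 c2) \<le> W'" for W'
  proof (rule exec.intros)
    show "exec W' c1 s t1 s1" using 1 power_weight_le[OF W', of "V + t1" "weight c1"] by simp
    show "exec W' c2 s1 t2 s2" using 2 power_weight_le[OF W', of "V + t1 + t2" "weight c2"] by simp
  qed
  then show ?case using 2 by (simp add: add.assoc)
next
  case (4 b s c1 t s1 c2)
  have 1: "(\<forall>i. s1 i \<le> V + t) \<and> (\<forall>W'. (V + t + 2) ^ weight c1 \<le> W' \<longrightarrow> exec W' c1 s t s1)"
    using 4(4)[of V] 4(5,6) by simp
  have "exec W' (If b c1 c2) s (1 + cost b + t) s1"
    if W': "(V + (1 + cost b + t) + 2) ^ weight (If b c1 c2) \<le> W'" for W'
  proof (rule exec.intros(4))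
    show "fits W' b s" by (rule fits_if_power_le[OF W' _ _ 4(6)]) simp_all
    show "exec W' c1 s t s1" using 1 power_weight_le[OF W', of "V + t" "weight c1"] by simp
  qed fact
  moreover have "s1 i \<le> V + (1 + cost b + t)" for i using spec[OF conjunct1[OF 1], of i] by linarith
  ultimately show ?case by blast
next
  case (5 b s c2 t s1 c1)
  have 1: "(\<forall>i. s1 i \<le> V + t) \<and> (\<forall>W'. (V + t + 2) ^ weight c2 \<le> W' \<longrightarrow> exec W' c2 s t s1)"
    using 5(4)[of V] 5(5,6) by simp
  have "exec W' (If b c1 c2) s (1 + cost b + t) s1"
    if W': "(V + (1 + cost b + t) + 2) ^ weight (If b c1 c2) \<le> W'" for W'
  proof (rule exec.intros(5))
    show "fits W' b s" by (rule fits_if_power_le[OF W' _ _ 5(6)]) simp_all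
    show "exec W' c2 s t s1" using 1 power_weight_le[OF W', of "V + t" "weight c2"] by simp
  qed fact
  moreover have "s1 i \<le> V + (1 + cost b + t)" for i using spec[OF conjunct1[OF 1], of i] by linarith
  ultimately show ?case by blast
next
  case (6 b s c)
  have "exec W' (While b c) s (1 + cost b) s"
    if W': "(V + (1 + cost b) + 2) ^ weight (While b c) \<le> W'" for W'
    by (rule exec.intros(6)) (rule fits_if_power_le[OF W' _ _ 6(4)], simp, simp, fact)
  moreover have "s i \<le> V + (1 + cost b)" for i using 6(4)[of i] by linarith
  ultimately show ?case by blast
next
  case (7 b s c t1 s1 t2 s2)
  have 1: "(\<forall>i. s1 i \<le> V + t1) \<and> (\<forall>W'. (V + t1 + 2) ^ weight c \<le> W' \<longrightarrow> exec W' c s t1 s1)"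
    using 7(5)[of V] 7(7,8) by simp
  then have 2: "(\<forall>i. s2 i \<le> V + t1 + t2) \<and>
    (\<forall>W'. (V + t1 + t2 + 2) ^ weight (While b c) \<le> W' \<longrightarrow> exec W' (While b c) s1 t2 s2)"
    using 7(6)[of "V + t1"] 7(7) by simp
  have "exec W' (While b c) s (1 + cost b + t1 + t2) s2"
    if W': "(V + (1 + cost b + t1 + t2) + 2) ^ weight (While b c) \<le> W'" for W'
  proof (rule exec.intros(7))
    show "fits W' b s" by (rule fits_if_power_le[OF W' _ _ 7(8)]) simp_all
    show "exec W' c s t1 s1" using 1 power_weight_le[OF W', of "V + t1" "weight c"] by simp
    show "exec W' (While b c) s1 t2 s2"
      using 2 power_weight_le[OF W', of "V + t1 + t2" "weight (While b c)"] by simp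
  qed fact
  moreover have "s2 i \<le> V + (1 + cost b + t1 + t2)" for i using spec[OF conjunct1[OF 2], of i] by linarith
  ultimately show ?case by blast
qed

text \<open>Executions are composed under unspecified word bounds, by taking maxima. Afterwards
  \<open>exec_small_steps\<close> replaces the unknown bound by a polynomial one.\<close>

definition halts :: "com \<Rightarrow> mem \<Rightarrow> nat \<Rightarrow> mem \<Rightarrow> bool" where
  "halts c s t s' \<longleftrightarrow> (\<exists>W. exec W c s t s')"

lemma ex_fits: "\<exists>W. fits W e s"
proof (induction e)
  case (Const a)
  have "fits (Suc a) (Const a) s" by simp
  then show ?case ..
next
  case (Load e)
  then obtain W where "fits W e s" ..
  then have "fits (max W (Suc (s (val e s)))) (Load e) s" using fits_mono by (simp add: less_max_iff_disj)
  then show ?case ..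
next
  case (Add e f)
  then obtain W1 W2 where "fits W1 e s" "fits W2 f s" by blast
  then have "fits (max (max W1 W2) (Suc (val (Add e f) s))) (Add e f) s"
    using fits_mono by (simp add: less_max_iff_disj)
  then show ?case ..
next
  case (Sub e f)
  then obtain W1 W2 where "fits W1 e s" "fits W2 f s" by blast
  then have "fits (max W1 W2) (Sub e f) s" using fits_mono by simp
  then show ?case ..
next
  case (Mul e f)
  then obtain W1 W2 where "fits W1 e s" "fits W2 f s" by blast
  then have "fits (max (max W1 W2) (Suc (val (Mul e f) s))) (Mul e f) s"
    using fits_mono by (simp add: less_max_iff_disj)
  then show ?case ..
next
  case (Div e f)
  then obtain W1 W2 where "fits W1 e s" "fits W2 f s" by blast
  then have "fits (max W1 W2) (Div e f) s" using fits_mono by simp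
  then show ?case ..
qed

lemma halts_Skip: "halts Skip s 1 s"
  unfolding halts_def using exec.intros(1) by blast

lemma halts_Store: "halts (Store a e) s (1 + cost a + cost e) (s(val a s := val e s))"
proof -
  obtain W1 W2 where "fits W1 a s" "fits W2 e s" using ex_fits by blast
  then have "fits (max W1 W2) a s" "fits (max W1 W2) e s" using fits_mono by simp_all
  then show ?thesis unfolding halts_def using exec.intros(2) by blast
qed

lemma halts_Seq:
  assumes "halts c s t1 s1" "halts d s1 t2 s2"
  shows "halts (Seq c d) s (t1 + t2) s2"
proof -
  obtain W1 W2 where "exec W1 c s t1 s1" "exec W2 d s1 t2 s2" using assms by (auto simp: halts_def)
  then have "exec (max W1 W2) c s t1 s1" "exec (max W1 W2) d s1 t2 s2" using exec_mono by simp_all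
  then show ?thesis unfolding halts_def using exec.intros(3) by blast
qed

lemma halts_If:
  assumes "if val b s \<noteq> 0 then halts c s t s' else halts d s t s'"
  shows "halts (If b c d) s (1 + cost b + t) s'"
proof -
  obtain W1 W2 where "fits W1 b s" "if val b s \<noteq> 0 then exec W2 c s t s' else exec W2 d s t s'"
    using assms ex_fits[of b s] unfolding halts_def by presburger
  then have "fits (max W1 W2) b s" "if val b s \<noteq> 0 then exec (max W1 W2) c s t s' else exec (max W1 W2) d s t s'"
    using fits_mono exec_mono by (simp, metis max.cobounded2)
  then show ?thesis unfolding halts_def using exec.intros(4,5) by metis
qed

lemma halts_While_end: "val b s = 0 \<Longrightarrow> halts (While b c) s (1 + cost b) s"
  unfolding halts_def using exec.intros(6) ex_fits by blast

lemma halts_While_step: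
  assumes "val b s \<noteq> 0" "halts c s t1 s1" "halts (While b c) s1 t2 s2"
  shows "halts (While b c) s (1 + cost b + t1 + t2) s2"
proof -
  obtain W1 W2 W3 where "fits W1 b s" "exec W2 c s t1 s1" "exec W3 (While b c) s1 t2 s2"
    using assms(2,3) ex_fits[of b s] unfolding halts_def by blast
  then have "fits (max W1 (max W2 W3)) b s" "exec (max W1 (max W2 W3)) c s t1 s1"
    "exec (max W1 (max W2 W3)) (While b c) s1 t2 s2"
    using fits_mono exec_mono by (simp, (meson max.cobounded1 max.cobounded2 order_trans)+)
  then show ?thesis unfolding halts_def using exec.intros(7)[OF _ assms(1)] by blast
qed

section \<open>Programs over two-dimensional arrays\<close>

text \<open>Array \<open>k\<close> at index \<open>(i, j)\<close> is stored behind the input, at an address that interleaves the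
  40 arrays and uses Cantor's pairing function for the indices. So distinct array elements never
  overlap, whatever the sizes of the arrays. A scalar variable is an array at index \<open>(0, 0)\<close>.\<close>

type_synonym arrays = "nat \<Rightarrow> nat \<Rightarrow> nat \<Rightarrow> nat"

text \<open>The offset \<open>2 * s 1 + 2\<close> is the length of the input: n, m and two endpoints
  for each of the m edges.\<close>

definition address :: "mem \<Rightarrow> nat \<Rightarrow> nat \<Rightarrow> nat \<Rightarrow> nat" where
  "address s k i j = 2 * s 1 + 2 + k + 40 * prod_encode (i, j)"

definition mem_of :: "mem \<Rightarrow> arrays \<Rightarrow> mem" where
  "mem_of s \<sigma> = (\<lambda>l. if l < 2 * s 1 + 2 then s l
     else \<sigma> ((l - (2 * s 1 + 2)) mod 40) (fst (prod_decode ((l - (2 * s 1 + 2)) div 40)))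
        (snd (prod_decode ((l - (2 * s 1 + 2)) div 40))))"

definition upd :: "arrays \<Rightarrow> nat \<Rightarrow> nat \<Rightarrow> nat \<Rightarrow> nat \<Rightarrow> arrays" where
  "upd \<sigma> k i j v = (\<lambda>k' i' j'. if k' = k \<and> i' = i \<and> j' = j then v else \<sigma> k' i' j')"

lemma mem_of_address: "k < 40 \<Longrightarrow> mem_of s \<sigma> (address s k i j) = \<sigma> k i j"
  by (simp add: mem_of_def address_def)

lemma mem_of_input: "l < 2 * s 1 + 2 \<Longrightarrow> mem_of s \<sigma> l = s l"
  by (simp add: mem_of_def)

lemma mem_of_01 [simp]: "mem_of s \<sigma> 0 = s 0" "mem_of s \<sigma> (Suc 0) = s (Suc 0)"
  by (simp_all add: mem_of_def)

lemma address_inj: "k < 40 \<Longrightarrow> k' < 40 \<Longrightarrow> address s k i j = address s k' i' j' \<longleftrightarrow> k = k' \<and> i = i' \<and> j = j'"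
proof
  assume k: "k < 40" "k' < 40" and "address s k i j = address s k' i' j'"
  then have "k + 40 * prod_encode (i, j) = k' + 40 * prod_encode (i', j')" by (simp add: address_def)
  then have "(k + 40 * prod_encode (i, j)) mod 40 = (k' + 40 * prod_encode (i', j')) mod 40"
    "(k + 40 * prod_encode (i, j)) div 40 = (k' + 40 * prod_encode (i', j')) div 40" by simp_all
  then show "k = k' \<and> i = i' \<and> j = j'" using k by simp
qed simp

lemma address_surj:
  assumes "\<not> l < 2 * s 1 + 2"
  obtains k i j where "k < 40" "l = address s k i j"
proof
  let ?r = "l - (2 * s 1 + 2)"
  show "?r mod 40 < 40" by simp
  show "l = address s (?r mod 40) (fst (prod_decode (?r div 40))) (snd (prod_decode (?r div 40)))"
    using assms by (simp add: address_def)
qed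

lemma mem_of_upd: "k < 40 \<Longrightarrow> (mem_of s \<sigma>)(address s k i j := v) = mem_of s (upd \<sigma> k i j v)"
proof
  fix l assume k: "k < 40"
  show "((mem_of s \<sigma>)(address s k i j := v)) l = mem_of s (upd \<sigma> k i j v) l"
  proof (cases "l < 2 * s 1 + 2")
    case True
    then show ?thesis by (simp add: mem_of_input address_def)
  next
    case False
    then obtain k' i' j' where "k' < 40" "l = address s k' i' j'" using address_surj by metis
    then show ?thesis using k by (auto simp: mem_of_address address_inj upd_def)
  qed
qed

definition cell :: "nat \<Rightarrow> exp \<Rightarrow> exp \<Rightarrow> exp" where
  "cell k e f = Add (Add (Mul (Const 2) (Load (Const 1))) (Const (k + 2)))
     (Mul (Const 40) (Add (Div (Mul (Add e f) (Add (Add e f) (Const 1))) (Const 2)) e))"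

abbreviation elem :: "nat \<Rightarrow> exp \<Rightarrow> exp \<Rightarrow> exp" where
  "elem k e f \<equiv> Load (cell k e f)"

abbreviation var_cell :: "nat \<Rightarrow> exp" where
  "var_cell k \<equiv> cell k (Const 0) (Const 0)"

abbreviation var :: "nat \<Rightarrow> exp" where
  "var k \<equiv> Load (var_cell k)"

lemma val_cell [simp]:
  "val (cell k e f) (mem_of s \<sigma>) = address s k (val e (mem_of s \<sigma>)) (val f (mem_of s \<sigma>))"
  by (simp add: cell_def address_def prod_encode_def triangle_def)

text \<open>Loop bounds will depend on the input alone, which makes the semantics \<open>run\<close>
  a total function and the running time a static expression.\<close>

datatype stmt = Nop | Put nat exp exp exp | Then stmt stmt (infixr \<open>;;\<close> 60)
  | Cond exp stmt stmt | For nat exp stmt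

text \<open>The last update in the equation for loops reflects that the compiled
  \<open>While\<close> leaves the counter at its bound.\<close>

fun run :: "mem \<Rightarrow> stmt \<Rightarrow> arrays \<Rightarrow> arrays" where
  "run s Nop \<sigma> = \<sigma>"
| "run s (Put k e f g) \<sigma> =
     upd \<sigma> k (val e (mem_of s \<sigma>)) (val f (mem_of s \<sigma>)) (val g (mem_of s \<sigma>))"
| "run s (c ;; d) \<sigma> = run s d (run s c \<sigma>)"
| "run s (Cond b c d) \<sigma> = (if val b (mem_of s \<sigma>) \<noteq> 0 then run s c \<sigma> else run s d \<sigma>)"
| "run s (For k b c) \<sigma> =
     upd (fold (\<lambda>i \<sigma>. run s c (upd \<sigma> k 0 0 i)) [0..<val b s] \<sigma>) k 0 0 (val b s)"

fun writes :: "stmt \<Rightarrow> nat set" where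
  "writes Nop = {}"
| "writes (Put k e f g) = {k}"
| "writes (c ;; d) = writes c \<union> writes d"
| "writes (Cond b c d) = writes c \<union> writes d"
| "writes (For k b c) = insert k (writes c)"

lemma run_frame: "k \<notin> writes c \<Longrightarrow> run s c \<sigma> k = \<sigma> k"
proof (induction c arbitrary: \<sigma>)
  case (For l b c)
  have "fold (\<lambda>i \<sigma>. run s c (upd \<sigma> l 0 0 i)) xs \<sigma> k = \<sigma> k" for xs
    using For by (induction xs arbitrary: \<sigma>) (auto simp: upd_def)
  then show ?case using For by (auto simp: upd_def)
qed (auto simp: upd_def)

text \<open>Loop bounds depend only on the two input cells that the program never changes.\<close>

fun input_exp :: "exp \<Rightarrow> bool" where
  "input_exp (Const a) \<longleftrightarrow> True"
| "input_exp (Load (Const a)) \<longleftrightarrow> a \<le> 1"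
| "input_exp (Add e f) \<longleftrightarrow> input_exp e \<and> input_exp f"
| "input_exp (Mul e f) \<longleftrightarrow> input_exp e \<and> input_exp f"
| "input_exp _ \<longleftrightarrow> False"

lemma val_input_exp: "input_exp e \<Longrightarrow> val e (mem_of s \<sigma>) = val e s"
  by (induction e rule: input_exp.induct) (auto simp: le_Suc_eq)

text \<open>Arrays below 40 do not overlap in memory, stored values obey the growth condition behind
  the word bounds, and no loop body disturbs its counter.\<close>

fun proper :: "stmt \<Rightarrow> bool" where
  "proper Nop \<longleftrightarrow> True"
| "proper (Put k e f g) \<longleftrightarrow> k < 40 \<and> small_step_exp g"
| "proper (c ;; d) \<longleftrightarrow> proper c \<and> proper d"
| "proper (Cond b c d) \<longleftrightarrow> proper c \<and> proper d"
| "proper (For k b c) \<longleftrightarrow> k < 40 \<and> k \<notin> writes c \<and> input_exp b \<and> proper c"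

fun code :: "stmt \<Rightarrow> com" where
  "code Nop = Skip"
| "code (Put k e f g) = Store (cell k e f) g"
| "code (c ;; d) = Seq (code c) (code d)"
| "code (Cond b c d) = If b (code c) (code d)"
| "code (For k b c) = Seq (Store (var_cell k) (Const 0))
     (While (Sub b (var k)) (Seq (code c) (Store (var_cell k) (Add (var k) (Const 1)))))"

text \<open>Independent of the array contents: both branches of a conditional are added. In a loop,
  initialization takes 24 steps, each test \<open>cost b + 25\<close> and each increment 48; the
  constant 100 covers these.\<close>

fun time :: "mem \<Rightarrow> stmt \<Rightarrow> nat" where
  "time s Nop = 1"
| "time s (Put k e f g) = 1 + cost (cell k e f) + cost g"
| "time s (c ;; d) = time s c + time s d"
| "time s (Cond b c d) = 1 + cost b + time s c + time s d"
| "time s (For k b c) = (cost b + 100) * (val b s + 1) + val b s * time s c"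

lemma cost_var_cell: "cost (var_cell k) = 22"
  by (simp add: cell_def)

lemma halts_code:
  assumes "proper c"
  shows "\<exists>t\<le>time s c. halts (code c) (mem_of s \<sigma>) t (mem_of s (run s c \<sigma>))"
  using assms
proof (induction c arbitrary: \<sigma>)
  case Nop
  then show ?case using halts_Skip by auto
next
  case (Put k e f g)
  then show ?case
    using halts_Store[of "cell k e f" g "mem_of s \<sigma>"] by (auto simp: mem_of_upd)
next
  case (Then c d)
  then obtain t1 t2 where "t1 \<le> time s c" "halts (code c) (mem_of s \<sigma>) t1 (mem_of s (run s c \<sigma>))"
    "t2 \<le> time s d" "halts (code d) (mem_of s (run s c \<sigma>)) t2 (mem_of s (run s d (run s c \<sigma>)))"
    by fastforce
  then show ?case using halts_Seq by (auto intro!: exI[of _ "t1 + t2"])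
next
  case (Cond b c d)
  obtain t1 t2 where t: "t1 \<le> time s c" "halts (code c) (mem_of s \<sigma>) t1 (mem_of s (run s c \<sigma>))"
    "t2 \<le> time s d" "halts (code d) (mem_of s \<sigma>) t2 (mem_of s (run s d \<sigma>))"
    using Cond by fastforce
  let ?t = "if val b (mem_of s \<sigma>) \<noteq> 0 then t1 else t2"
  have "halts (code (Cond b c d)) (mem_of s \<sigma>) (1 + cost b + ?t) (mem_of s (run s (Cond b c d) \<sigma>))"
    unfolding code.simps by (rule halts_If) (use t in auto)
  moreover have "1 + cost b + ?t \<le> time s (Cond b c d)" using t by simp
  ultimately show ?case by blast
next
  case (For k b c)
  let ?f = "\<lambda>i \<sigma>. run s c (upd \<sigma> k 0 0 i)"
  let ?\<tau> = "\<lambda>i. fold ?f [0..<i] \<sigma>"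
  let ?m = "\<lambda>i. mem_of s (upd (?\<tau> i) k 0 0 i)"
  let ?body = "Seq (code c) (Store (var_cell k) (Add (var k) (Const 1)))"
  let ?b = "Sub b (var k)"
  have k: "k < 40" "k \<notin> writes c" "input_exp b" using For.prems by auto
  have b: "val ?b (?m i) = val b s - i" for i
    using k by (simp add: val_input_exp mem_of_address upd_def)
  have step: "\<exists>t\<le>time s c + 48. halts ?body (?m i) t (?m (Suc i))" for i
  proof -
    define \<rho> where "\<rho> = upd (?\<tau> i) k 0 0 i"
    have \<tau>: "?\<tau> (Suc i) = run s c \<rho>" by (simp add: \<rho>_def)
    obtain t where t: "t \<le> time s c" "halts (code c) (mem_of s \<rho>) t (mem_of s (run s c \<rho>))"
      using For by fastforce
    have "run s c \<rho> k 0 0 = i" using run_frame[OF k(2)] by (simp add: upd_def \<rho>_def)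
    then have "halts (Store (var_cell k) (Add (var k) (Const 1))) (mem_of s (run s c \<rho>)) 48
        (mem_of s (upd (run s c \<rho>) k 0 0 (Suc i)))"
      using halts_Store[of "var_cell k" "Add (var k) (Const 1)" "mem_of s (run s c \<rho>)"] k(1)
      by (simp add: mem_of_upd mem_of_address cost_var_cell)
    from halts_Seq[OF t(2) this]
    have "halts ?body (?m i) (t + 48) (?m (Suc i))" unfolding \<tau> \<rho>_def .
    then show ?thesis using t(1) by (intro exI[of _ "t + 48"]) simp
  qed
  have loop: "\<exists>t\<le>(cost b + 73 + time s c) * j + cost b + 25. halts (While ?b ?body) (?m i) t (?m (val b s))"
    if "i + j = val b s" for i j
    using that
  proof (induction j arbitrary: i)
    case 0
    then have "halts (While ?b ?body) (?m i) (1 + cost ?b) (?m i)"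
      by (intro halts_While_end) (use b[of i] 0 in linarith)
    then show ?case using 0 cost_var_cell[of k] by (intro exI[of _ "1 + cost ?b"]) auto
  next
    case (Suc j)
    obtain t1 where t1: "t1 \<le> time s c + 48" "halts ?body (?m i) t1 (?m (Suc i))" using step by blast
    obtain t2 where t2: "t2 \<le> (cost b + 73 + time s c) * j + cost b + 25"
      "halts (While ?b ?body) (?m (Suc i)) t2 (?m (val b s))"
      using Suc.IH[of "Suc i"] Suc.prems by auto
    have "val ?b (?m i) \<noteq> 0" unfolding b using Suc.prems by simp
    from halts_While_step[OF this t1(2) t2(2)]
    have "halts (While ?b ?body) (?m i) (1 + cost ?b + t1 + t2) (?m (val b s))" .
    moreover have "1 + cost ?b + t1 + t2 \<le> (cost b + 73 + time s c) * Suc j + cost b + 25"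
      using t1(1) t2(1) by (simp add: cost_var_cell)
    ultimately show ?case by blast
  qed
  obtain t where t: "t \<le> (cost b + 73 + time s c) * val b s + cost b + 25"
    "halts (While ?b ?body) (?m 0) t (?m (val b s))"
    using loop[of 0 "val b s"] by auto
  have "halts (Store (var_cell k) (Const 0)) (mem_of s \<sigma>) 24 (?m 0)"
    using halts_Store[of "var_cell k" "Const 0" "mem_of s \<sigma>"] k(1) by (simp add: mem_of_upd cost_var_cell)
  from halts_Seq[OF this t(2)]
  have "halts (code (For k b c)) (mem_of s \<sigma>) (24 + t) (mem_of s (run s (For k b c) \<sigma>))" by simp
  moreover have "24 + t \<le> time s (For k b c)" using t(1) by (simp add: algebra_simps)
  ultimately show ?case by blast
qed

lemma small_steps_code: "proper c \<Longrightarrow> small_steps (code c)"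
  by (induction c) auto

lemma mem_of_zero:
  assumes "\<And>l. 2 * s 1 + 2 \<le> l \<Longrightarrow> s l = 0"
  shows "mem_of s (\<lambda>_ _ _. 0) = s"
  using assms by (auto simp: mem_of_def fun_eq_iff)

lemma val_cell_general:
  "s' (Suc 0) = s (Suc 0) \<Longrightarrow> val (cell k e f) s' = address s k (val e s') (val f s')"
  by (simp add: cell_def address_def prod_encode_def triangle_def)

lemma cost_cell: "cost (cell k e f) = 17 + 3 * cost e + 2 * cost f"
  by (simp add: cell_def)

text \<open>Cantor pairing is increasing along \<open>(i, 0)\<close>. So copying to
  \<open>address s 0 p 0\<close> and beyond overwrites neither the first p output elements nor, for
  positive p, any scalar variable.\<close>

lemma address_less:
  assumes "k < 40" "i < p"
  shows "address s k i 0 < address s 0 p 0"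
proof -
  have "i * Suc i \<le> p * Suc p" using assms(2) by (intro mult_le_mono) auto
  then have "triangle i \<le> triangle p" unfolding triangle_def by (rule div_le_mono)
  then show ?thesis using assms by (simp add: address_def prod_encode_def)
qed

text \<open>The output array is spread out in memory by the interleaving. It is finally copied to consecutive cells
  behind all other data.\<close>

definition copy_out :: "nat \<Rightarrow> nat \<Rightarrow> nat \<Rightarrow> com" where
  "copy_out out ptr j = Seq (Store (var_cell j) (Const 0))
     (While (Sub (var ptr) (var j))
       (Seq (Store (Add (cell 0 (var ptr) (Const 0)) (var j)) (elem out (var j) (Const 0)))
         (Store (var_cell j) (Add (var j) (Const 1)))))"

lemma small_steps_copy_out: "small_steps (copy_out out ptr j)"
  by (simp add: copy_out_def)

text \<open>A round takes 48 steps for the test, 202 for copying an element and 48 for the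
  increment, in total 298. Initialization (24) and the last test (48) give 72.\<close>

lemma halts_copy_out:
  assumes k: "out < 40" "ptr < 40" "j < 40" "j \<noteq> ptr" "j \<noteq> out" and p: "\<sigma> ptr 0 0 = p" "1 \<le> p"
    and P: "P = address s 0 p 0"
  shows "halts (copy_out out ptr j) (mem_of s \<sigma>) (72 + 298 * p)
    (\<lambda>l. if P \<le> l \<and> l < P + p then \<sigma> out (l - P) 0 else mem_of s (upd \<sigma> j 0 0 p) l)"
proof -
  define m where "m i = (\<lambda>l. if P \<le> l \<and> l < P + i then \<sigma> out (l - P) 0 else mem_of s (upd \<sigma> j 0 0 i) l)" for i
  let ?body = "Seq (Store (Add (cell 0 (var ptr) (Const 0)) (var j)) (elem out (var j) (Const 0)))
         (Store (var_cell j) (Add (var j) (Const 1)))"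
  let ?b = "Sub (var ptr) (var j)"
  have low: "m i l = mem_of s (upd \<sigma> j 0 0 i) l" if "l < P" for i l
    using that by (simp add: m_def)
  have P1: "1 < P" by (simp add: P address_def)
  have m1: "m i (Suc 0) = s (Suc 0)" for i using low[of "Suc 0" i] P1 by simp
  have elem: "m i (address s k i' 0) = upd \<sigma> j 0 0 i k i' 0" if "k < 40" "i' < p" for i k i'
    using low[of "address s k i' 0" i] address_less[OF that] that by (simp add: P mem_of_address)
  have vars: "val (var ptr) (m i) = p" "val (var j) (m i) = i" for i
    using elem[of ptr 0 i] elem[of j 0 i] k p m1[of i] by (simp_all add: val_cell_general[of "m i" s] upd_def)
  have b: "val ?b (m i) = p - i" for i using vars by simp
  have body: "halts ?body (m i) 250 (m (Suc i))" if "i < p" for i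
  proof -
    let ?m' = "(m i)(P + i := \<sigma> out i 0)"
    have a: "val (Add (cell 0 (var ptr) (Const 0)) (var j)) (m i) = P + i"
      using vars[of i] val_cell_general[of "m i" s, OF m1] unfolding P by simp
    have o: "val (elem out (var j) (Const 0)) (m i) = \<sigma> out i 0"
      using vars[of i] elem[OF k(1) that, of i] k by (simp add: val_cell_general[of "m i" s, OF m1] upd_def)
    have "halts (Store (Add (cell 0 (var ptr) (Const 0)) (var j)) (elem out (var j) (Const 0)))
       (m i) 202 ?m'"
      using halts_Store[of "Add (cell 0 (var ptr) (Const 0)) (var j)" "elem out (var j) (Const 0)" "m i"]
      unfolding a o by (simp add: cost_cell)
    moreover have "halts (Store (var_cell j) (Add (var j) (Const 1))) ?m' 48 (m (Suc i))"
    proof -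
      have m1': "?m' (Suc 0) = s (Suc 0)" using m1[of i] P1 by simp
      have j: "val (var_cell j) ?m' = address s j 0 0"
        using val_cell_general[of ?m' s, OF m1'] by simp
      have jP: "address s j 0 0 < P" using address_less[OF k(3), of 0 p s] p by (simp add: P)
      have v: "val (Add (var j) (Const 1)) ?m' = Suc i"
        using elem[OF k(3), of 0 i] p jP j by (simp add: upd_def)
      have "?m'(address s j 0 0 := Suc i) = m (Suc i)"
      proof
        fix l
        show "(?m'(address s j 0 0 := Suc i)) l = m (Suc i) l"
        proof (cases "l < P")
          case True
          have "mem_of s (upd \<sigma> j 0 0 (Suc i)) = (mem_of s (upd \<sigma> j 0 0 i))(address s j 0 0 := Suc i)"
            unfolding mem_of_upd[OF k(3)] by (rule arg_cong[of _ _ "mem_of s"]) (auto simp: upd_def fun_eq_iff)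
          then show ?thesis using True low by simp
        next
          case False
          have "upd \<sigma> j 0 0 i k i' j' = upd \<sigma> j 0 0 (Suc i) k i' j'"
            if "address s k i' j' \<noteq> address s j 0 0" for k i' j'
            using that unfolding upd_def by metis
          moreover have "\<not> l < 2 * s 1 + 2" using False by (simp add: P address_def)
          then obtain k' i' j' where "k' < 40" "l = address s k' i' j'" using address_surj by metis
          ultimately have "mem_of s (upd \<sigma> j 0 0 i) l = mem_of s (upd \<sigma> j 0 0 (Suc i)) l"
            using False jP by (auto simp: mem_of_address)
          then show ?thesis using False jP by (auto simp: m_def)
        qed
      qed
      then show ?thesis
        using halts_Store[of "var_cell j" "Add (var j) (Const 1)" ?m'] unfolding j v by (simp add: cost_cell)
    qed
    ultimately show ?thesis using halts_Seq by fastforce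
  qed
  have loop: "halts (While ?b ?body) (m i) (298 * (p - i) + 48) (m p)" if "i \<le> p" for i
    using that
  proof (induction "p - i" arbitrary: i)
    case 0
    then have "i = p" by simp
    then show ?case using halts_While_end[of ?b "m i" ?body] b[of i] by (simp add: cost_cell)
  next
    case (Suc q)
    have "halts (While ?b ?body) (m (Suc i)) (298 * (p - Suc i) + 48) (m p)"
      using Suc.hyps(2) by (intro Suc.hyps(1)) auto
    moreover have "val ?b (m i) \<noteq> 0" using Suc.hyps(2) b by simp
    ultimately have "halts (While ?b ?body) (m i) (1 + cost ?b + 250 + (298 * (p - Suc i) + 48)) (m p)"
      using body[of i] Suc.hyps(2) by (intro halts_While_step) auto
    moreover have "1 + cost ?b + 250 + (298 * (p - Suc i) + 48) = 298 * (p - i) + 48"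
      using Suc.hyps(2) by (simp add: cost_cell)
    ultimately show ?case by argo
  qed
  have "(P \<le> l \<and> l < P + 0) = False" for l by simp
  then have "halts (Store (var_cell j) (Const 0)) (mem_of s \<sigma>) 24 (m 0)"
    using halts_Store[of "var_cell j" "Const 0" "mem_of s \<sigma>"] k(3)
    unfolding m_def by (simp only: if_False) (simp add: mem_of_upd cost_cell)
  from halts_Seq[OF this loop[of 0]] show ?thesis
    unfolding copy_out_def m_def by simp
qed

text \<open>Cell 0 contains n, a loop bound throughout, so the output address is stored there
  last.\<close>

definition program :: "stmt \<Rightarrow> nat \<Rightarrow> nat \<Rightarrow> nat \<Rightarrow> com" where
  "program c out ptr j =
     Seq (Seq (code c) (copy_out out ptr j)) (Store (Const 0) (cell 0 (var ptr) (Const 0)))"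

theorem exec_program:
  assumes c: "proper c" and k: "out < 40" "ptr < 40" "j < 40" "j \<noteq> ptr" "j \<noteq> out"
    and s: "\<And>l. 2 * s 1 + 2 \<le> l \<Longrightarrow> s l = 0" "\<And>l. s l \<le> V"
    and \<sigma>: "\<sigma> = run s c (\<lambda>_ _ _. 0)" "1 \<le> \<sigma> ptr 0 0"
    and W: "(400 * (V + time s c + 2)) ^ weight (program c out ptr j) \<le> W"
  shows "\<exists>t s'. exec W (program c out ptr j) s t s' \<and> t \<le> 400 * (V + time s c + 2) \<and>
    holds_output s' (map (\<lambda>i. \<sigma> out i 0) [0..<\<sigma> ptr 0 0])"
proof -
  define p where "p = \<sigma> ptr 0 0"
  define P where "P = address s 0 p 0"
  let ?B = "400 * (V + time s c + 2)"
  obtain t1 where t1: "t1 \<le> time s c" "halts (code c) s t1 (mem_of s \<sigma>)"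
    using halts_code[OF c, of s "\<lambda>_ _ _. 0"] \<sigma>(1) mem_of_zero[OF s(1)] by auto
  then have "mem_of s \<sigma> (address s ptr 0 0) \<le> V + t1"
    using exec_small_steps[OF _ small_steps_code[OF c] s(2)] by (auto simp: halts_def)
  \<comment> \<open>The output length p is itself the content of a cell, so the growth bound limits
    it by the running time and the output is not counted separately.\<close>
  then have p: "p \<le> V + t1" "1 \<le> p" using \<sigma>(2) k(2) by (simp_all add: mem_of_address p_def)
  define s2 where "s2 = (\<lambda>l. if P \<le> l \<and> l < P + p then \<sigma> out (l - P) 0 else mem_of s (upd \<sigma> j 0 0 p) l)"
  have "halts (copy_out out ptr j) (mem_of s \<sigma>) (72 + 298 * p) s2"
    using halts_copy_out[of out ptr j \<sigma> p P s] k p by (simp add: s2_def P_def p_def)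
  define t2 where "t2 = t1 + (72 + 298 * p)"
  have "halts (Seq (code c) (copy_out out ptr j)) s t2 s2"
    unfolding t2_def by (rule halts_Seq) fact+
  then obtain W0 where "exec W0 (Seq (code c) (copy_out out ptr j)) s t2 s2" by (auto simp: halts_def)
  from exec_small_steps[OF this _ s(2)]
  have s2: "s2 l \<le> V + t2"
    and ex: "(V + t2 + 2) ^ weight (Seq (code c) (copy_out out ptr j)) \<le> W \<Longrightarrow>
      exec W (Seq (code c) (copy_out out ptr j)) s t2 s2" for l
    using small_steps_code[OF c] small_steps_copy_out by simp_all
  have B: "V + t2 + 2 \<le> ?B" "t2 + 90 \<le> ?B" using t1(1) p by (simp_all add: t2_def)
  have pow: "(V + t2 + 2) ^ w \<le> W" if "w \<le> weight (program c out ptr j)" for w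
  proof -
    have "(V + t2 + 2) ^ w \<le> ?B ^ w" using B(1) by (rule power_mono) simp
    also have "\<dots> \<le> ?B ^ weight (program c out ptr j)" using that by (intro power_increasing) auto
    finally show ?thesis using W by simp
  qed
  have e: "exec W (Seq (code c) (copy_out out ptr j)) s t2 s2"
    by (rule ex) (rule pow, simp add: program_def)
  have fit: "fits W (Const 0) s2" "fits W (cell 0 (var ptr) (Const 0)) s2"
    by (rule fits_if_bound[OF s2], rule pow, simp add: program_def)+
  have P: "1 < P" by (simp add: P_def address_def)
  then have s21: "s2 (Suc 0) = s (Suc 0)" by (simp add: s2_def)
  have ptr_low: "address s ptr 0 0 < P" using address_less[OF k(2)] p(2) by (simp add: P_def)
  then have "s2 (address s ptr 0 0) = p"
    using k by (simp add: s2_def mem_of_address upd_def p_def)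
  then have v: "val (cell 0 (var ptr) (Const 0)) s2 = P"
    using val_cell_general[of s2 s, OF s21] by (simp add: P_def)
  have "exec W (Store (Const 0) (cell 0 (var ptr) (Const 0))) s2 90 (s2(0 := P))"
    using exec.intros(2)[OF fit] v by (simp add: cost_cell)
  then have "exec W (program c out ptr j) s (t2 + 90) (s2(0 := P))"
    unfolding program_def by (rule exec.intros(3)[OF e])
  moreover have "holds_output (s2(0 := P)) (map (\<lambda>i. \<sigma> out i 0) [0..<p])"
    using P unfolding holds_output_def by (intro nth_equalityI) (simp_all add: s2_def)
  ultimately show ?thesis using B(2) p_def by blast
qed

section \<open>Loops that fill arrays\<close>

declare run.simps(5) [simp del] mem_of_address [simp]

lemma upd_other [simp]: "l \<noteq> k \<Longrightarrow> upd \<sigma> k i j v l = \<sigma> l"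
  by (simp add: upd_def fun_eq_iff)

lemma upd_same [simp]: "upd \<sigma> k i j v k = (\<lambda>x y. if x = i \<and> y = j then v else \<sigma> k x y)"
  by (simp add: upd_def fun_eq_iff)

lemma For_rule:
  assumes "I 0 \<sigma>" and "\<And>i \<tau>. i < val b s \<Longrightarrow> I i \<tau> \<Longrightarrow> I (Suc i) (run s c (upd \<tau> k 0 0 i))"
  shows "\<exists>\<tau>. I (val b s) \<tau> \<and> run s (For k b c) \<sigma> = upd \<tau> k 0 0 (val b s)"
proof -
  have "I i (fold (\<lambda>i \<sigma>. run s c (upd \<sigma> k 0 0 i)) [0..<i] \<sigma>)" if "i \<le> val b s" for i
    using that by (induction i) (use assms in auto)
  then show ?thesis by (auto simp: run.simps(5))
qed

definition same_but :: "nat set \<Rightarrow> arrays \<Rightarrow> arrays \<Rightarrow> bool" where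
  "same_but A \<sigma> \<tau> \<longleftrightarrow> (\<forall>l. l \<notin> A \<longrightarrow> \<tau> l = \<sigma> l)"

lemma same_but_run: "same_but (insert k (writes c)) \<sigma> \<tau> \<Longrightarrow>
  same_but (insert k (writes c)) \<sigma> (run s c (upd \<tau> k 0 0 i))"
  by (auto simp: same_but_def run_frame)

lemma For_frame_rule:
  assumes "I 0 \<sigma>"
    and "\<And>i \<tau>. i < val b s \<Longrightarrow> same_but (insert k (writes c)) \<sigma> \<tau> \<Longrightarrow> I i \<tau> \<Longrightarrow>
      I (Suc i) (run s c (upd \<tau> k 0 0 i))"
  shows "\<exists>\<tau>. I (val b s) \<tau> \<and> run s (For k b c) \<sigma> = upd \<tau> k 0 0 (val b s)"
  using For_rule[of "\<lambda>i \<tau>. same_but (insert k (writes c)) \<sigma> \<tau> \<and> I i \<tau>" \<sigma> b s c k]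
    assms same_but_run by (auto simp: same_but_def)

text \<open>The written value \<open>g x y\<close> does not depend on the iteration, so neither
  order nor repetition of the writes matters, and the loop writes the union of the positions
  P.\<close>

lemma For_array:
  assumes body: "\<And>i \<tau> x y. i < val b s \<Longrightarrow> same_but (insert k (writes c)) \<sigma> \<tau> \<Longrightarrow>
      run s c (upd \<tau> k 0 0 i) K x y = (if P i x y then g x y else \<tau> K x y)"
    and "K \<noteq> k"
  shows "run s (For k b c) \<sigma> K x y = (if \<exists>i<val b s. P i x y then g x y else \<sigma> K x y)"
proof -
  have "\<exists>\<tau>. (\<forall>x y. \<tau> K x y = (if \<exists>i<val b s. P i x y then g x y else \<sigma> K x y)) \<and>
      run s (For k b c) \<sigma> = upd \<tau> k 0 0 (val b s)"
    by (rule For_frame_rule) (auto simp: body less_Suc_eq)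
  then show ?thesis using assms(2) by auto
qed

section \<open>Writing lists to the output\<close>

abbreviation (input) OUT :: nat where "OUT \<equiv> 0"
abbreviation (input) PTR :: nat where "PTR \<equiv> 1"

definition outs :: "arrays \<Rightarrow> nat list" where
  "outs \<sigma> = map (\<lambda>i. \<sigma> OUT i 0) [0..<\<sigma> PTR 0 0]"

definition push :: "exp \<Rightarrow> stmt" where
  "push e = Put OUT (var PTR) (Const 0) e ;; Put PTR (Const 0) (Const 0) (Add (var PTR) (Const 1))"

text \<open>An encoded list starts with its length. This cell is located by the variable \<open>h\<close>, and it is
  incremented before each element is written.\<close>

definition open_list :: "nat \<Rightarrow> stmt" where
  "open_list h = Put h (Const 0) (Const 0) (var PTR) ;; push (Const 0)"

definition count :: "nat \<Rightarrow> stmt" where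
  "count h = Put OUT (var h) (Const 0) (Add (elem OUT (var h) (Const 0)) (Const 1))"

definition emits :: "mem \<Rightarrow> stmt \<Rightarrow> arrays \<Rightarrow> nat list \<Rightarrow> bool" where
  "emits s c \<sigma> xs \<longleftrightarrow> outs (run s c \<sigma>) = outs \<sigma> @ xs"

text \<open>Here x is the length cell of the open list, located by h. Its code so far is zs, and
  everything outside the list lies in pre. Quantifying over all three makes the statement composable
  for nested lists.\<close>

definition appends :: "mem \<Rightarrow> nat \<Rightarrow> ('b \<Rightarrow> nat list) \<Rightarrow> stmt \<Rightarrow> arrays \<Rightarrow> 'b list \<Rightarrow> bool" where
  "appends s h f c \<sigma> ys \<longleftrightarrow> (\<forall>pre x zs. outs \<sigma> = pre @ x # zs \<and> \<sigma> h 0 0 = length pre \<longrightarrow>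
     outs (run s c \<sigma>) = pre @ (x + length ys) # zs @ concat (map f ys))"

lemma writes_push [simp]: "writes (push e) = {OUT, PTR}"
  by (auto simp: push_def)

lemma writes_open_list [simp]: "writes (open_list h) = {h, OUT, PTR}"
  by (auto simp: open_list_def)

lemma writes_count [simp]: "writes (count h) = {OUT}"
  by (simp add: count_def)

lemma proper_push [simp]: "proper (push e) \<longleftrightarrow> small_step_exp e"
  by (auto simp: push_def)

lemma proper_open_list [simp]: "proper (open_list h) \<longleftrightarrow> h < 40"
  by (auto simp: open_list_def)

lemma proper_count [simp]: "proper (count h)"
  by (simp add: count_def)

lemma outs_upd [simp]: "k \<noteq> OUT \<Longrightarrow> k \<noteq> PTR \<Longrightarrow> outs (upd \<sigma> k i j v) = outs \<sigma>"
  by (simp add: outs_def)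

lemma outs_push: "outs (run s (push e) \<sigma>) = outs \<sigma> @ [val e (mem_of s \<sigma>)]"
  by (simp add: outs_def push_def)

lemma length_outs: "length (outs \<sigma>) = \<sigma> PTR 0 0"
  by (simp add: outs_def)

lemma outs_count:
  assumes "outs \<sigma> = pre @ x # zs" "\<sigma> h 0 0 = length pre" "h < 40" "h \<noteq> OUT"
  shows "outs (run s (count h) \<sigma>) = pre @ Suc x # zs"
proof -
  have len: "\<sigma> PTR 0 0 = length pre + Suc (length zs)" using length_outs[of \<sigma>] assms(1) by simp
  have nth: "\<sigma> OUT i 0 = (pre @ x # zs) ! i" if "i < \<sigma> PTR 0 0" for i
    using assms(1) that unfolding outs_def by (metis (no_types, lifting) add_0 diff_zero length_upt nth_map nth_upt)
  show ?thesis
  proof (rule nth_equalityI)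
    show "length (outs (run s (count h) \<sigma>)) = length (pre @ Suc x # zs)"
      using len by (simp add: outs_def count_def)
    fix i assume "i < length (outs (run s (count h) \<sigma>))"
    then have i: "i < \<sigma> PTR 0 0" by (simp add: outs_def count_def)
    have "outs (run s (count h) \<sigma>) ! i = (if i = length pre then Suc (\<sigma> OUT i 0) else \<sigma> OUT i 0)"
      using i assms(2,3) by (simp add: outs_def count_def)
    also have "\<dots> = (pre @ Suc x # zs) ! i"
      using nth[OF i] by (auto simp: nth_append nth_Cons' )
    finally show "outs (run s (count h) \<sigma>) ! i = (pre @ Suc x # zs) ! i" .
  qed
qed

lemma emits_push: "emits s (push e) \<sigma> [val e (mem_of s \<sigma>)]"
  by (simp add: emits_def outs_push)

lemma emits_Then:
  "emits s c \<sigma> xs \<Longrightarrow> emits s d (run s c \<sigma>) ys \<Longrightarrow> emits s (c ;; d) \<sigma> (xs @ ys)"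
  by (simp add: emits_def)

lemma emits_Cond:
  assumes "val b (mem_of s \<sigma>) \<noteq> 0 \<longleftrightarrow> B" "B \<Longrightarrow> emits s c \<sigma> xs" "\<not> B \<Longrightarrow> emits s d \<sigma> xs"
  shows "emits s (Cond b c d) \<sigma> xs"
  using assms by (cases B) (auto simp: emits_def)

lemma emits_open_list:
  assumes "appends s h f c (run s (open_list h) \<sigma>) ys" "h < 40" "h \<notin> {OUT, PTR}"
  shows "emits s (open_list h ;; c) \<sigma> (enc f ys)"
proof -
  have "outs (run s (open_list h) \<sigma>) = outs \<sigma> @ [0]"
    using assms(2,3) by (simp add: open_list_def outs_push)
  moreover have "run s (open_list h) \<sigma> h 0 0 = length (outs \<sigma>)"
    using assms(2,3) by (simp add: open_list_def run_frame length_outs)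
  ultimately have "outs (run s c (run s (open_list h) \<sigma>)) = outs \<sigma> @ (0 + length ys) # [] @ concat (map f ys)"
    using assms(1) unfolding appends_def by blast
  then show ?thesis by (simp add: emits_def enc_def)
qed

lemma appends_Nop: "appends s h f Nop \<sigma> []"
  by (simp add: appends_def)

lemma appends_Then:
  assumes "appends s h f c \<sigma> xs" "appends s h f d (run s c \<sigma>) ys" "h \<notin> writes c"
  shows "appends s h f (c ;; d) \<sigma> (xs @ ys)"
  unfolding appends_def
proof safe
  fix pre x zs assume a: "outs \<sigma> = pre @ x # zs" "\<sigma> h 0 0 = length pre"
  have "outs (run s c \<sigma>) = pre @ (x + length xs) # zs @ concat (map f xs)"
    using assms(1) a unfolding appends_def by blast
  moreover have "run s c \<sigma> h 0 0 = length pre" using run_frame[OF assms(3)] a by simp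
  ultimately have "outs (run s d (run s c \<sigma>)) =
      pre @ (x + length xs + length ys) # (zs @ concat (map f xs)) @ concat (map f ys)"
    using assms(2) unfolding appends_def by blast
  then show "outs (run s (c ;; d) \<sigma>) = pre @ (x + length (xs @ ys)) # zs @ concat (map f (xs @ ys))"
    by simp
qed

lemma appends_Cond:
  assumes "val b (mem_of s \<sigma>) \<noteq> 0 \<longleftrightarrow> B" "B \<Longrightarrow> appends s h f c \<sigma> ys" "\<not> B \<Longrightarrow> appends s h f d \<sigma> ys'"
  shows "appends s h f (Cond b c d) \<sigma> (if B then ys else ys')"
  using assms by (cases B) (auto simp: appends_def)

lemma appends_item:
  assumes "emits s c (run s (count h) \<sigma>) (f y)" "h < 40" "h \<noteq> OUT"
  shows "appends s h f (count h ;; c) \<sigma> [y]"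
  unfolding appends_def
proof safe
  fix pre x zs assume a: "outs \<sigma> = pre @ x # zs" "\<sigma> h 0 0 = length pre"
  then have "outs (run s (count h) \<sigma>) = pre @ Suc x # zs" using outs_count assms by blast
  then show "outs (run s (count h ;; c) \<sigma>) = pre @ (x + length [y]) # zs @ concat (map f [y])"
    using assms(1) by (simp add: emits_def)
qed

lemma appends_For:
  assumes body: "\<And>i \<tau>. i < val b s \<Longrightarrow> same_but (insert k (writes c)) \<sigma> \<tau> \<Longrightarrow> appends s h f c (upd \<tau> k 0 0 i) (ys i)"
    and h: "h \<notin> insert k (writes c)" and k: "k \<notin> {OUT, PTR}"
  shows "appends s h f (For k b c) \<sigma> (concat (map ys [0..<val b s]))"
  unfolding appends_def
proof safe
  fix pre x zs assume a: "outs \<sigma> = pre @ x # zs" "\<sigma> h 0 0 = length pre"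
  let ?ys = "\<lambda>i. concat (map ys [0..<i])"
  have "\<exists>\<tau>. outs \<tau> = pre @ (x + length (?ys (val b s))) # zs @ concat (map f (?ys (val b s))) \<and>
      run s (For k b c) \<sigma> = upd \<tau> k 0 0 (val b s)"
  proof (rule For_frame_rule)
    fix i \<tau>
    assume i: "i < val b s" and \<tau>: "same_but (insert k (writes c)) \<sigma> \<tau>"
      "outs \<tau> = pre @ (x + length (?ys i)) # zs @ concat (map f (?ys i))"
    have "outs (upd \<tau> k 0 0 i) = pre @ (x + length (?ys i)) # zs @ concat (map f (?ys i))"
      using \<tau>(2) k by simp
    moreover have "upd \<tau> k 0 0 i h 0 0 = length pre" using \<tau>(1) h a(2) by (auto simp: same_but_def)
    ultimately have "outs (run s c (upd \<tau> k 0 0 i)) = pre @ (x + length (?ys i) + length (ys i)) #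
       (zs @ concat (map f (?ys i))) @ concat (map f (ys i))"
      using body[OF i \<tau>(1)] unfolding appends_def by blast
    then show "outs (run s c (upd \<tau> k 0 0 i)) =
        pre @ (x + length (?ys (Suc i))) # zs @ concat (map f (?ys (Suc i)))"
      by simp
  qed (use a in simp)
  then show "outs (run s (For k b c) \<sigma>) =
      pre @ (x + length (?ys (val b s))) # zs @ concat (map f (?ys (val b s)))"
    using k by auto
qed

section \<open>The program\<close>

abbreviation (input) "ADJ \<equiv> 2 :: nat"
abbreviation (input) "SEP \<equiv> 3 :: nat"
abbreviation (input) "REACH_A \<equiv> 4 :: nat"
abbreviation (input) "REACH_B \<equiv> 5 :: nat"
abbreviation (input) "INC \<equiv> 6 :: nat"
abbreviation (input) "MARK_A \<equiv> 7 :: nat"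
abbreviation (input) "MARK_B \<equiv> 8 :: nat"
abbreviation (input) "LINK \<equiv> 9 :: nat"
abbreviation (input) "DIFF \<equiv> 10 :: nat"
abbreviation (input) "DUP \<equiv> 11 :: nat"
abbreviation (input) "EMITTED \<equiv> 12 :: nat"
abbreviation (input) "HC \<equiv> 13 :: nat"
abbreviation (input) "HT \<equiv> 14 :: nat"
abbreviation (input) "HL \<equiv> 15 :: nat"
abbreviation (input) "LI \<equiv> 20 :: nat"
abbreviation (input) "LB \<equiv> 21 :: nat"
abbreviation (input) "LV \<equiv> 22 :: nat"
abbreviation (input) "LU \<equiv> 23 :: nat"
abbreviation (input) "LR \<equiv> 24 :: nat"
abbreviation (input) "LI' \<equiv> 25 :: nat"
abbreviation (input) "LB' \<equiv> 26 :: nat"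
abbreviation (input) "LP \<equiv> 27 :: nat"
abbreviation (input) "LD1 \<equiv> 28 :: nat"
abbreviation (input) "LD2 \<equiv> 29 :: nat"
abbreviation (input) "LF \<equiv> 30 :: nat"
abbreviation (input) "LJ \<equiv> 31 :: nat"

abbreviation "n_exp \<equiv> Load (Const 0)"
abbreviation "m_exp \<equiv> Load (Const 1)"
abbreviation "elem1 k e \<equiv> elem k e (Const 0)"
abbreviation "Put1 k e g \<equiv> Put k e (Const 0) g"
abbreviation "Put0 k g \<equiv> Put k (Const 0) (Const 0) g"

definition differ :: "exp \<Rightarrow> exp \<Rightarrow> exp" where
  "differ e f = Add (Sub e f) (Sub f e)"

definition neg :: "exp \<Rightarrow> exp" where
  "neg e = Sub (Const 1) e"

lemma val_differ [simp]: "val (differ e f) s = 0 \<longleftrightarrow> val e s = val f s"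
  by (auto simp: differ_def)

lemma val_neg [simp]: "val (neg e) s = 0 \<longleftrightarrow> val e s \<noteq> 0"
  by (auto simp: neg_def)

text \<open>An index below 2m selects an endpoint of an edge directly from the input, behind the
  cells for n and m.\<close>

abbreviation "endpoint k \<equiv> Load (Add (Const 2) (var k))"

definition read_edges :: stmt where
  "read_edges = For LI m_exp
     (Put ADJ (Load (Add (Const 2) (Mul (Const 2) (var LI)))) (Load (Add (Const 3) (Mul (Const 2) (var LI)))) (Const 1) ;;
      Put ADJ (Load (Add (Const 3) (Mul (Const 2) (var LI)))) (Load (Add (Const 2) (Mul (Const 2) (var LI)))) (Const 1))"

text \<open>The loop covers n and n + 1 too, because \<open>SEP\<close> is later read at the names
  of the Steiner centers and must be 0 there, even after earlier pairs.\<close>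

definition find_common_nbrs :: stmt where
  "find_common_nbrs = For LV (Add n_exp (Const 2))
     (Cond (Mul (elem ADJ (endpoint LI) (var LV)) (elem ADJ (var LB) (var LV)))
        (Put1 SEP (var LV) (Const 1)) (Put1 SEP (var LV) (Const 0)))"

definition spread_round :: "nat \<Rightarrow> stmt" where
  "spread_round k = For LU n_exp (For LV n_exp
     (Cond (Mul (elem1 k (var LU)) (Mul (elem ADJ (var LU) (var LV)) (neg (elem1 SEP (var LV)))))
        (Put1 k (var LV) (Const 1)) Nop))"

definition find_component :: "nat \<Rightarrow> exp \<Rightarrow> stmt" where
  "find_component k e = For LV n_exp (Put1 k (var LV) (Const 0)) ;; Put1 k e (Const 1) ;; For LR n_exp (spread_round k)"

text \<open>Earlier separators are recomputed from the pairs recorded in \<open>EMITTED\<close>.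
  Each of the 2mn pairs takes n comparisons, which is within order \<open>n ^ 4\<close>.\<close>

definition find_duplicate :: stmt where
  "find_duplicate = Put0 DUP (Const 0) ;; For LI' (Mul (Const 2) m_exp) (For LB' n_exp
     (Put0 DIFF (Const 0) ;;
      For LV n_exp
        (Cond (differ (elem1 SEP (var LV)) (Mul (elem ADJ (endpoint LI') (var LV)) (elem ADJ (var LB') (var LV))))
           (Put0 DIFF (Const 1)) Nop) ;;
      Cond (Mul (elem EMITTED (var LI') (var LB')) (neg (var DIFF))) (Put0 DUP (Const 1)) Nop))"

definition find_incomplete :: stmt where
  "find_incomplete = For LP n_exp
     (Put1 INC (var LP) (Const 0) ;;
      Cond (elem1 SEP (var LP)) Nop
        (For LV n_exp (Cond (Mul (elem1 SEP (var LV)) (neg (elem ADJ (var LP) (var LV))))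
           (Put1 INC (var LP) (Const 1)) Nop)))"

definition find_marked :: "nat \<Rightarrow> nat \<Rightarrow> stmt" where
  "find_marked k r = For LV n_exp
     (Put1 k (var LV) (Const 0) ;;
      For LP n_exp (Cond (Mul (elem1 INC (var LP)) (Mul (elem1 r (var LP)) (elem ADJ (var LP) (var LV))))
        (Put1 k (var LV) (Const 1)) Nop))"

text \<open>The second index runs up to n inclusive, since the first center may be the Steiner name
  n; its column is 0.\<close>

definition find_linked :: stmt where
  "find_linked = For LV n_exp (For LU (Add n_exp (Const 1))
     (Put LINK (var LV) (var LU) (Const 0) ;;
      For LP n_exp (Cond (Mul (elem1 INC (var LP)) (Mul (elem ADJ (var LP) (var LV)) (elem ADJ (var LP) (var LU))))
        (Put LINK (var LV) (var LU) (Const 1)) Nop)))"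

lemma writes_pieces [simp]:
  "writes read_edges = {ADJ, LI}" "writes find_common_nbrs = {SEP, LV}"
  "writes (spread_round k) = {k, LU, LV}" "writes (find_component k e) = {k, LU, LV, LR}"
  "writes find_duplicate = {DUP, DIFF, LI', LB', LV}" "writes find_incomplete = {INC, LP, LV}"
  "writes (find_marked k r) = {k, LV, LP}" "writes find_linked = {LINK, LV, LU, LP}"
  by (auto simp: read_edges_def find_common_nbrs_def spread_round_def find_component_def find_duplicate_def
      find_incomplete_def find_marked_def find_linked_def)

lemma proper_pieces [simp]:
  "proper read_edges" "proper find_common_nbrs" "k \<in> {4, 5} \<Longrightarrow> proper (find_component k e)"
  "proper find_duplicate" "proper find_incomplete" "k \<in> {7, 8} \<Longrightarrow> proper (find_marked k r)" "proper find_linked"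
  by (auto simp: read_edges_def find_common_nbrs_def spread_round_def find_component_def find_duplicate_def
      find_incomplete_def find_marked_def find_linked_def)

subsection \<open>Components\<close>

text \<open>Adds to X what is reached from u in one step. Folding over all u models one round with
  updates in place, so later vertices already profit from earlier ones.\<close>

definition spread :: "'a graph \<Rightarrow> 'a set \<Rightarrow> 'a \<Rightarrow> 'a set \<Rightarrow> 'a set" where
  "spread G S u X = X \<union> {v. u \<in> X \<and> v \<in> nbrs G u - S}"

lemma spread_mono: "X \<subseteq> fold (spread G S) us X"
proof (induction us arbitrary: X)
  case (Cons u us)
  have "X \<subseteq> spread G S u X" by (auto simp: spread_def)
  then show ?case using Cons[of "spread G S u X"] by auto
qed simp

lemma spread_step: "u \<in> set us \<Longrightarrow> u \<in> X \<Longrightarrow> v \<in> nbrs G u - S \<Longrightarrow> v \<in> fold (spread G S) us X"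
proof (induction us arbitrary: X)
  case (Cons w us)
  show ?case
  proof (cases "u = w")
    case True
    then have "v \<in> spread G S w X" using Cons.prems by (auto simp: spread_def)
    then show ?thesis using spread_mono[of "spread G S w X" G S us] by auto
  next
    case False
    then show ?thesis using Cons.IH[of "spread G S w X"] Cons.prems by (auto simp: spread_def)
  qed
qed simp

lemma spread_sound:
  assumes "simple_graph G" "X \<subseteq> component G S a"
  shows "fold (spread G S) us X \<subseteq> component G S a"
  using assms(2)
proof (induction us arbitrary: X)
  case (Cons u us)
  have "v \<in> component G S a" if "u \<in> X" "v \<in> nbrs G u - S" for v
  proof (rule component_step)
    show "u \<in> component G S a" using that Cons.prems by auto
    show "{u, v} \<in> edges G" "v \<in> verts G - S" "u \<noteq> v"
      using that assms(1) by (auto simp: nbrs_def simple_graph_def)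
  qed
  then have "spread G S u X \<subseteq> component G S a" using Cons.prems by (auto simp: spread_def)
  then show ?case using Cons.IH by simp
qed simp

text \<open>After r rounds the ends of all paths with at most r + 1 vertices are reached, and a path
  has at most n vertices.\<close>

lemma spread_eq_component:
  fixes G :: "nat graph"
  assumes G: "simple_graph G" "verts G = {..<n}" and a: "a \<in> verts G - S"
  shows "((fold (spread G S) [0..<n]) ^^ n) {a} = component G S a"
proof
  let ?F = "fold (spread G S) [0..<n]"
  have "(?F ^^ r) {a} \<subseteq> component G S a" for r
    by (induction r) (use spread_sound[OF G(1)] component_self[of a G S] a in auto)
  then show "(?F ^^ n) {a} \<subseteq> component G S a" .
  let ?H = "induced G (verts G - S)"
  have path: "v \<in> (?F ^^ r) {a}" if "is_path ?H a p v" "length p \<le> Suc r" for p v r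
    using that
  proof (induction r arbitrary: p v)
    case 0
    then have "length p = 1" using is_path_ends(5)[OF 0(1)] by (cases p) auto
    then show ?case using 0(1) by (auto simp: is_path_def length_Suc_conv)
  next
    case (Suc r)
    show ?case
    proof (cases "a = v")
      case True
      have "a \<in> (?F ^^ k) {a}" for k
        by (induction k) (simp_all add: subsetD[OF spread_mono])
      then show ?thesis using True by blast
    next
      case False
      have ne: "p \<noteq> []" "last p = v" "hd p = a" using Suc.prems(1) by (auto simp: is_path_def)
      then obtain q where q: "p = q @ [v]" by (metis append_butlast_last_id)
      then have "q \<noteq> []" using False ne by auto
      then obtain q' w where "q = q' @ [w]" by (meson rev_exhaust)
      then have p: "p = q' @ w # [v]" using q by simp
      have w: "is_path ?H a (q' @ [w]) w" "is_path ?H w (w # [v]) v"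
        using is_path_split[of ?H a q' w "[v]" v] Suc.prems(1) p by auto
      then have "w \<in> (?F ^^ r) {a}" using Suc.IH[of "q' @ [w]" w] Suc.prems(2) p by simp
      moreover have "v \<in> nbrs G w - S" "w < n"
        using w(2) G(2) by (auto simp: is_path_def induced_def nbrs_def)
      ultimately show ?thesis using spread_step[of w "[0..<n]"] by simp
    qed
  qed
  show "component G S a \<subseteq> (?F ^^ n) {a}"
  proof
    fix v assume "v \<in> component G S a"
    then obtain p where p: "is_path ?H a p v" by (auto simp: component_def)
    then have "distinct p" "set p \<subseteq> {..<n}" using G(2) by (auto simp: is_path_def induced_def)
    then have "length p \<le> n" using card_mono[of "{..<n}" "set p"] by (simp add: distinct_card)
    then show "v \<in> (?F ^^ n) {a}" using path[OF p, of n] by simp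
  qed
qed

subsection \<open>Correctness of the array computations\<close>

lemma length_concat_pairs: "length (concat (map (\<lambda>(u, v). [u, v]) es)) = 2 * length es"
  by (induction es) auto

lemma nth_concat_pairs:
  "i < length es \<Longrightarrow> concat (map (\<lambda>(u, v). [u, v]) es) ! (2 * i) = fst (es ! i) \<and>
    concat (map (\<lambda>(u, v). [u, v]) es) ! Suc (2 * i) = snd (es ! i)"
proof (induction es arbitrary: i)
  case (Cons e es)
  then show ?case by (cases i) (auto simp: case_prod_beta)
qed simp

locale input_graph =
  fixes G :: "nat graph" and n m :: nat and es :: "(nat \<times> nat) list"
  assumes simple_G: "simple_graph G" and verts_G: "verts G = {..<n}"
    and card_edges: "card (edges G) = m" and listed: "lists_edges es G"
begin

definition "s = input_mem n es"

lemma length_es: "length es = m"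
  using listed card_edges by (simp add: lists_edges_def)

lemma s_eq:
  "s = (\<lambda>i. if i < 2 * m + 2 then (n # m # concat (map (\<lambda>(u, v). [u, v]) es)) ! i else 0)"
  by (auto simp: s_def input_mem_def enc_edges_def enc_def length_concat_pairs length_es Let_def fun_eq_iff)

lemma s_n [simp]: "s 0 = n" and s_m [simp]: "s (Suc 0) = m"
  by (auto simp: s_eq)

lemma s_zero: "2 * s 1 + 2 \<le> l \<Longrightarrow> s l = 0"
  by (simp add: s_eq)

lemma s_endpoints:
  assumes "i < m"
  shows "s (2 + 2 * i) = fst (es ! i)" "s (3 + 2 * i) = snd (es ! i)"
proof -
  have "(n # m # concat (map (\<lambda>(u, v). [u, v]) es)) ! (3 + 2 * i) =
    concat (map (\<lambda>(u, v). [u, v]) es) ! Suc (2 * i)"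
    by (simp add: eval_nat_numeral)
  then show "s (2 + 2 * i) = fst (es ! i)" "s (3 + 2 * i) = snd (es ! i)"
    using assms nth_concat_pairs[of i es] length_es by (simp_all add: s_eq)
qed

lemma mem_endpoint [simp]: "i < 2 * m \<Longrightarrow> mem_of s \<sigma> (Suc (Suc i)) = s (Suc (Suc i))"
  by (rule mem_of_input) simp

lemma edge_in: "{u, v} \<in> edges G \<Longrightarrow> u < n \<and> v < n \<and> u \<noteq> v"
  using simple_G verts_G by (auto simp: simple_graph_def card_insert_if split: if_splits)

lemma edge_listed: "{u, v} \<in> edges G \<longleftrightarrow> (\<exists>i<m. {u, v} = {s (2 + 2 * i), s (3 + 2 * i)})"
proof -
  have "{u, v} \<in> edges G \<longleftrightarrow> (\<exists>e\<in>set es. {u, v} = {fst e, snd e})"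
    using listed unfolding lists_edges_def edge_sets_def by (metis (no_types, lifting) case_prod_beta image_iff)
  also have "\<dots> \<longleftrightarrow> (\<exists>i<m. {u, v} = {fst (es ! i), snd (es ! i)})"
    unfolding length_es[symmetric] by (metis in_set_conv_nth)
  also have "\<dots> \<longleftrightarrow> (\<exists>i<m. {u, v} = {s (2 + 2 * i), s (3 + 2 * i)})"
    by (metis s_endpoints)
  finally show ?thesis .
qed

lemma endpoint_of_edge: "{u, v} \<in> edges G \<Longrightarrow> \<exists>i<2 * m. s (2 + i) = u"
proof -
  assume "{u, v} \<in> edges G"
  then obtain i where i: "i < m" "{u, v} = {s (2 + 2 * i), s (3 + 2 * i)}" by (auto simp: edge_listed)
  then have "u = s (2 + 2 * i) \<or> u = s (2 + (2 * i + 1))" by (auto simp: doubleton_eq_iff eval_nat_numeral)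
  moreover have "2 * i < 2 * m" "2 * i + 1 < 2 * m" using i(1) by simp_all
  ultimately show ?thesis by blast
qed

definition adj_ok :: "arrays \<Rightarrow> bool" where
  "adj_ok \<sigma> \<longleftrightarrow> (\<forall>u v. \<sigma> ADJ u v = of_bool (v \<in> nbrs G u))"

definition bits :: "nat \<Rightarrow> nat \<Rightarrow> arrays \<Rightarrow> nat set \<Rightarrow> bool" where
  "bits k l \<sigma> X \<longleftrightarrow> (\<forall>v<l. \<sigma> k v 0 = of_bool (v \<in> X))"

lemma nbrs_iff_edge: "v \<in> nbrs G u \<longleftrightarrow> {u, v} \<in> edges G"
  by (simp add: nbrs_def)

lemma read_edges: "adj_ok (run s read_edges (\<lambda>_ _ _. 0))"
proof -
  have "run s read_edges (\<lambda>_ _ _. 0) ADJ u v =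
     (if \<exists>i<m. {u, v} = {s (2 + 2 * i), s (3 + 2 * i)} then 1 else 0)" for u v
    unfolding read_edges_def
  proof (subst For_array[where P = "\<lambda>i u v. {u, v} = {s (2 + 2 * i), s (3 + 2 * i)}" and g = "\<lambda>_ _. 1"])
    fix i \<tau> x y assume i: "i < val m_exp s"
    define p q where "p = s (2 + 2 * i)" and "q = s (3 + 2 * i)"
    let ?p = "Load (Add (Const 2) (Mul (Const 2) (var LI)))"
    let ?q = "Load (Add (Const 3) (Mul (Const 2) (var LI)))"
    have pq: "val ?p (mem_of s \<rho>) = p" "val ?q (mem_of s \<rho>) = q" if "\<rho> LI 0 0 = i" for \<rho>
      using i that mem_of_input[of "2 + 2 * i" s \<rho>] mem_of_input[of "3 + 2 * i" s \<rho>]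
      by (simp_all add: p_def q_def)
    let ?\<rho>1 = "upd \<tau> LI 0 0 i" and ?\<rho>2 = "upd (upd \<tau> LI 0 0 i) ADJ p q 1"
    have c: "?\<rho>1 LI 0 0 = i" "?\<rho>2 LI 0 0 = i" by simp_all
    have "run s (Put ADJ ?p ?q (Const 1)) ?\<rho>1 = ?\<rho>2"
      unfolding run.simps pq(1)[of ?\<rho>1, OF c(1)] pq(2)[of ?\<rho>1, OF c(1)] by simp
    moreover have "run s (Put ADJ ?q ?p (Const 1)) ?\<rho>2 = upd ?\<rho>2 ADJ q p 1"
      unfolding run.simps pq(1)[of ?\<rho>2, OF c(2)] pq(2)[of ?\<rho>2, OF c(2)] by simp
    ultimately have R: "run s (Put ADJ ?p ?q (Const 1) ;; Put ADJ ?q ?p (Const 1)) ?\<rho>1 = upd ?\<rho>2 ADJ q p 1"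
      unfolding run.simps(3) by presburger
    have t: "upd \<tau> LI 0 0 i ADJ = \<tau> ADJ" by (rule upd_other) simp
    show "run s (Put ADJ ?p ?q (Const 1) ;; Put ADJ ?q ?p (Const 1))
        (upd \<tau> LI 0 0 i) ADJ x y = (if {x, y} = {s (2 + 2 * i), s (3 + 2 * i)} then 1 else \<tau> ADJ x y)"
      unfolding R p_def[symmetric] q_def[symmetric] doubleton_eq_iff upd_same t by argo
  qed simp_all
  then show ?thesis by (simp add: adj_ok_def nbrs_iff_edge edge_listed)
qed

lemma find_common_nbrs:
  assumes "adj_ok \<sigma>" "\<sigma> LI 0 0 < 2 * m"
  shows "bits SEP (n + 2) (run s find_common_nbrs \<sigma>) (nbrs G (s (2 + \<sigma> LI 0 0)) \<inter> nbrs G (\<sigma> LB 0 0))"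
proof -
  let ?S = "nbrs G (s (2 + \<sigma> LI 0 0)) \<inter> nbrs G (\<sigma> LB 0 0)"
  have "run s find_common_nbrs \<sigma> SEP v 0 = (if \<exists>i<n + 2. v = i \<and> (0::nat) = 0 then of_bool (v \<in> ?S) else \<sigma> SEP v 0)" for v
    unfolding find_common_nbrs_def
    by (subst For_array[where P = "\<lambda>i v j. v = i \<and> j = 0" and g = "\<lambda>v _. of_bool (v \<in> ?S)"])
      (use assms in \<open>auto simp: same_but_def adj_ok_def\<close>)
  then show ?thesis by (simp add: bits_def)
qed

lemma spread_inner:
  assumes "adj_ok \<sigma>" "bits SEP n \<sigma> S" "bits k n \<sigma> X" "\<sigma> LU 0 0 < n" "k \<in> {4, 5}"
  shows "bits k n (run s (For LV n_exp
     (Cond (Mul (elem1 k (var LU)) (Mul (elem ADJ (var LU) (var LV)) (neg (elem1 SEP (var LV)))))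
        (Put1 k (var LV) (Const 1)) Nop)) \<sigma>) (spread G S (\<sigma> LU 0 0) X)"
proof -
  let ?u = "\<sigma> LU 0 0"
  let ?I = "\<lambda>i \<tau>. bits k n \<tau> (X \<union> {v. v < i \<and> ?u \<in> X \<and> v \<in> nbrs G ?u - S})"
  let ?body = "Cond (Mul (elem1 k (var LU)) (Mul (elem ADJ (var LU) (var LV)) (neg (elem1 SEP (var LV)))))
        (Put1 k (var LV) (Const 1)) Nop"
  \<comment> \<open>The row is read at u while it is being written. As u is not its own neighbour,
    its entry stays unchanged during the loop.\<close>
  have u: "?u \<notin> nbrs G ?u" using edge_in[of ?u ?u] by (auto simp: nbrs_def)
  have k: "k < 40" "k \<noteq> LV" "k \<noteq> LU" "k \<noteq> ADJ" "k \<noteq> SEP" using assms(5) by auto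
  have "\<exists>\<tau>. ?I (val n_exp s) \<tau> \<and> run s (For LV n_exp ?body) \<sigma> = upd \<tau> LV 0 0 (val n_exp s)"
  proof (rule For_frame_rule[where I = ?I])
    fix i \<tau> assume i: "i < val n_exp s" and sb: "same_but (insert LV (writes ?body)) \<sigma> \<tau>" and I: "?I i \<tau>"
    have fr: "\<tau> LU = \<sigma> LU" "\<tau> ADJ = \<sigma> ADJ" "\<tau> SEP = \<sigma> SEP" using sb k by (auto simp: same_but_def)
    have "\<tau> k ?u 0 = of_bool (?u \<in> X)" using I u assms(4) by (auto simp: bits_def)
    moreover have "\<sigma> ADJ ?u i = of_bool (i \<in> nbrs G ?u)" "\<sigma> SEP i 0 = of_bool (i \<in> S)"
      using assms(1,2) i by (simp_all add: adj_ok_def bits_def)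
    ultimately have run: "run s ?body (upd \<tau> LV 0 0 i) =
        (if ?u \<in> X \<and> i \<in> nbrs G ?u - S then upd (upd \<tau> LV 0 0 i) k i 0 1 else upd \<tau> LV 0 0 i)"
      using fr k by simp
    show "?I (Suc i) (run s ?body (upd \<tau> LV 0 0 i))"
      unfolding run using I k(2) by (auto simp: bits_def less_Suc_eq)
  qed (use assms in simp)
  moreover have "X \<union> {v. v < n \<and> ?u \<in> X \<and> v \<in> nbrs G ?u - S} = spread G S ?u X"
    using edge_in by (auto simp: spread_def nbrs_def)
  ultimately show ?thesis using assms(5) by (auto simp: bits_def)
qed

lemma spread_round:
  assumes "adj_ok \<sigma>" "bits SEP n \<sigma> S" "bits k n \<sigma> X" "k \<in> {4, 5}"
  shows "bits k n (run s (spread_round k) \<sigma>) (fold (spread G S) [0..<n] X)"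
proof -
  have "\<exists>\<tau>. bits k n \<tau> (fold (spread G S) [0..<val n_exp s] X) \<and>
      run s (spread_round k) \<sigma> = upd \<tau> LU 0 0 (val n_exp s)"
    unfolding spread_round_def
  proof (rule For_frame_rule)
    fix i \<tau>
    assume i: "i < val n_exp s" and \<tau>: "same_but (insert LU (writes (For LV n_exp
     (Cond (Mul (elem1 k (var LU)) (Mul (elem ADJ (var LU) (var LV)) (neg (elem1 SEP (var LV)))))
        (Put1 k (var LV) (Const 1)) Nop)))) \<sigma> \<tau>" "bits k n \<tau> (fold (spread G S) [0..<i] X)"
    show "bits k n (run s (For LV n_exp
     (Cond (Mul (elem1 k (var LU)) (Mul (elem ADJ (var LU) (var LV)) (neg (elem1 SEP (var LV)))))
        (Put1 k (var LV) (Const 1)) Nop)) (upd \<tau> LU 0 0 i)) (fold (spread G S) [0..<Suc i] X)"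
      using spread_inner[of "upd \<tau> LU 0 0 i" S k "fold (spread G S) [0..<i] X"] assms i \<tau>
      by (auto simp: adj_ok_def bits_def same_but_def)
  qed (use assms in simp)
  then show ?thesis using assms(4) by (auto simp: bits_def)
qed

text \<open>The expression e is evaluated after the row has been cleared, so its value is required
  in all states that differ at most in this row and the loop counter.\<close>

lemma find_component:
  assumes "adj_ok \<sigma>" "bits SEP n \<sigma> S" "k \<in> {4, 5}"
    and e: "\<And>\<tau>. same_but {k, LV} \<sigma> \<tau> \<Longrightarrow> val e (mem_of s \<tau>) = a" "a \<in> {..<n} - S"
  shows "bits k n (run s (find_component k e) \<sigma>) (component G S a)"
proof -
  let ?c = "For LV n_exp (Put1 k (var LV) (Const 0)) ;; Put1 k e (Const 1)"
  let ?\<sigma> = "run s ?c \<sigma>"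
  let ?F = "fold (spread G S) [0..<n]"
  have z: "run s (For LV n_exp (Put1 k (var LV) (Const 0))) \<sigma> k x 0 = (if \<exists>i<n. x = i \<and> (0::nat) = 0 then 0 else \<sigma> k x 0)" for x
    by (subst For_array[where P = "\<lambda>i x y. x = i \<and> y = 0" and g = "\<lambda>_ _. 0"])
      (use assms(3) in auto)
  have frame: "same_but {k, LV} \<sigma> (run s (For LV n_exp (Put1 k (var LV) (Const 0))) \<sigma>)"
    using assms(3) by (auto simp: same_but_def run_frame)
  have b0: "bits k n ?\<sigma> {a}"
    using z e(1)[OF frame] e(2) by (auto simp: bits_def)
  have sb: "same_but {k, LV} \<sigma> ?\<sigma>" using frame by (auto simp: same_but_def)
  have "\<exists>\<tau>. bits k n \<tau> ((?F ^^ val n_exp s) {a}) \<and>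
      run s (For LR n_exp (spread_round k)) ?\<sigma> = upd \<tau> LR 0 0 (val n_exp s)"
  proof (rule For_frame_rule)
    fix i \<tau>
    assume \<tau>: "same_but (insert LR (writes (spread_round k))) ?\<sigma> \<tau>" "bits k n \<tau> ((?F ^^ i) {a})"
    have "\<tau> l = \<sigma> l" if "l \<in> {ADJ, SEP}" for l
      using \<tau>(1) sb assms(3) that unfolding same_but_def by auto
    then show "bits k n (run s (spread_round k) (upd \<tau> LR 0 0 i)) ((?F ^^ Suc i) {a})"
      using spread_round[of "upd \<tau> LR 0 0 i" S k "(?F ^^ i) {a}"] assms(1-3) \<tau>(2)
      by (auto simp: adj_ok_def bits_def)
  qed (use b0 in simp)
  moreover have "(?F ^^ n) {a} = component G S a"
    using spread_eq_component[OF simple_G verts_G] e(2) verts_G by simp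
  ultimately show ?thesis using assms(3) by (auto simp: find_component_def bits_def)
qed

lemma find_duplicate:
  assumes "adj_ok \<sigma>" "bits SEP n \<sigma> S" "S \<subseteq> {..<n}"
  shows "run s find_duplicate \<sigma> DUP 0 0 =
    of_bool (\<exists>i<2 * m. \<exists>b<n. \<sigma> EMITTED i b \<noteq> 0 \<and> S = nbrs G (s (2 + i)) \<inter> nbrs G b)"
proof -
  \<comment> \<open>All neighbours are below n, so comparing n bits decides equality of the
    sets.\<close>
  have S_eq: "S = nbrs G u \<inter> nbrs G b \<longleftrightarrow> (\<forall>v<n. v \<in> S \<longleftrightarrow> v \<in> nbrs G u \<inter> nbrs G b)" for u b
    using assms(3) edge_in[of u] by (auto simp: nbrs_def)
  let ?diff = "For LV n_exp
        (Cond (differ (elem1 SEP (var LV)) (Mul (elem ADJ (endpoint LI') (var LV)) (elem ADJ (var LB') (var LV))))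
           (Put0 DIFF (Const 1)) Nop)"
  let ?body = "Put0 DIFF (Const 0) ;; ?diff ;;
      Cond (Mul (elem EMITTED (var LI') (var LB')) (neg (var DIFF))) (Put0 DUP (Const 1)) Nop"
  let ?same = "\<lambda>i b. \<sigma> EMITTED i b \<noteq> 0 \<and> S = nbrs G (s (2 + i)) \<inter> nbrs G b"
  have diff: "run s ?diff \<tau> DIFF 0 0 =
      (if \<exists>v<n. (0::nat) = 0 \<and> (0::nat) = 0 \<and> (v \<in> S) \<noteq> (v \<in> nbrs G (s (2 + \<tau> LI' 0 0)) \<inter> nbrs G (\<tau> LB' 0 0)) then 1
        else \<tau> DIFF 0 0)"
    if "same_but {DIFF, DUP, LI', LB', LV} \<sigma> \<tau>" "\<tau> LI' 0 0 < 2 * m" for \<tau>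
    by (subst For_array[where P = "\<lambda>v x y. x = 0 \<and> y = 0 \<and>
          (v \<in> S) \<noteq> (v \<in> nbrs G (s (2 + \<tau> LI' 0 0)) \<inter> nbrs G (\<tau> LB' 0 0))" and g = "\<lambda>_ _. 1"])
      (use assms that in \<open>auto simp: same_but_def adj_ok_def bits_def\<close>)
  have body: "run s ?body \<tau> DUP x y = (if x = 0 \<and> y = 0 \<and> ?same (\<tau> LI' 0 0) (\<tau> LB' 0 0) then 1 else \<tau> DUP x y)"
    if "same_but {DIFF, DUP, LI', LB', LV} \<sigma> \<tau>" "\<tau> LI' 0 0 < 2 * m" for \<tau> x y
  proof -
    let ?\<tau> = "run s (Put0 DIFF (Const 0)) \<tau>"
    have sb: "same_but {DIFF, DUP, LI', LB', LV} \<sigma> ?\<tau>" using that(1) by (auto simp: same_but_def)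
    have d: "run s ?diff ?\<tau> DIFF 0 0 = 0 \<longleftrightarrow> S = nbrs G (s (2 + \<tau> LI' 0 0)) \<inter> nbrs G (\<tau> LB' 0 0)"
      using diff[OF sb] that(2) unfolding S_eq by auto
    have fr: "run s ?diff ?\<tau> l = \<tau> l" if "l \<notin> {DIFF, LV}" for l
      using that by (subst run_frame) auto
    have "\<tau> EMITTED = \<sigma> EMITTED" using that(1) by (simp add: same_but_def)
    then show ?thesis using d fr by auto
  qed
  have inner: "run s (For LB' n_exp ?body) \<tau> DUP x y =
      (if \<exists>b<n. x = 0 \<and> y = 0 \<and> ?same (\<tau> LI' 0 0) b then 1 else \<tau> DUP x y)"
    if "same_but {DIFF, DUP, LI', LB', LV} \<sigma> \<tau>" "\<tau> LI' 0 0 < 2 * m" for \<tau> x y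
  proof (subst For_array[where P = "\<lambda>b x y. x = 0 \<and> y = 0 \<and> ?same (\<tau> LI' 0 0) b" and g = "\<lambda>_ _. 1"])
    fix i \<rho> x y
    assume \<rho>: "same_but (insert LB' (writes ?body)) \<tau> \<rho>"
    have "same_but {DIFF, DUP, LI', LB', LV} \<sigma> (upd \<rho> LB' 0 0 i)" "\<rho> LI' = \<tau> LI'"
      using \<rho> that(1) by (auto simp: same_but_def)
    then show "run s ?body (upd \<rho> LB' 0 0 i) DUP x y =
        (if x = 0 \<and> y = 0 \<and> ?same (\<tau> LI' 0 0) i then 1 else \<rho> DUP x y)"
      using body[of "upd \<rho> LB' 0 0 i" x y] that(2) by simp
  qed auto
  let ?\<sigma> = "run s (Put0 DUP (Const 0)) \<sigma>"
  have "run s (For LI' (Mul (Const 2) m_exp) (For LB' n_exp ?body)) ?\<sigma> DUP 0 0 =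
      (if \<exists>i<val (Mul (Const 2) m_exp) s. (0::nat) = 0 \<and> (0::nat) = 0 \<and> (\<exists>b<n. ?same i b) then 1 else ?\<sigma> DUP 0 0)"
  proof (subst For_array[where P = "\<lambda>i x y. x = 0 \<and> y = 0 \<and> (\<exists>b<n. ?same i b)" and g = "\<lambda>_ _. 1"])
    fix i \<rho> x y
    assume i: "i < val (Mul (Const 2) m_exp) s" and \<rho>: "same_but (insert LI' (writes (For LB' n_exp ?body))) ?\<sigma> \<rho>"
    have "same_but {DIFF, DUP, LI', LB', LV} \<sigma> (upd \<rho> LI' 0 0 i)"
      using \<rho> by (auto simp: same_but_def)
    then show "run s (For LB' n_exp ?body) (upd \<rho> LI' 0 0 i) DUP x y =
        (if x = 0 \<and> y = 0 \<and> (\<exists>b<n. ?same i b) then 1 else \<rho> DUP x y)"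
      using inner[of "upd \<rho> LI' 0 0 i" x y] i by auto
  qed auto
  then show ?thesis by (simp add: find_duplicate_def)
qed

lemma find_incomplete:
  assumes "adj_ok \<sigma>" "bits SEP n \<sigma> S" "S \<subseteq> {..<n}"
  shows "bits INC n (run s find_incomplete \<sigma>) {p. incomplete G S p}"
proof -
  let ?loop = "For LV n_exp (Cond (Mul (elem1 SEP (var LV)) (neg (elem ADJ (var LP) (var LV))))
           (Put1 INC (var LP) (Const 1)) Nop)"
  have loop: "run s ?loop \<tau> INC x y =
      (if \<exists>v<n. x = \<tau> LP 0 0 \<and> y = 0 \<and> v \<in> S - nbrs G (\<tau> LP 0 0) then 1 else \<tau> INC x y)"
    if "same_but {INC, LP, LV} \<sigma> \<tau>" for \<tau> x y
    by (subst For_array[where P = "\<lambda>v x y. x = \<tau> LP 0 0 \<and> y = 0 \<and> v \<in> S - nbrs G (\<tau> LP 0 0)" and g = "\<lambda>_ _. 1"])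
      (use assms that in \<open>auto simp: same_but_def adj_ok_def bits_def\<close>)
  have inc: "incomplete G S p \<longleftrightarrow> p < n \<and> p \<notin> S \<and> (\<exists>v<n. v \<in> S - nbrs G p)" for p
    using assms(3) verts_G by (auto simp: incomplete_def)
  have "run s find_incomplete \<sigma> INC p 0 = (if \<exists>i<val n_exp s. p = i \<and> (0::nat) = 0 then of_bool (incomplete G S p) else \<sigma> INC p 0)" for p
    unfolding find_incomplete_def
  proof (subst For_array[where P = "\<lambda>i x y. x = i \<and> y = 0" and g = "\<lambda>x _. of_bool (incomplete G S x)"])
    fix i \<tau> x y
    assume i: "i < val n_exp s" and "same_but (insert LP (writes (Put1 INC (var LP) (Const 0) ;;
      Cond (elem1 SEP (var LP)) Nop ?loop))) \<sigma> \<tau>"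
    then have sb: "same_but {INC, LP, LV} \<sigma> (upd (upd \<tau> LP 0 0 i) INC i 0 0)"
      and sep: "\<tau> SEP i 0 = of_bool (i \<in> S)"
      using assms(2) by (auto simp: same_but_def bits_def)
    then show "run s (Put1 INC (var LP) (Const 0) ;; Cond (elem1 SEP (var LP)) Nop ?loop) (upd \<tau> LP 0 0 i) INC x y =
        (if x = i \<and> y = 0 then of_bool (incomplete G S x) else \<tau> INC x y)"
      using loop[OF sb, of x y] i inc[of i] by auto
  qed auto
  then show ?thesis by (simp add: bits_def)
qed

lemma find_marked:
  assumes "adj_ok \<sigma>" "bits INC n \<sigma> {p. incomplete G S p}" "bits r n \<sigma> (component G S a)"
    and k: "k \<in> {7, 8}" "r \<in> {4, 5}"
  shows "bits k n (run s (find_marked k r) \<sigma>) {v. marked G S a v}"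
proof -
  let ?loop = "For LP n_exp (Cond (Mul (elem1 INC (var LP)) (Mul (elem1 r (var LP)) (elem ADJ (var LP) (var LV))))
        (Put1 k (var LV) (Const 1)) Nop)"
  have kr: "k < 40" "r < 40" "k \<noteq> 27" "k \<noteq> 22" "k \<noteq> 6" "k \<noteq> 2" "r \<noteq> k" "r \<noteq> 27" "r \<noteq> 22"
    using k by auto
  have loop: "run s ?loop \<tau> k x y =
      (if \<exists>p<n. x = \<tau> LV 0 0 \<and> y = 0 \<and> incomplete G S p \<and> p \<in> component G S a \<and> \<tau> LV 0 0 \<in> nbrs G p then 1 else \<tau> k x y)"
    if "same_but {k, LP, LV} \<sigma> \<tau>" for \<tau> x y
    by (subst For_array[where P = "\<lambda>p x y. x = \<tau> LV 0 0 \<and> y = 0 \<and> incomplete G S p \<and>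
        p \<in> component G S a \<and> \<tau> LV 0 0 \<in> nbrs G p" and g = "\<lambda>_ _. 1"])
      (use assms(1-3) kr that in \<open>auto simp: same_but_def adj_ok_def bits_def\<close>)
  have mk: "marked G S a v \<longleftrightarrow> (\<exists>p<n. incomplete G S p \<and> p \<in> component G S a \<and> v \<in> nbrs G p)" for v
    using verts_G by (auto simp: marked_def incomplete_def)
  have "run s (find_marked k r) \<sigma> k v 0 = (if \<exists>i<val n_exp s. v = i \<and> (0::nat) = 0 then of_bool (marked G S a v) else \<sigma> k v 0)" for v
    unfolding find_marked_def
  proof (subst For_array[where P = "\<lambda>i x y. x = i \<and> y = 0" and g = "\<lambda>x _. of_bool (marked G S a x)"])
    fix i \<tau> x y
    assume i: "i < val n_exp s" and "same_but (insert LV (writes (Put1 k (var LV) (Const 0) ;; ?loop))) \<sigma> \<tau>"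
    then have sb: "same_but {k, LP, LV} \<sigma> (upd (upd \<tau> LV 0 0 i) k i 0 0)"
      using kr by (auto simp: same_but_def)
    then show "run s (Put1 k (var LV) (Const 0) ;; ?loop) (upd \<tau> LV 0 0 i) k x y =
        (if x = i \<and> y = 0 then of_bool (marked G S a x) else \<tau> k x y)"
      using loop[OF sb, of x y] i mk[of i] kr by auto
  qed (use kr in auto)
  then show ?thesis by (simp add: bits_def)
qed

lemma find_linked:
  assumes "adj_ok \<sigma>" "bits INC n \<sigma> {p. incomplete G S p}" "v < n" "u \<le> n"
  shows "run s find_linked \<sigma> LINK v u = of_bool (linked G S v u)"
proof -
  let ?loop = "For LP n_exp (Cond (Mul (elem1 INC (var LP)) (Mul (elem ADJ (var LP) (var LV)) (elem ADJ (var LP) (var LU))))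
        (Put LINK (var LV) (var LU) (Const 1)) Nop)"
  let ?body = "Put LINK (var LV) (var LU) (Const 0) ;; ?loop"
  have loop: "run s ?loop \<tau> LINK x y =
      (if \<exists>p<n. x = \<tau> LV 0 0 \<and> y = \<tau> LU 0 0 \<and> incomplete G S p \<and> \<tau> LV 0 0 \<in> nbrs G p \<and> \<tau> LU 0 0 \<in> nbrs G p then 1 else \<tau> LINK x y)"
    if "same_but {LINK, LP, LV, LU} \<sigma> \<tau>" for \<tau> x y
    by (subst For_array[where P = "\<lambda>p x y. x = \<tau> LV 0 0 \<and> y = \<tau> LU 0 0 \<and> incomplete G S p \<and>
        \<tau> LV 0 0 \<in> nbrs G p \<and> \<tau> LU 0 0 \<in> nbrs G p" and g = "\<lambda>_ _. 1"])
      (use assms that in \<open>auto simp: same_but_def adj_ok_def bits_def\<close>)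
  have lk: "linked G S x y \<longleftrightarrow> (\<exists>p<n. incomplete G S p \<and> x \<in> nbrs G p \<and> y \<in> nbrs G p)" for x y
    using verts_G by (auto simp: linked_def incomplete_def)
  have inner: "run s (For LU (Add n_exp (Const 1)) ?body) \<tau> LINK x y =
      (if \<exists>i<val (Add n_exp (Const 1)) s. x = \<tau> LV 0 0 \<and> y = i then of_bool (linked G S x y) else \<tau> LINK x y)"
    if \<tau>: "same_but {LINK, LP, LV, LU} \<sigma> \<tau>" for \<tau> x y
  proof (subst For_array[where P = "\<lambda>i x y. x = \<tau> LV 0 0 \<and> y = i" and g = "\<lambda>x y. of_bool (linked G S x y)"])
    fix i \<rho> x y
    assume \<rho>: "same_but (insert LU (writes ?body)) \<tau> \<rho>"
    then have sb: "same_but {LINK, LP, LV, LU} \<sigma> (upd (upd \<rho> LU 0 0 i) LINK (\<rho> LV 0 0) i 0)"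
      and LV: "\<rho> LV = \<tau> LV"
      using \<tau> by (auto simp: same_but_def)
    then show "run s ?body (upd \<rho> LU 0 0 i) LINK x y =
        (if x = \<tau> LV 0 0 \<and> y = i then of_bool (linked G S x y) else \<rho> LINK x y)"
      using loop[OF sb, of x y] lk[of x i] by auto
  qed auto
  have "run s find_linked \<sigma> LINK v u = (if \<exists>i<val n_exp s. v = i \<and> u \<le> n then of_bool (linked G S v u) else \<sigma> LINK v u)"
    unfolding find_linked_def
  proof (subst For_array[where P = "\<lambda>i x y. x = i \<and> y \<le> n" and g = "\<lambda>x y. of_bool (linked G S x y)"])
    fix i \<rho> x y
    assume "same_but (insert LV (writes (For LU (Add n_exp (Const 1)) ?body))) \<sigma> \<rho>"
    then have "same_but {LINK, LP, LV, LU} \<sigma> (upd \<rho> LV 0 0 i)" by (auto simp: same_but_def)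
    then show "run s (For LU (Add n_exp (Const 1)) ?body) (upd \<rho> LV 0 0 i) LINK x y =
        (if x = i \<and> y \<le> n then of_bool (linked G S x y) else \<rho> LINK x y)"
      using inner[of "upd \<rho> LV 0 0 i" x y] by auto
  qed auto
  then show ?thesis using assms(3,4) by simp
qed

end

subsection \<open>Emitting the trees\<close>

definition emit_set :: stmt where
  "emit_set = open_list HL ;; For LV n_exp (Cond (elem1 SEP (var LV)) (count HL ;; push (var LV)) Nop)"

definition emit_tree_verts :: stmt where
  "emit_tree_verts = open_list HL ;; For LV (Add n_exp (Const 2))
     (Cond (Add (elem1 SEP (var LV)) (Add (neg (differ (var LV) (var LD1))) (neg (differ (var LV) (var LD2)))))
        (count HL ;; push (var LV)) Nop)"

definition emit_tree_edges :: "exp \<Rightarrow> stmt" where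
  "emit_tree_edges c = open_list HL ;;
     (Cond (differ (var LD1) (var LD2)) (count HL ;; (push (var LD1) ;; push (var LD2))) Nop ;;
      For LV n_exp
        (Cond (Mul (elem1 SEP (var LV)) (Mul (differ (var LV) (var LD1)) (differ (var LV) (var LD2))))
          (count HL ;; (push (var LV) ;; Cond c (push (var LD1)) (push (var LD2)))) Nop))"

definition emit_tree :: "exp \<Rightarrow> stmt" where
  "emit_tree c = emit_tree_verts ;; emit_tree_edges c"

definition side_exp :: "nat \<Rightarrow> exp" where
  "side_exp k = Add (elem1 k (var LV)) (Add (elem LINK (var LV) (var LD1)) (neg (differ (var LV) (var LF))))"

definition emit_candidates :: stmt where
  "emit_candidates =
     For LF n_exp (count HT ;; emit_tree (elem ADJ (var LF) (var LV))) ;;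
     For LF (Add n_exp (Const 1))
       ((count HT ;; emit_tree (side_exp MARK_A)) ;; (count HT ;; emit_tree (side_exp MARK_B)))"

text \<open>Two empty lists encode the empty tree, for the empty separator. The first center ranges
  up to n and the second up to n + 1; the names n and n + 1 are Steiner nodes.\<close>

definition emit_trees :: stmt where
  "emit_trees = open_list HT ;;
     ((count HT ;; (push (Const 0) ;; push (Const 0))) ;;
      For LD1 (Add n_exp (Const 1)) (For LD2 (Add n_exp (Const 2)) emit_candidates))"

text \<open>The pair is accepted if b is not reachable from a outside the common neighbourhood. Both
  this test and the duplicate test precede any output, so a rejected pair leaves the output
  untouched.\<close>

definition process_pair :: stmt where
  "process_pair = find_common_nbrs ;; find_component REACH_A (endpoint LI) ;;
     Cond (elem1 REACH_A (var LB)) Nop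
       (find_duplicate ;;
        Cond (var DUP) Nop
          (Put EMITTED (var LI) (var LB) (Const 1) ;;
           find_component REACH_B (var LB) ;; find_incomplete ;;
           find_marked MARK_A REACH_A ;; find_marked MARK_B REACH_B ;; find_linked ;;
           (count HC ;; (emit_set ;; emit_trees))))"

definition separator_program :: stmt where
  "separator_program = read_edges ;; open_list HC ;;
     For LI (Mul (Const 2) m_exp) (For LB n_exp process_pair)"

lemma writes_emit [simp]:
  "writes emit_set = {HL, OUT, PTR, LV}" "writes emit_tree_verts = {HL, OUT, PTR, LV}"
  "writes (emit_tree_edges c) = {HL, OUT, PTR, LV}" "writes (emit_tree c) = {HL, OUT, PTR, LV}"
  "writes emit_candidates = {HL, OUT, PTR, LV, LF}"
  "writes emit_trees = {HT, HL, OUT, PTR, LV, LF, LD1, LD2}"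
  by (auto simp: emit_set_def emit_tree_verts_def emit_tree_edges_def emit_tree_def
      emit_candidates_def emit_trees_def)

lemma writes_process_pair: "x \<in> {ADJ, HC, LI, LB} \<Longrightarrow> x \<notin> writes process_pair"
  by (auto simp: process_pair_def)

lemma proper_separator_program: "proper separator_program"
  by (simp add: separator_program_def process_pair_def emit_set_def emit_trees_def emit_candidates_def
      emit_tree_def emit_tree_verts_def emit_tree_edges_def)

lemma val_pos [simp]:
  "0 < val (differ e f) s \<longleftrightarrow> val e s \<noteq> val f s" "0 < val (neg e) s \<longleftrightarrow> val e s = 0"
  using val_differ[of e f s] val_neg[of e s] by linarith+

lemma emits_eq: "emits s c \<sigma> xs \<Longrightarrow> xs = ys \<Longrightarrow> emits s c \<sigma> ys"
  by simp

lemma emits_singleton: "val e (mem_of s \<sigma>) = v \<Longrightarrow> emits s (push e) \<sigma> [v]"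
  using emits_push[of s e \<sigma>] by simp

lemma same_but_mono: "same_but A \<sigma> \<tau> \<Longrightarrow> A \<subseteq> C \<Longrightarrow> same_but C \<sigma> \<tau>"
  unfolding same_but_def by blast

lemma same_but_comp: "same_but A \<sigma> \<tau> \<Longrightarrow> same_but B \<tau> \<rho> \<Longrightarrow> same_but (A \<union> B) \<sigma> \<rho>"
  by (simp add: same_but_def)

lemma same_but_trans: "same_but A \<sigma> \<tau> \<Longrightarrow> same_but B \<tau> \<rho> \<Longrightarrow> A \<union> B \<subseteq> C \<Longrightarrow> same_but C \<sigma> \<rho>"
  using same_but_mono[OF same_but_comp] .

lemma same_but_upd: "same_but A \<sigma> \<tau> \<Longrightarrow> k \<in> A \<Longrightarrow> same_but A \<sigma> (upd \<tau> k i j v)"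
  unfolding same_but_def by (metis upd_other)

lemma same_but_writes: "same_but (writes c) \<sigma> (run s c \<sigma>)"
  by (simp add: same_but_def run_frame)

context input_graph
begin

definition tree_code :: "nat set \<Rightarrow> nat set \<Rightarrow> nat \<Rightarrow> nat \<Rightarrow> tree_code" where
  "tree_code S D d1 d2 =
     (concat (map (\<lambda>v. if v \<in> S \<or> v = d1 \<or> v = d2 then [v] else []) [0..<n + 2]),
      (if d1 \<noteq> d2 then [(d1, d2)] else []) @
      concat (map (\<lambda>v. if v \<in> S \<and> v \<noteq> d1 \<and> v \<noteq> d2 then [(v, if v \<in> D then d1 else d2)] else []) [0..<n]))"

text \<open>The nested concatenations mirror the loops of \<open>emit_trees\<close>, so that
  \<open>appends_For\<close> applies directly. These are of order \<open>n ^ 3\<close> trees of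
  linear size.\<close>

definition candidate_trees :: "nat \<Rightarrow> nat \<Rightarrow> tree_code list" where
  "candidate_trees a b = (let S = nbrs G a \<inter> nbrs G b in
     [([], [])] @ concat (map (\<lambda>d1. concat (map (\<lambda>d2.
       concat (map (\<lambda>w. [tree_code S (nbrs G w) d1 d2]) [0..<n]) @
       concat (map (\<lambda>f. [tree_code S (side_set G S a f d1) d1 d2] @
         [tree_code S (side_set G S b f d1) d1 d2]) [0..<n + 1])) [0..<n + 2])) [0..<n + 1]))"

definition set_code :: "nat set \<Rightarrow> nat list" where
  "set_code S = concat (map (\<lambda>v. if v \<in> S then [v] else []) [0..<n])"

lemma emits_emit_set:
  assumes "bits SEP n \<sigma> S"
  shows "emits s emit_set \<sigma> (enc_vertices (set_code S))"
  unfolding emit_set_def enc_vertices_def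
proof (rule emits_open_list)
  let ?c = "Cond (elem1 SEP (var LV)) (count HL ;; push (var LV)) Nop"
  let ?\<sigma> = "run s (open_list HL) \<sigma>"
  have "appends s HL (\<lambda>v. [v]) (For LV n_exp ?c) ?\<sigma>
      (concat (map (\<lambda>v. if v \<in> S then [v] else []) [0..<val n_exp s]))"
  proof (rule appends_For)
    fix i \<tau> assume i: "i < val n_exp s" and sb: "same_but (insert LV (writes ?c)) ?\<sigma> \<tau>"
    have "\<tau> SEP = \<sigma> SEP" using sb by (simp add: same_but_def run_frame)
    then show "appends s HL (\<lambda>v. [v]) ?c (upd \<tau> LV 0 0 i) (if i \<in> S then [i] else [])"
      using assms i
      by (intro appends_Cond appends_Nop appends_item emits_singleton) (auto simp: bits_def run_frame)
  qed auto
  then show "appends s HL (\<lambda>v. [v]) (For LV n_exp ?c) ?\<sigma> (set_code S)" by (simp add: set_code_def)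
qed auto

lemma emits_emit_tree_verts:
  assumes "bits SEP (n + 2) \<sigma> S"
  shows "emits s emit_tree_verts \<sigma> (enc_vertices (fst (tree_code S D (\<sigma> LD1 0 0) (\<sigma> LD2 0 0))))"
  unfolding emit_tree_verts_def enc_vertices_def
proof (rule emits_open_list)
  let ?c = "Cond (Add (elem1 SEP (var LV)) (Add (neg (differ (var LV) (var LD1))) (neg (differ (var LV) (var LD2)))))
        (count HL ;; push (var LV)) Nop"
  let ?\<sigma> = "run s (open_list HL) \<sigma>"
  let ?P = "\<lambda>v. v \<in> S \<or> v = \<sigma> LD1 0 0 \<or> v = \<sigma> LD2 0 0"
  have "appends s HL (\<lambda>v. [v]) (For LV (Add n_exp (Const 2)) ?c) ?\<sigma>
      (concat (map (\<lambda>v. if ?P v then [v] else []) [0..<val (Add n_exp (Const 2)) s]))"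
  proof (rule appends_For)
    fix i \<tau> assume i: "i < val (Add n_exp (Const 2)) s" and sb: "same_but (insert LV (writes ?c)) ?\<sigma> \<tau>"
    have "\<tau> SEP = \<sigma> SEP" "\<tau> LD1 = \<sigma> LD1" "\<tau> LD2 = \<sigma> LD2"
      using sb by (simp_all add: same_but_def run_frame)
    then show "appends s HL (\<lambda>v. [v]) ?c (upd \<tau> LV 0 0 i) (if ?P i then [i] else [])"
      using assms i
      by (intro appends_Cond appends_Nop appends_item emits_singleton) (auto simp: bits_def run_frame)
  qed auto
  then show "appends s HL (\<lambda>v. [v]) (For LV (Add n_exp (Const 2)) ?c) ?\<sigma>
      (fst (tree_code S D (\<sigma> LD1 0 0) (\<sigma> LD2 0 0)))"
    by (simp add: tree_code_def)
qed auto

lemma emits_emit_tree_edges: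
  assumes "bits SEP (n + 2) \<sigma> S"
    and c: "\<And>\<tau>. same_but {OUT, PTR, HL, LV} \<sigma> \<tau> \<Longrightarrow> \<tau> LV 0 0 < n \<Longrightarrow>
      val c (mem_of s \<tau>) \<noteq> 0 \<longleftrightarrow> \<tau> LV 0 0 \<in> D"
  shows "emits s (emit_tree_edges c) \<sigma> (enc_edges (snd (tree_code S D (\<sigma> LD1 0 0) (\<sigma> LD2 0 0))))"
  unfolding emit_tree_edges_def enc_edges_def
proof (rule emits_open_list)
  let ?f = "\<lambda>(u::nat, v::nat). [u, v]"
  let ?e = "Cond (differ (var LD1) (var LD2)) (count HL ;; (push (var LD1) ;; push (var LD2))) Nop"
  let ?c = "Cond (Mul (elem1 SEP (var LV)) (Mul (differ (var LV) (var LD1)) (differ (var LV) (var LD2))))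
          (count HL ;; (push (var LV) ;; Cond c (push (var LD1)) (push (var LD2)))) Nop"
  let ?\<sigma> = "run s (open_list HL) \<sigma>"
  let ?d1 = "\<sigma> LD1 0 0" and ?d2 = "\<sigma> LD2 0 0"
  let ?P = "\<lambda>v. v \<in> S \<and> v \<noteq> ?d1 \<and> v \<noteq> ?d2"
  let ?y = "\<lambda>v. (v, if v \<in> D then ?d1 else ?d2)"
  have 1: "appends s HL ?f ?e ?\<sigma> (if ?d1 \<noteq> ?d2 then [(?d1, ?d2)] else [])"
  proof (intro appends_Cond appends_Nop appends_item)
    let ?\<tau> = "run s (count HL) ?\<sigma>"
    show "emits s (push (var LD1) ;; push (var LD2)) ?\<tau> (?f (?d1, ?d2))"
      by (rule emits_eq[OF emits_Then[OF emits_singleton emits_singleton]]) (auto simp: run_frame)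
  qed (auto simp: run_frame)
  have 2: "appends s HL ?f (For LV n_exp ?c) (run s ?e ?\<sigma>)
      (concat (map (\<lambda>v. if ?P v then [?y v] else []) [0..<val n_exp s]))"
  proof (rule appends_For)
    fix i \<tau> assume i: "i < val n_exp s" and sb: "same_but (insert LV (writes ?c)) (run s ?e ?\<sigma>) \<tau>"
    have sb': "same_but {OUT, PTR, HL, LV} \<sigma> (upd \<tau> LV 0 0 i)"
    proof (rule same_but_upd)
      show "same_but {OUT, PTR, HL, LV} \<sigma> \<tau>"
        by (rule same_but_trans[OF same_but_comp[OF same_but_writes same_but_writes] sb]) auto
    qed simp
    then have fr: "\<tau> SEP = \<sigma> SEP" "\<tau> LD1 = \<sigma> LD1" "\<tau> LD2 = \<sigma> LD2"
      by (simp_all add: same_but_def)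
    show "appends s HL ?f ?c (upd \<tau> LV 0 0 i) (if ?P i then [?y i] else [])"
    proof (intro appends_Cond appends_Nop appends_item)
      show "val (Mul (elem1 SEP (var LV)) (Mul (differ (var LV) (var LD1)) (differ (var LV) (var LD2))))
          (mem_of s (upd \<tau> LV 0 0 i)) \<noteq> 0 \<longleftrightarrow> ?P i"
        using fr assms(1) i by (auto simp: bits_def)
      let ?\<tau> = "run s (count HL) (upd \<tau> LV 0 0 i)"
      have v: "val (var LV) (mem_of s ?\<tau>) = i" by (simp add: run_frame)
      have "emits s (Cond c (push (var LD1)) (push (var LD2))) (run s (push (var LV)) ?\<tau>)
          [if i \<in> D then ?d1 else ?d2]"
      proof (rule emits_Cond)
        have "same_but {OUT, PTR, HL, LV} \<sigma> (run s (push (var LV)) ?\<tau>)"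
          by (rule same_but_trans[OF sb' same_but_comp[OF same_but_writes same_but_writes]]) auto
        moreover have "run s (push (var LV)) ?\<tau> LV 0 0 = i" by (simp add: run_frame)
        ultimately show "val c (mem_of s (run s (push (var LV)) ?\<tau>)) \<noteq> 0 \<longleftrightarrow> i \<in> D"
          using c[of "run s (push (var LV)) ?\<tau>"] i by simp
        show "emits s (push (var LD1)) (run s (push (var LV)) ?\<tau>) [if i \<in> D then ?d1 else ?d2]" if "i \<in> D"
          using that fr by (intro emits_singleton) (simp add: run_frame)
        show "emits s (push (var LD2)) (run s (push (var LV)) ?\<tau>) [if i \<in> D then ?d1 else ?d2]" if "i \<notin> D"
          using that fr by (intro emits_singleton) (simp add: run_frame)
      qed
      from emits_Then[OF emits_singleton[OF v] this]
      show "emits s (push (var LV) ;; Cond c (push (var LD1)) (push (var LD2))) ?\<tau> (?f (?y i))"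
        by simp
    qed auto
  qed auto
  show "appends s HL ?f (?e ;; For LV n_exp ?c) ?\<sigma> (snd (tree_code S D ?d1 ?d2))"
    using appends_Then[OF 1 2] by (simp add: tree_code_def)
qed auto

lemma emits_emit_tree:
  assumes "bits SEP (n + 2) \<sigma> S" "\<sigma> LD1 0 0 = d1" "\<sigma> LD2 0 0 = d2"
    and c: "\<And>\<tau>. same_but {OUT, PTR, HL, LV} \<sigma> \<tau> \<Longrightarrow> \<tau> LV 0 0 < n \<Longrightarrow>
      val c (mem_of s \<tau>) \<noteq> 0 \<longleftrightarrow> \<tau> LV 0 0 \<in> D"
  shows "emits s (emit_tree c) \<sigma> (enc_tree (tree_code S D d1 d2))"
proof -
  let ?\<sigma> = "run s emit_tree_verts \<sigma>"
  have sb: "same_but {OUT, PTR, HL, LV} \<sigma> ?\<sigma>" by (rule same_but_mono[OF same_but_writes]) auto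
  have "bits SEP (n + 2) ?\<sigma> S" "?\<sigma> LD1 0 0 = d1" "?\<sigma> LD2 0 0 = d2"
    using assms(1-3) by (simp_all add: bits_def run_frame)
  then have "emits s (emit_tree_edges c) ?\<sigma> (enc_edges (snd (tree_code S D d1 d2)))"
    using emits_emit_tree_edges[of ?\<sigma> S c D] c same_but_trans[OF sb] by fastforce
  from emits_Then[OF emits_emit_tree_verts[OF assms(1), of D] this]
  show ?thesis using assms(2,3) by (simp add: emit_tree_def enc_tree_def)
qed

lemma emits_emit_trees:
  assumes sep: "bits SEP (n + 2) \<sigma> S" and adj: "adj_ok \<sigma>"
    and mark: "bits MARK_A n \<sigma> {v. marked G S a v}" "bits MARK_B n \<sigma> {v. marked G S b v}"
    and link: "\<And>v u. v < n \<Longrightarrow> u \<le> n \<Longrightarrow> \<sigma> LINK v u = of_bool (linked G S v u)"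
    and S: "S = nbrs G a \<inter> nbrs G b"
  shows "emits s emit_trees \<sigma> (enc enc_tree (candidate_trees a b))"
  unfolding emit_trees_def
proof (rule emits_open_list)
  let ?A = "{HT, HL, OUT, PTR, LV, LF, LD1, LD2}"
  let ?\<sigma> = "run s (open_list HT) \<sigma>"
  let ?e = "count HT ;; (push (Const 0) ;; push (Const 0))"
  have tree: "emits s (emit_tree (elem ADJ (var LF) (var LV))) \<tau> (enc_tree (tree_code S (nbrs G (\<tau> LF 0 0)) (\<tau> LD1 0 0) (\<tau> LD2 0 0)))"
    "emits s (emit_tree (side_exp MARK_A)) \<tau>
      (enc_tree (tree_code S (side_set G S a (\<tau> LF 0 0) (\<tau> LD1 0 0)) (\<tau> LD1 0 0) (\<tau> LD2 0 0)))"
    "emits s (emit_tree (side_exp MARK_B)) \<tau>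
      (enc_tree (tree_code S (side_set G S b (\<tau> LF 0 0) (\<tau> LD1 0 0)) (\<tau> LD1 0 0) (\<tau> LD2 0 0)))"
    if \<tau>: "same_but ?A \<sigma> \<tau>" "\<tau> LD1 0 0 \<le> n" for \<tau>
  proof -
    have fr: "\<tau> SEP = \<sigma> SEP" "\<tau> ADJ = \<sigma> ADJ" "\<tau> MARK_A = \<sigma> MARK_A" "\<tau> MARK_B = \<sigma> MARK_B" "\<tau> LINK = \<sigma> LINK"
      using \<tau>(1) by (simp_all add: same_but_def)
    have SEP: "bits SEP (n + 2) \<tau> S" using sep fr by (simp add: bits_def)
    have v: "val (elem ADJ (var LF) (var LV)) (mem_of s \<rho>) \<noteq> 0 \<longleftrightarrow> \<rho> LV 0 0 \<in> nbrs G (\<tau> LF 0 0)"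
      "val (side_exp MARK_A) (mem_of s \<rho>) \<noteq> 0 \<longleftrightarrow> \<rho> LV 0 0 \<in> side_set G S a (\<tau> LF 0 0) (\<tau> LD1 0 0)"
      "val (side_exp MARK_B) (mem_of s \<rho>) \<noteq> 0 \<longleftrightarrow> \<rho> LV 0 0 \<in> side_set G S b (\<tau> LF 0 0) (\<tau> LD1 0 0)"
      if \<rho>: "same_but {OUT, PTR, HL, LV} \<tau> \<rho>" "\<rho> LV 0 0 < n" for \<rho>
    proof -
      have fr': "\<rho> ADJ = \<sigma> ADJ" "\<rho> MARK_A = \<sigma> MARK_A" "\<rho> MARK_B = \<sigma> MARK_B" "\<rho> LINK = \<sigma> LINK"
        "\<rho> LF = \<tau> LF" "\<rho> LD1 = \<tau> LD1"
        using \<rho>(1) fr by (simp_all add: same_but_def)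
      show "val (elem ADJ (var LF) (var LV)) (mem_of s \<rho>) \<noteq> 0 \<longleftrightarrow> \<rho> LV 0 0 \<in> nbrs G (\<tau> LF 0 0)"
        using adj fr' by (simp add: adj_ok_def)
      show "val (side_exp MARK_A) (mem_of s \<rho>) \<noteq> 0 \<longleftrightarrow> \<rho> LV 0 0 \<in> side_set G S a (\<tau> LF 0 0) (\<tau> LD1 0 0)"
        "val (side_exp MARK_B) (mem_of s \<rho>) \<noteq> 0 \<longleftrightarrow> \<rho> LV 0 0 \<in> side_set G S b (\<tau> LF 0 0) (\<tau> LD1 0 0)"
        using mark link[OF \<rho>(2) \<tau>(2)] fr' \<rho>(2) by (auto simp: bits_def side_exp_def side_set_def)
    qed
    show "emits s (emit_tree (elem ADJ (var LF) (var LV))) \<tau> (enc_tree (tree_code S (nbrs G (\<tau> LF 0 0)) (\<tau> LD1 0 0) (\<tau> LD2 0 0)))"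
      by (rule emits_emit_tree[OF SEP refl refl v(1)])
    show "emits s (emit_tree (side_exp MARK_A)) \<tau>
      (enc_tree (tree_code S (side_set G S a (\<tau> LF 0 0) (\<tau> LD1 0 0)) (\<tau> LD1 0 0) (\<tau> LD2 0 0)))"
      by (rule emits_emit_tree[OF SEP refl refl v(2)])
    show "emits s (emit_tree (side_exp MARK_B)) \<tau>
      (enc_tree (tree_code S (side_set G S b (\<tau> LF 0 0) (\<tau> LD1 0 0)) (\<tau> LD1 0 0) (\<tau> LD2 0 0)))"
      by (rule emits_emit_tree[OF SEP refl refl v(3)])
  qed
  let ?cand = "\<lambda>d1 d2. concat (map (\<lambda>w. [tree_code S (nbrs G w) d1 d2]) [0..<val n_exp s]) @
       concat (map (\<lambda>f. [tree_code S (side_set G S a f d1) d1 d2] @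
         [tree_code S (side_set G S b f d1) d1 d2]) [0..<val (Add n_exp (Const 1)) s])"
  have cand: "appends s HT enc_tree emit_candidates \<tau> (?cand (\<tau> LD1 0 0) (\<tau> LD2 0 0))"
    if \<tau>: "same_but ?A \<sigma> \<tau>" "\<tau> LD1 0 0 \<le> n" for \<tau>
    unfolding emit_candidates_def
  proof (rule appends_Then)
    let ?c = "count HT ;; emit_tree (elem ADJ (var LF) (var LV))"
    let ?d = "(count HT ;; emit_tree (side_exp MARK_A)) ;; (count HT ;; emit_tree (side_exp MARK_B))"
    let ?\<tau> = "run s (For LF n_exp ?c) \<tau>"
    show "appends s HT enc_tree (For LF n_exp ?c) \<tau>
        (concat (map (\<lambda>w. [tree_code S (nbrs G w) (\<tau> LD1 0 0) (\<tau> LD2 0 0)]) [0..<val n_exp s]))"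
    proof (rule appends_For)
      fix i \<rho> assume \<rho>: "same_but (insert LF (writes ?c)) \<tau> \<rho>"
      let ?\<rho> = "run s (count HT) (upd \<rho> LF 0 0 i)"
      have "same_but ?A \<sigma> (upd \<rho> LF 0 0 i)"
        by (rule same_but_upd[OF same_but_trans[OF \<tau>(1) \<rho>]]) auto
      then have sb: "same_but ?A \<sigma> ?\<rho>" by (rule same_but_trans[OF _ same_but_writes]) auto
      have "?\<rho> LF 0 0 = i" "?\<rho> LD1 0 0 = \<tau> LD1 0 0" "?\<rho> LD2 0 0 = \<tau> LD2 0 0"
        using \<rho> by (simp_all add: run_frame same_but_def)
      then show "appends s HT enc_tree ?c (upd \<rho> LF 0 0 i) [tree_code S (nbrs G i) (\<tau> LD1 0 0) (\<tau> LD2 0 0)]"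
        using tree(1)[OF sb] \<tau>(2) by (intro appends_item) auto
    qed auto
    show "appends s HT enc_tree (For LF (Add n_exp (Const 1)) ?d) ?\<tau>
        (concat (map (\<lambda>f. [tree_code S (side_set G S a f (\<tau> LD1 0 0)) (\<tau> LD1 0 0) (\<tau> LD2 0 0)] @
         [tree_code S (side_set G S b f (\<tau> LD1 0 0)) (\<tau> LD1 0 0) (\<tau> LD2 0 0)]) [0..<val (Add n_exp (Const 1)) s]))"
    proof (rule appends_For)
      fix i \<rho> assume \<rho>: "same_but (insert LF (writes ?d)) ?\<tau> \<rho>"
      let ?\<rho> = "upd \<rho> LF 0 0 i"
      have \<tau>': "same_but (insert LF (writes ?d)) \<tau> ?\<tau>" by (rule same_but_mono[OF same_but_writes]) auto
      have \<rho>': "same_but (insert LF (writes ?d)) \<tau> \<rho>" by (rule same_but_trans[OF \<tau>' \<rho>]) auto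
      have sb0: "same_but ?A \<sigma> ?\<rho>"
        by (rule same_but_upd[OF same_but_trans[OF \<tau>(1) \<rho>']]) auto
      have vars: "?\<rho> LF 0 0 = i" "?\<rho> LD1 0 0 = \<tau> LD1 0 0" "?\<rho> LD2 0 0 = \<tau> LD2 0 0"
        using \<rho>' by (simp_all add: same_but_def)
      show "appends s HT enc_tree ?d ?\<rho>
        ([tree_code S (side_set G S a i (\<tau> LD1 0 0)) (\<tau> LD1 0 0) (\<tau> LD2 0 0)] @
         [tree_code S (side_set G S b i (\<tau> LD1 0 0)) (\<tau> LD1 0 0) (\<tau> LD2 0 0)])"
      proof (intro appends_Then appends_item)
        let ?\<rho>1 = "run s (count HT) ?\<rho>"
        have "same_but ?A \<sigma> ?\<rho>1" by (rule same_but_trans[OF sb0 same_but_writes]) auto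
        moreover have "?\<rho>1 LF 0 0 = i" "?\<rho>1 LD1 0 0 = \<tau> LD1 0 0" "?\<rho>1 LD2 0 0 = \<tau> LD2 0 0"
          using vars by (simp_all add: run_frame)
        ultimately show "emits s (emit_tree (side_exp MARK_A)) ?\<rho>1
            (enc_tree (tree_code S (side_set G S a i (\<tau> LD1 0 0)) (\<tau> LD1 0 0) (\<tau> LD2 0 0)))"
          using tree(2)[of ?\<rho>1] \<tau>(2) by simp
        let ?\<rho>2 = "run s (count HT) (run s (count HT ;; emit_tree (side_exp MARK_A)) ?\<rho>)"
        have "same_but ?A \<sigma> ?\<rho>2"
          by (rule same_but_trans[OF sb0 same_but_comp[OF same_but_writes same_but_writes]]) auto
        moreover have "?\<rho>2 LF 0 0 = i" "?\<rho>2 LD1 0 0 = \<tau> LD1 0 0" "?\<rho>2 LD2 0 0 = \<tau> LD2 0 0"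
          using vars by (simp_all add: run_frame)
        ultimately show "emits s (emit_tree (side_exp MARK_B)) ?\<rho>2
            (enc_tree (tree_code S (side_set G S b i (\<tau> LD1 0 0)) (\<tau> LD1 0 0) (\<tau> LD2 0 0)))"
          using tree(3)[of ?\<rho>2] \<tau>(2) by simp
      qed auto
    qed auto
  qed auto
  have inner: "appends s HT enc_tree (For LD2 (Add n_exp (Const 2)) emit_candidates) \<tau>
      (concat (map (\<lambda>d2. ?cand (\<tau> LD1 0 0) d2) [0..<val (Add n_exp (Const 2)) s]))"
    if \<tau>: "same_but ?A \<sigma> \<tau>" "\<tau> LD1 0 0 \<le> n" for \<tau>
  proof (rule appends_For)
    fix i \<rho> assume \<rho>: "same_but (insert LD2 (writes emit_candidates)) \<tau> \<rho>"
    have "same_but ?A \<sigma> (upd \<rho> LD2 0 0 i)"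
      by (rule same_but_upd[OF same_but_trans[OF \<tau>(1) \<rho>]]) auto
    moreover have "upd \<rho> LD2 0 0 i LD1 0 0 = \<tau> LD1 0 0" "upd \<rho> LD2 0 0 i LD2 0 0 = i"
      using \<rho> by (simp_all add: same_but_def)
    ultimately show "appends s HT enc_tree emit_candidates (upd \<rho> LD2 0 0 i) (?cand (\<tau> LD1 0 0) i)"
      using cand[of "upd \<rho> LD2 0 0 i"] \<tau>(2) by simp
  qed auto
  have 2: "appends s HT enc_tree (For LD1 (Add n_exp (Const 1)) (For LD2 (Add n_exp (Const 2)) emit_candidates))
      (run s ?e ?\<sigma>)
      (concat (map (\<lambda>d1. concat (map (\<lambda>d2. ?cand d1 d2) [0..<val (Add n_exp (Const 2)) s]))
        [0..<val (Add n_exp (Const 1)) s]))"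
  proof (rule appends_For)
    fix i \<rho> assume i: "i < val (Add n_exp (Const 1)) s"
      and \<rho>: "same_but (insert LD1 (writes (For LD2 (Add n_exp (Const 2)) emit_candidates))) (run s ?e ?\<sigma>) \<rho>"
    have "same_but ?A \<sigma> (run s ?e ?\<sigma>)" by (rule same_but_trans[OF same_but_writes same_but_writes]) auto
    have "same_but ?A \<sigma> (upd \<rho> LD1 0 0 i)"
      by (rule same_but_upd[OF same_but_trans[OF \<open>same_but ?A \<sigma> (run s ?e ?\<sigma>)\<close> \<rho>]]) auto
    then show "appends s HT enc_tree (For LD2 (Add n_exp (Const 2)) emit_candidates) (upd \<rho> LD1 0 0 i)
        (concat (map (\<lambda>d2. ?cand i d2) [0..<val (Add n_exp (Const 2)) s]))"
      using inner[of "upd \<rho> LD1 0 0 i"] i by simp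
  qed auto
  have 1: "appends s HT enc_tree ?e ?\<sigma> [([], [])]"
    by (intro appends_item emits_eq[OF emits_Then[OF emits_singleton[OF val.simps(1)] emits_singleton[OF val.simps(1)]]])
      (auto simp: enc_tree_def enc_vertices_def enc_edges_def enc_def)
  show "appends s HT enc_tree (?e ;; For LD1 (Add n_exp (Const 1)) (For LD2 (Add n_exp (Const 2)) emit_candidates))
      ?\<sigma> (candidate_trees a b)"
    using appends_Then[OF 1 2] by (simp add: candidate_trees_def Let_def S[symmetric])
qed auto

subsection \<open>Processing all pairs\<close>

definition sep_of :: "nat \<times> nat \<Rightarrow> nat set" where
  "sep_of p = nbrs G (s (2 + fst p)) \<inter> nbrs G (snd p)"

definition valid :: "nat \<times> nat \<Rightarrow> bool" where
  "valid p \<longleftrightarrow> separates G (sep_of p) (s (2 + fst p)) (snd p)"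

definition entry :: "nat \<times> nat \<Rightarrow> nat list \<times> tree_code list" where
  "entry p = (set_code (sep_of p), candidate_trees (s (2 + fst p)) (snd p))"

definition extend :: "(nat \<times> nat) list \<Rightarrow> nat \<times> nat \<Rightarrow> (nat \<times> nat) list" where
  "extend L p = (if valid p \<and> sep_of p \<notin> sep_of ` set L then L @ [p] else L)"

text \<open>L lists the pairs whose entries have been written. The length cell of the collection is
  the very first output cell, hence the value 0 of \<open>HC\<close>.\<close>

definition state_ok :: "arrays \<Rightarrow> (nat \<times> nat) list \<Rightarrow> bool" where
  "state_ok \<sigma> L \<longleftrightarrow> adj_ok \<sigma> \<and> \<sigma> HC 0 0 = 0 \<and> outs \<sigma> = enc_collection (map entry L) \<and>
     (\<forall>i b. \<sigma> EMITTED i b = of_bool ((i, b) \<in> set L)) \<and> set L \<subseteq> {..<2 * m} \<times> {..<n}"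

lemma endpoint_less:
  assumes "i < 2 * m"
  shows "s (2 + i) < n"
proof -
  have e: "{s (2 + 2 * j), s (3 + 2 * j)} \<in> edges G" if "j < m" for j
    using that edge_listed[of "s (2 + 2 * j)" "s (3 + 2 * j)"] by blast
  have "i div 2 < m" "i = 2 * (i div 2) \<or> i = 2 * (i div 2) + 1" using assms by auto
  then show ?thesis using edge_in[OF e[of "i div 2"]] by (auto simp: eval_nat_numeral) 
qed

lemma process_pair:
  assumes ok: "state_ok \<sigma> L" and p: "\<sigma> LI 0 0 = i" "i < 2 * m" "\<sigma> LB 0 0 = b" "b < n"
  shows "state_ok (run s process_pair \<sigma>) (extend L (i, b))"
proof -
  define a where "a = s (2 + i)"
  define S where "S = nbrs G a \<inter> nbrs G b"
  have S: "sep_of (i, b) = S" by (simp add: sep_of_def S_def a_def)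
  have an: "a < n" using endpoint_less p by (simp add: a_def)
  have SV: "S \<subseteq> {..<n}" using edge_in by (auto simp: S_def nbrs_def)
  have aS: "a \<in> {..<n} - S" "b \<in> {..<n} - S"
    using an p(4) edge_in[of a a] edge_in[of b b] by (auto simp: S_def nbrs_def)
  have valid: "valid (i, b) \<longleftrightarrow> b \<notin> component G S a"
    using aS unfolding valid_def S separates_iff verts_G a_def by auto
  have \<sigma>: "adj_ok \<sigma>" "\<sigma> HC 0 0 = 0" "outs \<sigma> = enc_collection (map entry L)"
    "\<And>i b. \<sigma> EMITTED i b = of_bool ((i, b) \<in> set L)" "set L \<subseteq> {..<2 * m} \<times> {..<n}"
    using ok by (auto simp: state_ok_def)
  define \<sigma>1 where "\<sigma>1 = run s find_common_nbrs \<sigma>"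
  define \<sigma>2 where "\<sigma>2 = run s (find_component REACH_A (endpoint LI)) \<sigma>1"
  define \<sigma>3 where "\<sigma>3 = run s find_duplicate \<sigma>2"
  \<comment> \<open>All arrays but the five named ones are scratch space, recomputed for every
    pair.\<close>
  have keep: "state_ok \<tau> L"
    if "same_but (- {ADJ, HC, OUT, PTR, EMITTED}) \<sigma> \<tau>" for \<tau>
    using that ok by (simp add: state_ok_def same_but_def adj_ok_def outs_def)
  have sep1: "bits SEP (n + 2) \<sigma>1 S"
    using find_common_nbrs[OF \<sigma>(1)] p by (simp add: \<sigma>1_def S_def a_def)
  then have sep1': "bits SEP n \<sigma>1 S" by (simp add: bits_def)
  have adj1: "adj_ok \<sigma>1" using \<sigma>(1) by (simp add: adj_ok_def \<sigma>1_def run_frame)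
  have reach_a: "bits REACH_A n \<sigma>2 (component G S a)"
    unfolding \<sigma>2_def
  proof (rule find_component[OF adj1 sep1'])
    fix \<tau> assume "same_but {REACH_A, LV} \<sigma>1 \<tau>"
    then have "\<tau> LI 0 0 = i" using p by (simp add: same_but_def \<sigma>1_def run_frame)
    then show "val (endpoint LI) (mem_of s \<tau>) = a" using p by (simp add: a_def)
  qed (use aS in auto)
  have sb1: "same_but {SEP, LV} \<sigma> \<sigma>1" unfolding \<sigma>1_def by (rule same_but_mono[OF same_but_writes]) auto
  have sb2: "same_but {SEP, LV, REACH_A, LU, LR} \<sigma> \<sigma>2"
    unfolding \<sigma>2_def by (rule same_but_trans[OF sb1 same_but_writes]) auto
  have sep2: "bits SEP (n + 2) \<sigma>2 S" using sep1 by (simp add: \<sigma>2_def bits_def run_frame)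
  then have sep2': "bits SEP n \<sigma>2 S" by (simp add: bits_def)
  have adj2: "adj_ok \<sigma>2" using \<sigma>(1) sb2 by (simp add: adj_ok_def same_but_def)
  have b2: "val (elem1 REACH_A (var LB)) (mem_of s \<sigma>2) \<noteq> 0 \<longleftrightarrow> \<not> valid (i, b)"
    using reach_a p sb2 valid by (simp add: same_but_def bits_def)
  show ?thesis
  proof (cases "valid (i, b)")
    case False
    then have "run s process_pair \<sigma> = \<sigma>2"
      using b2 by (simp add: process_pair_def \<sigma>1_def[symmetric] \<sigma>2_def[symmetric])
    moreover have "same_but (- {ADJ, HC, OUT, PTR, EMITTED}) \<sigma> \<sigma>2" using sb2 by (auto simp: same_but_def)
    ultimately show ?thesis using keep False by (simp add: extend_def)
  next
    case True
    have sb3: "same_but {SEP, LV, REACH_A, LU, LR, DUP, DIFF, LI', LB'} \<sigma> \<sigma>3"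
      unfolding \<sigma>3_def by (rule same_but_trans[OF sb2 same_but_writes]) auto
    have "\<sigma>2 EMITTED = \<sigma> EMITTED" using sb2 by (simp add: same_but_def)
    then have "\<sigma>2 EMITTED i b = of_bool ((i, b) \<in> set L)" for i b using \<sigma>(4) by simp
    then have "\<sigma>3 DUP 0 0 \<noteq> 0 \<longleftrightarrow> (\<exists>i<2 * m. \<exists>b<n. (i, b) \<in> set L \<and> S = sep_of (i, b))"
      using find_duplicate[OF adj2 sep2' SV] unfolding \<sigma>3_def[symmetric]
      by (auto simp: sep_of_def)
    also have "\<dots> \<longleftrightarrow> S \<in> sep_of ` set L" using \<sigma>(5) by blast
    finally have dup: "\<sigma>3 DUP 0 0 \<noteq> 0 \<longleftrightarrow> S \<in> sep_of ` set L" .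
    show ?thesis
    proof (cases "S \<in> sep_of ` set L")
      case dupl: True
      then have "run s process_pair \<sigma> = \<sigma>3"
        using b2 True dup by (simp add: process_pair_def \<sigma>1_def[symmetric] \<sigma>2_def[symmetric] \<sigma>3_def[symmetric])
      moreover have "same_but (- {ADJ, HC, OUT, PTR, EMITTED}) \<sigma> \<sigma>3" using sb3 by (auto simp: same_but_def)
      ultimately show ?thesis using keep dupl S by (simp add: extend_def)
    next
      case new: False
      define \<sigma>4 where "\<sigma>4 = upd \<sigma>3 EMITTED i b 1"
      define \<sigma>5 where "\<sigma>5 = run s (find_component REACH_B (var LB)) \<sigma>4"
      define \<sigma>6 where "\<sigma>6 = run s find_incomplete \<sigma>5"
      define \<sigma>7 where "\<sigma>7 = run s (find_marked MARK_A REACH_A) \<sigma>6"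
      define \<sigma>8 where "\<sigma>8 = run s (find_marked MARK_B REACH_B) \<sigma>7"
      define \<sigma>9 where "\<sigma>9 = run s find_linked \<sigma>8"
      have LI3: "\<sigma>3 LI 0 0 = i" "\<sigma>3 LB 0 0 = b" using sb3 p by (simp_all add: same_but_def)
      have put: "run s (Put EMITTED (var LI) (var LB) (Const 1)) \<sigma>3 = \<sigma>4"
        using LI3 by (simp add: \<sigma>4_def)
      have run: "run s process_pair \<sigma> = run s (count HC ;; (emit_set ;; emit_trees)) \<sigma>9"
        using b2 True dup new put
        by (simp add: process_pair_def \<sigma>1_def[symmetric] \<sigma>2_def[symmetric] \<sigma>3_def[symmetric]
            \<sigma>5_def[symmetric] \<sigma>6_def[symmetric] \<sigma>7_def[symmetric] \<sigma>8_def[symmetric] \<sigma>9_def[symmetric]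
            del: run.simps(2))
      have sb4: "same_but {SEP, LV, REACH_A, LU, LR, DUP, DIFF, LI', LB', EMITTED} \<sigma> \<sigma>4"
        using sb3 by (auto simp: \<sigma>4_def same_but_def)
      have sep4: "\<sigma>4 SEP = \<sigma>2 SEP" "\<sigma>4 REACH_A = \<sigma>2 REACH_A" by (simp_all add: \<sigma>4_def \<sigma>3_def run_frame)
      have sep: "\<sigma>5 SEP = \<sigma>2 SEP" "\<sigma>6 SEP = \<sigma>2 SEP" "\<sigma>7 SEP = \<sigma>2 SEP" "\<sigma>8 SEP = \<sigma>2 SEP" "\<sigma>9 SEP = \<sigma>2 SEP"
        "\<sigma>6 REACH_A = \<sigma>2 REACH_A"
        by (simp_all add: \<sigma>5_def \<sigma>6_def \<sigma>7_def \<sigma>8_def \<sigma>9_def run_frame sep4)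
      have "\<sigma>4 ADJ = \<sigma> ADJ" using sb4 by (simp add: same_but_def)
      then have adj: "adj_ok \<sigma>4" "adj_ok \<sigma>5" "adj_ok \<sigma>6" "adj_ok \<sigma>7" "adj_ok \<sigma>8" "adj_ok \<sigma>9"
        using \<sigma>(1) by (simp_all add: adj_ok_def \<sigma>5_def \<sigma>6_def \<sigma>7_def \<sigma>8_def \<sigma>9_def run_frame)
      have reach_b: "bits REACH_B n \<sigma>5 (component G S b)"
        unfolding \<sigma>5_def
      proof (rule find_component[OF adj(1)])
        show "bits SEP n \<sigma>4 S" using sep2' by (simp add: bits_def sep4)
        fix \<tau> assume "same_but {REACH_B, LV} \<sigma>4 \<tau>"
        then have "\<tau> LB 0 0 = b" using p sb4 by (simp add: same_but_def)
        then show "val (var LB) (mem_of s \<tau>) = b" by simp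
      qed (use aS in auto)
      have "bits SEP n \<sigma>5 S" using sep2' by (simp add: bits_def sep)
      then have inc: "bits INC n \<sigma>6 {p. incomplete G S p}"
        unfolding \<sigma>6_def using find_incomplete[OF adj(2) _ SV] by blast
      have mark_a: "bits MARK_A n \<sigma>7 {v. marked G S a v}"
        unfolding \<sigma>7_def by (rule find_marked[OF adj(3) inc]) (use reach_a in \<open>auto simp: bits_def sep\<close>)
      have mark_b: "bits MARK_B n \<sigma>8 {v. marked G S b v}"
        unfolding \<sigma>8_def
      proof (rule find_marked[OF adj(4)])
        show "bits INC n \<sigma>7 {p. incomplete G S p}" using inc by (simp add: \<sigma>7_def bits_def run_frame)
        show "bits REACH_B n \<sigma>7 (component G S b)" using reach_b by (simp add: \<sigma>7_def \<sigma>6_def bits_def run_frame)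
      qed auto
      have "bits INC n \<sigma>8 {p. incomplete G S p}" using inc by (simp add: \<sigma>8_def \<sigma>7_def bits_def run_frame)
      then have link: "\<sigma>9 LINK v u = of_bool (linked G S v u)" if "v < n" "u \<le> n" for v u
        unfolding \<sigma>9_def using find_linked[OF adj(5) _ that] by blast
      have em_set: "emits s emit_set (run s (count HC) \<sigma>9) (enc_vertices (set_code S))"
        by (rule emits_emit_set) (use sep2' sep in \<open>simp add: bits_def run_frame\<close>)
      have em_trees: "emits s emit_trees (run s emit_set (run s (count HC) \<sigma>9)) (enc enc_tree (candidate_trees a b))"
        by (rule emits_emit_trees[OF _ _ _ _ _ S_def])
          (use sep2 sep adj mark_a mark_b link in
            \<open>simp_all add: bits_def run_frame adj_ok_def \<sigma>8_def \<sigma>9_def\<close>)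
      let ?f = "\<lambda>(ss, \<tau>s). enc_vertices ss @ enc enc_tree \<tau>s"
      have "appends s HC ?f (count HC ;; (emit_set ;; emit_trees)) \<sigma>9 [entry (i, b)]"
      proof (rule appends_item)
        show "emits s (emit_set ;; emit_trees) (run s (count HC) \<sigma>9) (?f (entry (i, b)))"
          using emits_Then[OF em_set em_trees] by (simp add: entry_def S a_def)
      qed auto
      moreover have fr9: "\<sigma>9 l = \<sigma> l" if "l \<in> {OUT, PTR, HC, ADJ}" for l
      proof -
        have "\<sigma>4 l = \<sigma> l" using that sb4 by (auto simp: same_but_def)
        then show ?thesis using that by (auto simp: \<sigma>5_def \<sigma>6_def \<sigma>7_def \<sigma>8_def \<sigma>9_def run_frame)
      qed
      have "outs \<sigma>9 = [] @ length L # concat (map ?f (map entry L))"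
        using \<sigma>(3) fr9 by (simp add: outs_def enc_collection_def enc_def)
      moreover have "\<sigma>9 HC 0 0 = length []" using \<sigma>(2) fr9 by simp
      ultimately have "outs (run s process_pair \<sigma>) =
          [] @ (length L + length [entry (i, b)]) # concat (map ?f (map entry L)) @ concat (map ?f [entry (i, b)])"
        unfolding run appends_def by blast
      then have o: "outs (run s process_pair \<sigma>) = enc_collection (map entry (L @ [(i, b)]))"
        by (simp add: enc_collection_def enc_def)
      have "\<sigma>9 EMITTED = \<sigma>4 EMITTED" by (simp add: \<sigma>5_def \<sigma>6_def \<sigma>7_def \<sigma>8_def \<sigma>9_def run_frame)
      moreover have "run s process_pair \<sigma> EMITTED = \<sigma>9 EMITTED" unfolding run by (subst run_frame) auto
      moreover have "\<sigma>3 EMITTED = \<sigma> EMITTED" using sb3 by (simp add: same_but_def)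
      ultimately have e: "run s process_pair \<sigma> EMITTED i' b' = of_bool ((i', b') \<in> set (L @ [(i, b)]))" for i' b'
        using \<sigma>(4) by (simp add: \<sigma>4_def)
      have "run s process_pair \<sigma> ADJ = \<sigma> ADJ" "run s process_pair \<sigma> HC = \<sigma> HC"
        by (rule run_frame, rule writes_process_pair, simp)+
      then have "state_ok (run s process_pair \<sigma>) (L @ [(i, b)])"
        using o e \<sigma> p by (simp add: state_ok_def adj_ok_def)
      then show ?thesis using True new S by (simp add: extend_def)
    qed
  qed
qed

text \<open>A is the set of pairs processed so far; L keeps the first valid pair for each
  separator.\<close>

definition complete_list :: "(nat \<times> nat) set \<Rightarrow> (nat \<times> nat) list \<Rightarrow> bool" where
  "complete_list A L \<longleftrightarrow> (\<forall>p\<in>set L. valid p) \<and> distinct (map sep_of L) \<and>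
     (\<forall>p\<in>A. valid p \<longrightarrow> sep_of p \<in> sep_of ` set L)"

lemma complete_list_extend: "complete_list A L \<Longrightarrow> complete_list (insert p A) (extend L p)"
  by (auto simp: complete_list_def extend_def)

lemma separator_program:
  obtains L where "outs (run s separator_program (\<lambda>_ _ _. 0)) = enc_collection (map entry L)"
    "complete_list ({..<2 * m} \<times> {..<n}) L"
proof -
  let ?\<sigma> = "run s (open_list HC) (run s read_edges (\<lambda>_ _ _. 0))"
  let ?I = "\<lambda>A \<tau>. \<exists>L. state_ok \<tau> L \<and> complete_list A L"
  have z: "run s read_edges (\<lambda>_ _ _. 0) l = (\<lambda>_ _. 0)" if "l \<notin> {ADJ, LI}" for l
    using that by (subst run_frame) auto
  have "outs ?\<sigma> = [0]" using z[of PTR] z[of OUT]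
    by (simp add: open_list_def outs_push) (simp add: outs_def)
  moreover have "adj_ok ?\<sigma>" using read_edges by (simp add: adj_ok_def run_frame)
  moreover have "?\<sigma> HC 0 0 = 0" using z[of PTR] by (simp add: open_list_def run_frame)
  ultimately have "state_ok ?\<sigma> []"
    using z[of EMITTED] by (simp add: state_ok_def run_frame enc_collection_def enc_def)
  then have init: "?I ({..<0} \<times> {..<n}) ?\<sigma>" by (intro exI[of _ "[]"]) (simp add: complete_list_def)
  have upd: "state_ok (upd \<tau> k 0 0 i) L" if "state_ok \<tau> L" "k \<in> {LI, LB}" for \<tau> k i L
    using that by (auto simp: state_ok_def adj_ok_def)
  have step: "?I ({..<Suc i} \<times> {..<n}) (run s (For LB n_exp process_pair) \<tau>)"
    if i: "i < 2 * m" "\<tau> LI 0 0 = i" and I: "?I ({..<i} \<times> {..<n}) \<tau>" for i \<tau>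
  proof -
    let ?A = "\<lambda>j. {..<i} \<times> {..<n} \<union> {i} \<times> {..<j}"
    have "\<exists>\<rho>. ?I (?A (val n_exp s)) \<rho> \<and> run s (For LB n_exp process_pair) \<tau> = upd \<rho> LB 0 0 (val n_exp s)"
    proof (rule For_frame_rule[where I = "\<lambda>j. ?I (?A j)"])
      fix j \<rho> assume j: "j < val n_exp s" and sb: "same_but (insert LB (writes process_pair)) \<tau> \<rho>"
        and "?I (?A j) \<rho>"
      then obtain L where L: "state_ok \<rho> L" "complete_list (?A j) L" by blast
      have "\<rho> LI 0 0 = i" using sb i(2) writes_process_pair[of LI] by (simp add: same_but_def)
      then have "state_ok (run s process_pair (upd \<rho> LB 0 0 j)) (extend L (i, j))"
        using process_pair[of "upd \<rho> LB 0 0 j" L i j] upd[OF L(1)] i(1) j by simp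
      moreover have "?A (Suc j) = insert (i, j) (?A j)" by auto
      ultimately show "?I (?A (Suc j)) (run s process_pair (upd \<rho> LB 0 0 j))"
        using complete_list_extend[OF L(2), of "(i, j)"] by metis
    qed (use I in simp)
    then obtain \<rho> L where \<rho>: "state_ok \<rho> L" "complete_list (?A n) L"
      "run s (For LB n_exp process_pair) \<tau> = upd \<rho> LB 0 0 n" by auto
    have "?A n = {..<Suc i} \<times> {..<n}" by auto
    then have "complete_list ({..<Suc i} \<times> {..<n}) L" using \<rho>(2) by simp
    moreover have "state_ok (run s (For LB n_exp process_pair) \<tau>) L" unfolding \<rho>(3) using upd[OF \<rho>(1)] by simp
    ultimately show ?thesis by blast
  qed
  have "\<exists>\<tau>. ?I ({..<val (Mul (Const 2) m_exp) s} \<times> {..<n}) \<tau> \<and>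
      run s (For LI (Mul (Const 2) m_exp) (For LB n_exp process_pair)) ?\<sigma> = upd \<tau> LI 0 0 (val (Mul (Const 2) m_exp) s)"
  proof (rule For_rule[where I = "\<lambda>i. ?I ({..<i} \<times> {..<n})"])
    fix i \<tau> assume i: "i < val (Mul (Const 2) m_exp) s" and "?I ({..<i} \<times> {..<n}) \<tau>"
    then have "?I ({..<i} \<times> {..<n}) (upd \<tau> LI 0 0 i)" using upd by blast
    then show "?I ({..<Suc i} \<times> {..<n}) (run s (For LB n_exp process_pair) (upd \<tau> LI 0 0 i))"
      using step[of i "upd \<tau> LI 0 0 i"] i by simp
  qed (rule init)
  then obtain \<tau> L where "state_ok \<tau> L" "complete_list ({..<2 * m} \<times> {..<n}) L"
    "run s separator_program (\<lambda>_ _ _. 0) = upd \<tau> LI 0 0 (2 * m)"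
    unfolding separator_program_def run.simps(3) by fastforce
  then show ?thesis using that[of L] by (simp add: state_ok_def)
qed

end

section \<open>Running time\<close>

text \<open>Running time of order \<open>n ^ i * m ^ j\<close> on inputs with at least one edge.
  There \<open>n ^ i * m ^ j\<close> is at least 1 and absorbs constants, and m can be traded for
  \<open>n ^ 2\<close>.\<close>

definition time_degree :: "stmt \<Rightarrow> nat \<Rightarrow> nat \<Rightarrow> bool" where
  "time_degree c i j \<longleftrightarrow>
     (\<exists>C. \<forall>s. 1 \<le> s 1 \<and> s 1 \<le> s 0 * s 0 \<longrightarrow> time s c \<le> C * (s 0 ^ i * s 1 ^ j))"

lemma time_degree_const:
  assumes "\<And>s. time s c = K"
  shows "time_degree c i j"
  unfolding time_degree_def
proof (intro exI[of _ K] allI impI)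
  fix s :: mem assume s: "1 \<le> s 1 \<and> s 1 \<le> s 0 * s 0"
  then have "1 \<le> s 0" by (cases "s 0") auto
  then have "1 \<le> s 0 ^ i * s 1 ^ j" using s by simp
  then show "time s c \<le> K * (s 0 ^ i * s 1 ^ j)" using assms by simp
qed

lemma time_degree_Nop: "time_degree Nop i j"
  by (rule time_degree_const) simp

lemma time_degree_Put: "time_degree (Put k e f g) i j"
  by (rule time_degree_const) simp

lemma time_degree_Then:
  assumes "time_degree c i j" "time_degree d i j"
  shows "time_degree (c ;; d) i j"
proof -
  obtain C D where "\<forall>s. 1 \<le> s 1 \<and> s 1 \<le> s 0 * s 0 \<longrightarrow> time s c \<le> C * (s 0 ^ i * s 1 ^ j)"
    "\<forall>s. 1 \<le> s 1 \<and> s 1 \<le> s 0 * s 0 \<longrightarrow> time s d \<le> D * (s 0 ^ i * s 1 ^ j)"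
    using assms unfolding time_degree_def by blast
  then have "\<forall>s. 1 \<le> s 1 \<and> s 1 \<le> s 0 * s 0 \<longrightarrow> time s (c ;; d) \<le> (C + D) * (s 0 ^ i * s 1 ^ j)"
    unfolding time.simps add_mult_distrib using add_mono by blast
  then show ?thesis unfolding time_degree_def by blast
qed

lemma time_degree_Cond:
  assumes "time_degree c i j" "time_degree d i j"
  shows "time_degree (Cond b c d) i j"
proof -
  obtain C where C: "\<forall>s. 1 \<le> s 1 \<and> s 1 \<le> s 0 * s 0 \<longrightarrow> time s (c ;; d) \<le> C * (s 0 ^ i * s 1 ^ j)"
    using time_degree_Then[OF assms] unfolding time_degree_def by blast
  show ?thesis unfolding time_degree_def
  proof (intro exI[of _ "C + (1 + cost b)"] allI impI)
    fix s :: mem assume s: "1 \<le> s 1 \<and> s 1 \<le> s 0 * s 0"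
    then have "1 \<le> s 0" by (cases "s 0") auto
    then have "1 \<le> s 0 ^ i * s 1 ^ j" using s by simp
    then have "1 + cost b \<le> (1 + cost b) * (s 0 ^ i * s 1 ^ j)" by (metis mult.right_neutral mult_le_mono2)
    moreover have "time s (c ;; d) \<le> C * (s 0 ^ i * s 1 ^ j)" using C s by blast
    ultimately show "time s (Cond b c d) \<le> (C + (1 + cost b)) * (s 0 ^ i * s 1 ^ j)"
      unfolding add_mult_distrib[of C] by simp
  qed
qed

lemma time_degree_For:
  assumes c: "time_degree c i j" and b: "\<And>s. 1 \<le> s 0 \<Longrightarrow> val b s \<le> K * (s 0 ^ p * s 1 ^ q)"
  shows "time_degree (For k b c) (i + p) (j + q)"
proof -
  obtain C where C: "\<forall>s. 1 \<le> s 1 \<and> s 1 \<le> s 0 * s 0 \<longrightarrow> time s c \<le> C * (s 0 ^ i * s 1 ^ j)"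
    using c unfolding time_degree_def by blast
  show ?thesis unfolding time_degree_def
  proof (intro exI[of _ "(cost b + 100) * (K + 1) + K * C"] allI impI)
    fix s :: mem assume s: "1 \<le> s 1 \<and> s 1 \<le> s 0 * s 0"
    then have s0: "1 \<le> s 0" by (cases "s 0") auto
    let ?x = "s 0 ^ i * s 1 ^ j" and ?y = "s 0 ^ p * s 1 ^ q"
    have xy: "1 \<le> ?x" "1 \<le> ?y" using s s0 by simp_all
    have b': "val b s \<le> K * ?y" using b[of s] s0 by simp
    have "?y \<le> ?x * ?y" using xy(1) by (cases ?x) simp_all
    then have "K * ?y \<le> K * (?x * ?y)" by (rule mult_le_mono2)
    moreover have "1 \<le> ?x * ?y" using xy mult_le_mono[of 1 ?x 1 ?y] by simp
    ultimately have "val b s + 1 \<le> (K + 1) * (?x * ?y)"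
      using b' unfolding add_mult_distrib by linarith
    then have "(cost b + 100) * (val b s + 1) \<le> (cost b + 100) * ((K + 1) * (?x * ?y))"
      by (rule mult_le_mono2)
    moreover have "val b s * time s c \<le> (K * ?y) * (C * ?x)"
      using b' C s by (intro mult_le_mono) auto
    moreover have "((cost b + 100) * (K + 1) + K * C) * (s 0 ^ (i + p) * s 1 ^ (j + q)) =
        (cost b + 100) * ((K + 1) * (?x * ?y)) + (K * ?y) * (C * ?x)"
      by (simp add: power_add algebra_simps)
    ultimately show "time s (For k b c) \<le> ((cost b + 100) * (K + 1) + K * C) * (s 0 ^ (i + p) * s 1 ^ (j + q))"
      by simp
  qed
qed

lemma time_degree_For_n: "time_degree c i j \<Longrightarrow> time_degree (For k n_exp c) (Suc i) j"
  using time_degree_For[of c i j n_exp 1 1 0 k] by simp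

lemma time_degree_For_Suc: "time_degree c i j \<Longrightarrow> time_degree (For k (Add n_exp (Const r)) c) (Suc i) j"
proof -
  have "s 0 + r \<le> (r + 1) * s 0" if "1 \<le> s 0" for s :: mem
    using that mult_le_mono2[of 1 "s 0" r] by simp
  then show "time_degree c i j \<Longrightarrow> time_degree (For k (Add n_exp (Const r)) c) (Suc i) j"
    using time_degree_For[of c i j "Add n_exp (Const r)" "r + 1" 1 0 k] by simp
qed

lemma time_degree_For_edges: "time_degree c i j \<Longrightarrow> time_degree (For k (Mul (Const r) m_exp) c) i (Suc j)"
  using time_degree_For[of c i j "Mul (Const r) m_exp" r 0 1 k] by simp

lemma time_degree_For_m: "time_degree c i j \<Longrightarrow> time_degree (For k m_exp c) i (Suc j)"
  using time_degree_For[of c i j m_exp 1 0 1 k] by simp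

lemma time_degree_edges_squared:
  assumes "time_degree c i (Suc j)"
  shows "time_degree c (Suc (Suc i)) j"
proof -
  obtain C where C: "\<forall>s. 1 \<le> s 1 \<and> s 1 \<le> s 0 * s 0 \<longrightarrow> time s c \<le> C * (s 0 ^ i * s 1 ^ Suc j)"
    using assms unfolding time_degree_def by blast
  show ?thesis unfolding time_degree_def
  proof (intro exI[of _ C] allI impI)
    fix s :: mem assume s: "1 \<le> s 1 \<and> s 1 \<le> s 0 * s 0"
    have "s 0 ^ i * s 1 ^ Suc j = (s 0 ^ i * s 1 ^ j) * s 1" by simp
    also have "\<dots> \<le> (s 0 ^ i * s 1 ^ j) * (s 0 * s 0)" using s by (intro mult_le_mono2) simp
    also have "\<dots> = s 0 ^ Suc (Suc i) * s 1 ^ j" by (simp add: algebra_simps)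
    finally have "C * (s 0 ^ i * s 1 ^ Suc j) \<le> C * (s 0 ^ Suc (Suc i) * s 1 ^ j)" by (rule mult_le_mono2)
    then show "time s c \<le> C * (s 0 ^ Suc (Suc i) * s 1 ^ j)" using C s order_trans by blast
  qed
qed

lemmas time_degree_rules = time_degree_Nop time_degree_Put time_degree_Then time_degree_Cond
  time_degree_For_n time_degree_For_Suc

text \<open>The order is \<open>n ^ 2 * m\<close>, and the factor m is traded for
  \<open>n ^ 2\<close>. Exponents are in unary notation so that the loop rules match by
  unification.\<close>

lemma time_degree_find_duplicate: "time_degree find_duplicate (Suc (Suc (Suc (Suc 0)))) 0"
  unfolding find_duplicate_def
  by (intro time_degree_rules time_degree_edges_squared[OF time_degree_For_edges])

lemma time_degree_process_pair: "time_degree process_pair (Suc (Suc (Suc (Suc 0)))) 0"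
  unfolding process_pair_def emit_trees_def emit_candidates_def emit_tree_def
    emit_tree_verts_def emit_tree_edges_def emit_set_def open_list_def count_def push_def
    find_common_nbrs_def find_component_def spread_round_def find_incomplete_def find_marked_def find_linked_def
  by (intro time_degree_find_duplicate time_degree_rules)

lemma time_degree_separator_program: "time_degree separator_program (Suc (Suc (Suc (Suc (Suc 0))))) (Suc 0)"
  unfolding separator_program_def read_edges_def open_list_def push_def
  by (intro time_degree_rules time_degree_For_m time_degree_For_edges time_degree_process_pair)

section \<open>The collection of candidates\<close>

lemma tree_empty: "tree ({}, {})"
  by (auto simp: tree_def simple_graph_def connected_graph_def acyclic_graph_def)

lemma set_concat_map_iff: "x \<in> set (concat (map f xs)) \<longleftrightarrow> (\<exists>y\<in>set xs. x \<in> set (f y))"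
  by auto

lemma concat_filter: "set (concat (map (\<lambda>v. if P v then [f v] else []) xs)) = f ` {v \<in> set xs. P v}"
  by auto

context input_graph
begin

lemma decode_tree_code:
  assumes "S \<subseteq> {..<n}" "d1 < n + 2" "d2 < n + 2"
  shows "decode (tree_code S D d1 d2) = bistar S D d1 d2"
proof -
  have "{v \<in> set [0..<n + 2]. v \<in> S \<or> v = d1 \<or> v = d2} = insert d1 (insert d2 S)"
    using assms by auto
  then have 1: "set (fst (tree_code S D d1 d2)) = insert d1 (insert d2 S)"
    unfolding tree_code_def fst_conv concat_filter by simp
  have "{v \<in> set [0..<n]. v \<in> S \<and> v \<noteq> d1 \<and> v \<noteq> d2} = S - {d1, d2}"
    using assms(1) by auto
  then have "set (snd (tree_code S D d1 d2)) = (if d1 \<noteq> d2 then {(d1, d2)} else {}) \<union>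
      (\<lambda>v. (v, if v \<in> D then d1 else d2)) ` (S - {d1, d2})"
    unfolding tree_code_def snd_conv set_append concat_filter by simp
  then have "edge_sets (snd (tree_code S D d1 d2)) = (if d1 = d2 then {} else {{d1, d2}}) \<union>
      (\<lambda>v. {v, if v \<in> D then d1 else d2}) ` (S - {d1, d2})"
    unfolding edge_sets_def image_Un image_image by auto
  then show ?thesis using 1 by (simp add: decode_def bistar_def)
qed

lemma sep_of_subset: "sep_of p \<subseteq> {..<n}"
  using edge_in by (auto simp: sep_of_def nbrs_def)

lemma set_fst_entry: "set (fst (entry p)) = sep_of p"
  using sep_of_subset[of p] concat_filter[of "\<lambda>v. v \<in> sep_of p" "\<lambda>v. v" "[0..<n]"]
  by (auto simp: entry_def set_code_def)

lemma candidate_trees_cases: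
  assumes "\<tau> \<in> set (candidate_trees a b)"
  obtains "\<tau> = ([], [])"
  | D d1 d2 where "\<tau> = tree_code (nbrs G a \<inter> nbrs G b) D d1 d2" "d1 < n + 2" "d2 < n + 2"
proof (cases "\<tau> = ([], [])")
  case False
  let ?S = "nbrs G a \<inter> nbrs G b"
  let ?X = "\<lambda>d1 d2. concat (map (\<lambda>w. [tree_code ?S (nbrs G w) d1 d2]) [0..<n]) @
       concat (map (\<lambda>f. [tree_code ?S (side_set G ?S a f d1) d1 d2] @
         [tree_code ?S (side_set G ?S b f d1) d1 d2]) [0..<n + 1])"
  have "\<tau> \<in> set [([], [])] \<or> (\<exists>d1\<in>set [0..<n + 1]. \<exists>d2\<in>set [0..<n + 2]. \<tau> \<in> set (?X d1 d2))"
    using assms unfolding candidate_trees_def Let_def set_append Un_iff set_concat_map_iff .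
  moreover have "\<tau> \<notin> set [([], [])]" using False by simp
  ultimately obtain d1 d2 where d: "d1 \<in> set [0..<n + 1]" "d2 \<in> set [0..<n + 2]"
    and "\<tau> \<in> set (?X d1 d2)"
    by blast
  then obtain D where "\<tau> = tree_code ?S D d1 d2" by auto
  moreover have "d1 < n + 2" "d2 < n + 2" using d unfolding set_upt by auto
  ultimately show ?thesis using that(2) by blast
qed (use that in blast)

lemma candidate_treesI:
  assumes "d1 < n + 1" "d2 < n + 2"
    and "(\<exists>w<n. D = nbrs G w) \<or> (\<exists>e\<in>{a, b}. \<exists>f<n + 1. D = side_set G (nbrs G a \<inter> nbrs G b) e f d1)"
  shows "tree_code (nbrs G a \<inter> nbrs G b) D d1 d2 \<in> set (candidate_trees a b)"
proof -
  let ?S = "nbrs G a \<inter> nbrs G b"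
  let ?X = "\<lambda>d1 d2. concat (map (\<lambda>w. [tree_code ?S (nbrs G w) d1 d2]) [0..<n]) @
       concat (map (\<lambda>f. [tree_code ?S (side_set G ?S a f d1) d1 d2] @
         [tree_code ?S (side_set G ?S b f d1) d1 d2]) [0..<n + 1])"
  have "tree_code ?S D d1 d2 \<in> set (?X d1 d2)"
    using assms(3)
  proof (elim disjE exE bexE conjE)
    fix w assume "w < n" "D = nbrs G w"
    then show ?thesis by auto
  next
    fix e f assume "e \<in> {a, b}" "f < n + 1" "D = side_set G ?S e f d1"
    moreover from this have "f \<in> set [0..<n + 1]" unfolding set_upt by simp
    ultimately show ?thesis unfolding set_append Un_iff set_concat_map_iff by auto
  qed
  moreover have "d1 \<in> set [0..<n + 1]" "d2 \<in> set [0..<n + 2]" using assms(1,2) by auto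
  ultimately have "\<exists>d1'\<in>set [0..<n + 1]. \<exists>d2'\<in>set [0..<n + 2]. tree_code ?S D d1 d2 \<in> set (?X d1' d2')"
    by blast
  then show ?thesis
    unfolding candidate_trees_def Let_def set_append Un_iff set_concat_map_iff by blast
qed

lemma covers:
  assumes L: "complete_list ({..<2 * m} \<times> {..<n}) L" and m: "0 < m"
    and T: "well_structured G T" and S: "S \<in> minimal_separators G"
  shows "\<exists>H\<in>family (map entry L) S. steiner_equivalent (verts G) T\<langle>S\<rangle> H"
proof -
  interpret T: steiner_tree T G
    using T simple_G by unfold_locales (auto simp: well_structured_def steiner_root_def)
  obtain a b where ab: "separates G S a b" "S = nbrs G a \<inter> nbrs G b"
    using T.minimal_separator_is_common_nbrs[OF S] .
  \<comment> \<open>The program takes a from the endpoints of edges, so a needs a neighbour. A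
    nonempty S provides one. For empty S, let u be an endpoint of any edge: u is not connected to
    both a and b, so it is separated from one of them by the empty set.\<close>
  have "\<exists>a b. separates G S a b \<and> S = nbrs G a \<inter> nbrs G b \<and> nbrs G a \<noteq> {}"
  proof (cases "S = {}")
    case False
    then show ?thesis using ab by blast
  next
    case True
    have "edges G \<noteq> {}" using card_edges m by auto
    then obtain e where e: "e \<in> edges G" by blast
    then have "card e = 2" using simple_G by (simp add: simple_graph_def)
    then obtain u v where "e = {u, v}" by (meson card_2_iff)
    with e have uv: "{u, v} \<in> edges G" by simp
    have uV: "u \<in> verts G - {}" using edge_in[OF uv] verts_G by simp
    have "\<exists>c\<in>{a, b}. c \<notin> component G {} u"
    proof (rule ccontr)
      assume "\<not> ?thesis"
      then have "b \<in> component G {} a" using component_trans[OF component_sym, of a G "{}" u b] by blast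
      then show False using ab(1) True by (simp add: separates_iff)
    qed
    then obtain c where c: "c \<in> {a, b}" "c \<notin> component G {} u" by blast
    then have sep: "separates G {} u c" using ab(1) True uV by (auto simp: separates_iff)
    have "nbrs G u \<inter> nbrs G c \<subseteq> verts G" using edge_in[of u] verts_G by (auto simp: nbrs_def)
    from common_nbrs_subset[OF sep this] have "nbrs G u \<inter> nbrs G c \<subseteq> {}" .
    then show ?thesis using sep uv True by (intro exI[of _ u] exI[of _ c]) (auto simp: nbrs_def)
  qed
  then obtain a b v where ab: "separates G S a b" "S = nbrs G a \<inter> nbrs G b" "{a, v} \<in> edges G"
    by (auto simp: nbrs_def)
  obtain i where i: "i < 2 * m" "s (2 + i) = a" using endpoint_of_edge[OF ab(3)] by blast
  have "b < n" using ab(1) verts_G by (auto simp: separates_iff)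
  moreover have "sep_of (i, b) = S" "valid (i, b)" using i ab by (simp_all add: sep_of_def valid_def)
  ultimately have "S \<in> sep_of ` set L" using L i(1) by (force simp: complete_list_def)
  \<comment> \<open>The entry for S may stem from another pair with the same common neighbourhood.
    As \<open>marked\<close> depends on the pair, the candidates are justified for the pair that was
    recorded.\<close>
  then obtain p where p: "p \<in> set L" "S = sep_of p" by blast
  then have "valid p" using L by (simp add: complete_list_def)
  define a b where "a = s (2 + fst p)" and "b = snd p"
  have S: "S = nbrs G a \<inter> nbrs G b" using p(2) by (simp add: sep_of_def a_def b_def)
  have "separates G S a b" using \<open>valid p\<close> p(2) by (simp add: valid_def a_def b_def)
  then interpret C: common_neighbourhood T G S a b by unfold_locales (use S in auto)
  have in_family: "decode \<tau> \<in> family (map entry L) S" if "\<tau> \<in> set (candidate_trees a b)" for \<tau>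
  proof -
    have "(fst (entry p), candidate_trees a b) \<in> set (map entry L)"
      using p(1) by (force simp: entry_def a_def b_def)
    then show ?thesis
      using that set_fst_entry[of p] p(2) unfolding family_def by blast
  qed
  have SV: "S \<subseteq> {..<n}" using sep_of_subset p(2) by simp
  have n: "n \<notin> verts G" "Suc n \<notin> verts G" using verts_G by auto
  consider "steiner_equivalent (verts G) T\<langle>S\<rangle> ({}, {})"
    | d1 d2 D where "d1 \<in> insert n (verts G)" "d2 \<in> insert n (insert (Suc n) (verts G))"
       "D \<in> nbrs G ` verts G \<or> (\<exists>e\<in>{a, b}. \<exists>f\<in>insert n (verts G). D = side_set G S e f d1)"
       "steiner_equivalent (verts G) T\<langle>S\<rangle> (bistar S D d1 d2)"
  proof -
    have "n \<noteq> Suc n" by simp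
    from C.span_candidates[OF T n this] show thesis
    proof (elim disjE bexE exE conjE)
      fix d1 d2 D assume "d1 \<in> insert n (verts G)" "d2 \<in> insert n (insert (Suc n) (verts G))"
        "D \<in> nbrs G ` verts G" "steiner_equivalent (verts G) T\<langle>S\<rangle> (bistar S D d1 d2)"
      then show thesis using that(2) by blast
    next
      fix d1 d2 D e f assume "d1 \<in> insert n (verts G)" "d2 \<in> insert n (insert (Suc n) (verts G))"
        "e \<in> {a, b}" "f \<in> insert n (verts G)" "D = side_set G S e f d1"
        "steiner_equivalent (verts G) T\<langle>S\<rangle> (bistar S D d1 d2)"
      then show thesis using that(2)[of d1 d2 D] by blast
    qed (rule that(1))
  qed
  then show ?thesis
  proof cases
    case 1
    have "decode ([], []) = ({}, {})" by (simp add: decode_def edge_sets_def)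
    moreover have "([], []) \<in> set (candidate_trees a b)"
      unfolding candidate_trees_def Let_def set_append by simp
    ultimately show ?thesis using 1 in_family by metis
  next
    case (2 d1 d2 D)
    have "d1 = n \<or> d1 < n" "d2 = n \<or> d2 = Suc n \<or> d2 < n"
      using 2(1,2) unfolding verts_G insert_iff lessThan_iff by blast+
    then have d: "d1 < n + 1" "d2 < n + 2" by linarith+
    have "(\<exists>w<n. D = nbrs G w) \<or> (\<exists>e\<in>{a, b}. \<exists>f<n + 1. D = side_set G (nbrs G a \<inter> nbrs G b) e f d1)"
    proof (cases "D \<in> nbrs G ` verts G")
      case True
      then show ?thesis unfolding verts_G by blast
    next
      case False
      then obtain e f where ef: "e \<in> {a, b}" "f \<in> insert n (verts G)" "D = side_set G S e f d1"
        using 2(3) by blast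
      have "f = n \<or> f < n" using ef(2) unfolding verts_G insert_iff lessThan_iff .
      then have "f < n + 1" by linarith
      then show ?thesis using ef(1,3) unfolding S by blast
    qed
    then have "tree_code S D d1 d2 \<in> set (candidate_trees a b)"
      unfolding S by (rule candidate_treesI[OF d])
    from in_family[OF this] have "bistar S D d1 d2 \<in> family (map entry L) S"
      using decode_tree_code[OF SV, of d1 d2 D] d by simp
    then show ?thesis using 2(4) by blast
  qed
qed

lemma family_trees:
  assumes "H \<in> family (map entry L) S"
  shows "tree H"
proof -
  obtain p \<tau> where H: "H = decode \<tau>" "\<tau> \<in> set (candidate_trees (s (2 + fst p)) (snd p))"
    using assms by (auto simp: family_def entry_def)
  from H(2) show ?thesis
  proof (cases rule: candidate_trees_cases)
    case 1
    then show ?thesis using H(1) tree_empty by (simp add: decode_def edge_sets_def)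
  next
    case (2 D d1 d2)
    have S: "nbrs G (s (2 + fst p)) \<inter> nbrs G (snd p) \<subseteq> {..<n}"
      using sep_of_subset[of p] by (simp add: sep_of_def)
    show ?thesis
      unfolding H(1) 2(1) decode_tree_code[OF S 2(2,3)]
      by (rule tree_bistar) (rule finite_subset[OF S finite_lessThan])
  qed
qed

lemma entries_minimal_separators:
  assumes "complete_list A L"
  shows "(set \<circ> fst) ` set (map entry L) \<subseteq> minimal_separators G"
    "distinct (map (set \<circ> fst) (map entry L))"
proof -
  have "sep_of p \<in> minimal_separators G" if "p \<in> set L" for p
    using assms that common_nbrs_minimal_separator[OF simple_G sep_of_def]
    by (simp add: complete_list_def valid_def)
  then show "(set \<circ> fst) ` set (map entry L) \<subseteq> minimal_separators G"
    using set_fst_entry by auto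
  have eq: "map (set \<circ> fst) (map entry L) = map sep_of L" using set_fst_entry by simp
  show "distinct (map (set \<circ> fst) (map entry L))"
    unfolding eq using assms by (simp add: complete_list_def)
qed

lemma input_le: "s l \<le> n + m"
proof (cases "l < 2 * m + 2")
  case True
  then consider "l = 0" | "l = 1" | i where "l = 2 + i" "i < 2 * m"
    by (metis One_nat_def Suc_1 add_2_eq_Suc less_2_cases_iff less_diff_conv2 linorder_not_less le_add_diff_inverse add.commute)
  then show ?thesis using endpoint_less by cases (auto simp: le_SucI less_imp_le trans_le_add1)
qed (simp add: s_eq)

lemma m_le: "m \<le> n * n"
proof -
  have "edges G \<subseteq> (\<lambda>(u, v). {u, v}) ` ({..<n} \<times> {..<n})"
  proof
    fix e assume "e \<in> edges G"
    moreover from this have "card e = 2" using simple_G by (simp add: simple_graph_def)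
    then obtain u v where "e = {u, v}" by (meson card_2_iff)
    ultimately show "e \<in> (\<lambda>(u, v). {u, v}) ` ({..<n} \<times> {..<n})" using edge_in[of u v] by auto
  qed
  then have "card (edges G) \<le> card ((\<lambda>(u, v). {u, v}) ` ({..<n} \<times> {..<n}))"
    by (intro card_mono) auto
  also have "\<dots> \<le> card ({..<n} \<times> {..<n})" by (intro card_image_le) auto
  finally show ?thesis using card_edges by simp
qed

lemma enc_collection_nonempty: "enc_collection coll \<noteq> []"
  by (simp add: enc_collection_def enc_def)

lemma run_with_edges:
  assumes m: "0 < m" and C: "time s separator_program \<le> C * (n ^ 5 * m)"
    and W: "(400 * (C + 5) * (n ^ 5 * m)) ^ weight (program separator_program OUT PTR LJ) \<le> W"
  shows "\<exists>t s' coll. exec W (program separator_program OUT PTR LJ) s t s' \<and>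
       t \<le> 400 * (C + 5) * (n ^ 5 * m) \<and>
       holds_output s' (enc_collection coll) \<and>
       distinct (map (set \<circ> fst) coll) \<and>
       (set \<circ> fst) ` set coll \<subseteq> minimal_separators G \<and>
       (\<forall>S\<in>minimal_separators G. \<forall>H\<in>family coll S. tree H) \<and>
       (\<forall>T. well_structured G T \<longrightarrow>
          (\<forall>S\<in>minimal_separators G. \<exists>H\<in>family coll S.
             steiner_equivalent (verts G) T\<langle>S\<rangle> H))"
proof -
  let ?\<sigma> = "run s separator_program (\<lambda>_ _ _. 0)"
  obtain L where L: "outs ?\<sigma> = enc_collection (map entry L)" "complete_list ({..<2 * m} \<times> {..<n}) L"
    by (rule separator_program)
  have ptr: "1 \<le> ?\<sigma> PTR 0 0"
    using L(1) enc_collection_nonempty[of "map entry L"] length_outs[of ?\<sigma>] by (cases "?\<sigma> PTR 0 0") auto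
  have "0 < n" using m m_le by (cases n) auto
  then have "n \<le> n ^ 5 * m" "m \<le> n ^ 5 * m" "1 \<le> n ^ 5 * m"
    using m by (auto simp: eval_nat_numeral)
  then have "n + m + time s separator_program + 2 \<le> C * (n ^ 5 * m) + 5 * (n ^ 5 * m)"
    using C by linarith
  then have "n + m + time s separator_program + 2 \<le> (C + 5) * (n ^ 5 * m)"
    by (simp only: add_mult_distrib)
  then have B: "400 * (n + m + time s separator_program + 2) \<le> 400 * (C + 5) * (n ^ 5 * m)"
    unfolding mult.assoc[of 400] by (rule mult_le_mono2)
  then have "(400 * (n + m + time s separator_program + 2)) ^ weight (program separator_program OUT PTR LJ) \<le> W"
    using power_mono[OF B] W by (meson le0 order_trans)
  from exec_program[OF proper_separator_program _ _ _ _ _ s_zero input_le refl ptr this]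
  obtain t s' where t: "exec W (program separator_program OUT PTR LJ) s t s'"
    "t \<le> 400 * (n + m + time s separator_program + 2)" "holds_output s' (outs ?\<sigma>)"
    unfolding outs_def by auto
  show ?thesis
    using t B L entries_minimal_separators[OF L(2)] family_trees covers[OF L(2) m]
    by (intro exI[of _ t] exI[of _ s'] exI[of _ "map entry L"] conjI) auto
qed

section \<open>Edgeless graphs and the final time and word bounds\<close>

lemma component_edgeless: "m = 0 \<Longrightarrow> component G S a \<subseteq> {a}"
proof
  fix v assume "m = 0" "v \<in> component G S a"
  have "finite (edges G)" using listed by (metis lists_edges_def edge_sets_def finite_imageI List.finite_set)
  then have "edges G = {}" using card_edges \<open>m = 0\<close> by simp
  with \<open>v \<in> component G S a\<close> show "v \<in> {a}" by (induction rule: component_induct) auto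
qed

text \<open>All common neighbourhoods are empty, so the empty set is the only possible minimal
  separator, and it is one as soon as there are two vertices to separate.\<close>

lemma edgeless_collection:
  assumes "m = 0"
  defines "coll \<equiv> if n < 2 then [] else [([], [([], [])])]"
  shows "distinct (map (set \<circ> fst) coll) \<and>
       (set \<circ> fst) ` set coll \<subseteq> minimal_separators G \<and>
       (\<forall>S\<in>minimal_separators G. \<forall>H\<in>family coll S. tree H) \<and>
       (\<forall>T. well_structured G T \<longrightarrow>
          (\<forall>S\<in>minimal_separators G. \<exists>H\<in>family coll S.
             steiner_equivalent (verts G) T\<langle>S\<rangle> H))"
proof (intro conjI ballI allI impI)
  have nbrs: "nbrs G u = {}" for u
  proof -
    have "finite (edges G)" using listed by (metis lists_edges_def edge_sets_def finite_imageI List.finite_set)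
    then show ?thesis using card_edges assms(1) by (simp add: nbrs_def)
  qed
  have empty: "decode ([], []) = ({}, {})" by (simp add: decode_def edge_sets_def)
  show "distinct (map (set \<circ> fst) coll)" by (simp add: coll_def)
  have "{} \<in> minimal_separators G" if "\<not> n < 2"
  proof (rule common_nbrs_minimal_separator[OF simple_G])
    show "{} = nbrs G 0 \<inter> nbrs G 1" by (simp add: nbrs)
    have "1 \<notin> component G {} 0" using component_edgeless[OF assms(1), of "{}" 0] by auto
    then show "separates G {} 0 1" using that verts_G by (simp add: separates_iff)
  qed
  then show "(set \<circ> fst) ` set coll \<subseteq> minimal_separators G" by (auto simp: coll_def)
  show "tree H" if "H \<in> family coll S" for H S
    using that tree_empty empty by (auto simp: family_def coll_def split: if_splits)
  fix T S assume T: "well_structured G T" and S: "S \<in> minimal_separators G"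
  interpret T: steiner_tree T G
    using T simple_G by unfold_locales (auto simp: well_structured_def steiner_root_def)
  obtain a b where ab: "separates G S a b" "S = nbrs G a \<inter> nbrs G b"
    using T.minimal_separator_is_common_nbrs[OF S] .
  then interpret C: common_neighbourhood T G S a b by unfold_locales
  have "S = {}" using ab(2) nbrs by simp
  moreover have "\<not> n < 2"
  proof -
    have "a < n" "b < n" using ab(1) verts_G by (auto simp: separates_iff)
    then show ?thesis using separates_not_adjacent(1)[OF ab(1)] by linarith
  qed
  then have "({}, {}) \<in> family coll {}"
    unfolding family_def coll_def using empty by force
  moreover have "steiner_equivalent (verts G) T\<langle>{}\<rangle> ({}, {})"
    using C.span_empty by (simp add: steiner_equivalent_def bij_betw_def)
  ultimately show "\<exists>H\<in>family coll S. steiner_equivalent (verts G) T\<langle>S\<rangle> H" by metis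
qed

end

text \<open>For n at least 2 the output code is 1, 0, 1, 0, 0. Placed at address 3 in zeroed memory,
  it needs writes to cells 3 and 5 only. For n below 2 the code is the single number 0, and the cell
  with address n already contains it: cell 0 holds n, cell 1 holds m = 0.\<close>

definition edgeless_program :: com where
  "edgeless_program = If (Sub (Load (Const 0)) (Const 1))
     (Seq (Store (Const 3) (Const 1)) (Seq (Store (Const 5) (Const 1)) (Store (Const 0) (Const 3)))) Skip"

lemma (in input_graph) run_edgeless:
  assumes m: "m = 0" and W: "n < W" "5 < W"
  shows "\<exists>t s'. exec W edgeless_program s t s' \<and> t \<le> 14 \<and>
    holds_output s' (enc_collection (if n < 2 then [] else [([], [([], [])])]))"
proof (cases "n < 2")
  case True
  have "exec W edgeless_program s (1 + cost (Sub (Load (Const 0)) (Const 1)) + 1) s"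
    unfolding edgeless_program_def
    by (rule exec.intros(5)[OF _ _ exec.intros(1)]) (use W True in auto)
  moreover have "s n = 0"
  proof (cases "n = 0")
    case 0: True
    have "s n = s 0" using 0 by (rule arg_cong)
    then show ?thesis using s_n 0 by linarith
  next
    case False
    then have 1: "n = Suc 0" using True by linarith
    have "s n = s (Suc 0)" using 1 by (rule arg_cong)
    then show ?thesis using s_m m by linarith
  qed
  then have "holds_output s (enc_collection [])" by (simp add: holds_output_def enc_collection_def enc_def)
  ultimately show ?thesis using True by (intro exI conjI) (assumption, simp, simp)
next
  case False
  let ?s = "(s(3 := 1))(5 := 1, 0 := 3)"
  have store: "exec W (Store (Const l) (Const v)) s' 3 (s'(l := v))" if "l < W" "v < W" for l v s'
    using exec.intros(2)[of W "Const l" s' "Const v"] that by (simp add: eval_nat_numeral)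
  have "exec W edgeless_program s (1 + cost (Sub (Load (Const 0)) (Const 1)) + (3 + (3 + 3))) ?s"
    unfolding edgeless_program_def
    by (rule exec.intros(4)[OF _ _ exec.intros(3)[OF store exec.intros(3)[OF store store]]])
      (use W False in auto)
  moreover have "s l = 0" if "2 \<le> l" for l using s_zero[of l] that m by simp
  then have "holds_output ?s (enc_collection [([], [([], [])])])"
    by (simp add: holds_output_def enc_collection_def enc_def enc_vertices_def enc_tree_def enc_edges_def
        upt_rec)
  ultimately show ?thesis using False by (intro exI conjI) (assumption, simp, simp)
qed

theorem theorem6p1:
  shows "\<exists>prog C k. \<forall>(G :: nat graph) es n m.
    simple_graph G \<and> verts G = {..<n} \<and> card (edges G) = m \<and> lists_edges es G \<longrightarrow>
    (\<exists>t s coll.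
       exec ((n + 2) ^ k) prog (input_mem n es) t s \<and>
       t \<le> C * (n ^ 5 * m + 1) \<and>
       holds_output s (enc_collection coll) \<and>
       distinct (map (set \<circ> fst) coll) \<and>
       (set \<circ> fst) ` set coll \<subseteq> minimal_separators G \<and>
       (\<forall>S\<in>minimal_separators G. \<forall>H\<in>family coll S. tree H) \<and>
       (\<forall>T. well_structured G T \<longrightarrow>
          (\<forall>S\<in>minimal_separators G. \<exists>H\<in>family coll S.
             steiner_equivalent (verts G) T\<langle>S\<rangle> H)))"
proof -
  obtain C0 where C0: "\<forall>s. 1 \<le> s 1 \<and> s 1 \<le> s 0 * s 0 \<longrightarrow>
      time s separator_program \<le> C0 * (s 0 ^ Suc (Suc (Suc (Suc (Suc 0)))) * s 1 ^ Suc 0)"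
    using time_degree_separator_program unfolding time_degree_def by blast
  let ?P = "program separator_program OUT PTR LJ"
  define C where "C = 400 * (C0 + 5)"
  \<comment> \<open>The product makes room for the polynomial bound raised to the weight of the
    program. The summand 7 guarantees that the bound exceeds 5, n and \<open>n * n\<close>, hence
    also m.\<close>
  define k where "k = (C + 7) * weight ?P + 7"
  \<comment> \<open>Without edges there are no endpoints to enumerate, and the required bound is
    constant because of the factor m; so this case has its own program.\<close>
  let ?prog = "If (Load (Const 1)) ?P edgeless_program"
  have main: "\<exists>t s' coll.
       exec ((n + 2) ^ k) ?prog (input_mem n es) t s' \<and>
       t \<le> (C + 20) * (n ^ 5 * m + 1) \<and>
       holds_output s' (enc_collection coll) \<and>
       distinct (map (set \<circ> fst) coll) \<and>
       (set \<circ> fst) ` set coll \<subseteq> minimal_separators G \<and>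
       (\<forall>S\<in>minimal_separators G. \<forall>H\<in>family coll S. tree H) \<and>
       (\<forall>T. well_structured G T \<longrightarrow>
          (\<forall>S\<in>minimal_separators G. \<exists>H\<in>family coll S.
             steiner_equivalent (verts G) T\<langle>S\<rangle> H))"
    if "simple_graph G" "verts G = {..<n}" "card (edges G) = m" "lists_edges es G" for G :: "nat graph" and es n m
  proof -
    interpret input_graph G n m es by unfold_locales (fact that)+
    have s: "input_mem n es = s" by (simp add: s_def)
    let ?W = "(n + 2) ^ k"
    have W7: "(n + 2) ^ 7 \<le> ?W" by (intro power_increasing) (auto simp: k_def)
    have "(2::nat) ^ 7 \<le> (n + 2) ^ 7" by (intro power_mono) auto
    then have "2 ^ 7 \<le> ?W" using W7 by (rule order_trans)
    then have W: "5 < ?W" by (rule less_le_trans[rotated]) simp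
    have n7: "n * n < (n + 2) ^ 7" "n < (n + 2) ^ 7"
    proof -
      have "(n + 2) ^ 2 \<le> (n + 2) ^ 7" by (intro power_increasing) auto
      moreover have "n * n < (n + 2) ^ 2" "n < (n + 2) ^ 2" by (simp_all add: power2_eq_square)
      ultimately show "n * n < (n + 2) ^ 7" "n < (n + 2) ^ 7" by linarith+
    qed
    have "m < ?W" using W7 n7(1) m_le by linarith
    then have fits: "fits ?W (Load (Const 1)) s" using W by simp
    show ?thesis
    proof (cases "m = 0")
      case True
      obtain t s' where t: "exec ?W edgeless_program s t s'" "t \<le> 14"
        "holds_output s' (enc_collection (if n < 2 then [] else [([], [([], [])])]))"
        using run_edgeless[OF True _ W] W7 n7(2) by (meson less_le_trans)
      have "val (Load (Const 1)) s = 0" using True by simp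
      from exec.intros(5)[OF fits this t(1)]
      have "exec ?W ?prog s (1 + cost (Load (Const 1)) + t) s'" .
      moreover have "1 + cost (Load (Const 1)) + t \<le> (C + 20) * (n ^ 5 * m + 1)"
        using t(2) by (simp add: algebra_simps)
      ultimately show ?thesis unfolding s using t(3) edgeless_collection[OF True] by blast
    next
      case False
      \<comment> \<open>The constant factor C is moved into the exponent of n + 2, and
        \<open>n ^ 5 * m\<close> is at most \<open>n ^ 7\<close>. This gives the exponent C + 7 in
        k.\<close>
      have "C \<le> 2 ^ C" by (rule less_imp_le[OF less_exp])
      also have "\<dots> \<le> (n + 2) ^ C" by (intro power_mono) auto
      finally have "C * (n ^ 5 * m) \<le> (n + 2) ^ C * (n ^ 5 * (n * n))"
        using m_le by (intro mult_le_mono) auto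
      also have "n ^ 5 * (n * n) = n ^ 7" by (simp add: eval_nat_numeral)
      also have "(n + 2) ^ C * n ^ 7 \<le> (n + 2) ^ C * (n + 2) ^ 7"
        by (intro mult_le_mono2 power_mono) auto
      finally have "C * (n ^ 5 * m) \<le> (n + 2) ^ (C + 7)" by (simp add: power_add)
      then have "(C * (n ^ 5 * m)) ^ weight ?P \<le> ((n + 2) ^ (C + 7)) ^ weight ?P" by (rule power_mono) simp
      also have "\<dots> \<le> ?W" unfolding power_mult[symmetric] by (intro power_increasing) (auto simp: k_def)
      finally have "(400 * (C0 + 5) * (n ^ 5 * m)) ^ weight ?P \<le> ?W" by (simp add: C_def)
      moreover have "time s separator_program \<le> C0 * (n ^ 5 * m)"
        using C0[rule_format, of s] False m_le by (simp add: eval_nat_numeral)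
      ultimately obtain t s' coll where t: "exec ?W ?P s t s'" "t \<le> C * (n ^ 5 * m)"
        and rest: "holds_output s' (enc_collection coll)"
          "distinct (map (set \<circ> fst) coll)"
          "(set \<circ> fst) ` set coll \<subseteq> minimal_separators G"
          "\<forall>S\<in>minimal_separators G. \<forall>H\<in>family coll S. tree H"
          "\<forall>T. well_structured G T \<longrightarrow> (\<forall>S\<in>minimal_separators G. \<exists>H\<in>family coll S.
             steiner_equivalent (verts G) T\<langle>S\<rangle> H)"
        using run_with_edges[of C0 ?W] False unfolding C_def by blast
      have "val (Load (Const 1)) s \<noteq> 0" using False by simp
      from exec.intros(4)[OF fits this t(1)]
      have "exec ?W ?prog s (1 + cost (Load (Const 1)) + t) s'" .
      moreover have "1 + cost (Load (Const 1)) + t \<le> (C + 20) * (n ^ 5 * m + 1)"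
        using t(2) by (simp add: algebra_simps)
      ultimately show ?thesis unfolding s using rest by blast
    qed
  qed
  then show ?thesis by blast
qed

end
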